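(* Let $R$ be a right perfect ring and $\mathcal{T}\subseteq\mathrm{Mod}\text{-}R$ a torsion class. The following are equivalent: (1) $\mathcal{T}=\mathrm{Gen}(T)$ for a silting module $T$; (2) there exists a $\mathcal{T}$-preenvelope $\epsilon:R\to M$ of the regular module $R$ such that $M\in\mathcal{T}\cap{}^\perp\mathcal{T}$. In these conditions, if $\epsilon:R\to M$ is as in (2) and $K=\mathrm{Coker}(\epsilon)$, then $M\oplus K$ is a silting module and $\mathcal{T}=\mathrm{Gen}(M\oplus K)$.
   Context: All modules are right modules over a unital ring $R$; $\mathrm{Mod}\text{-}R$ is the category of right $R$-modules. $R$ is right perfect if every right $R$-module has a projective cover. For a module $T$, $\mathrm{Gen}(T)$ is the class of all modules that are epimorphic images of direct sums of copies of $T$. For a class $\mathcal{T}$ of modules, ${}^\perp\mathcal{T}=\{X\in\mathrm{Mod}\text{-}R\mid \mathrm{Ext}^1_R(X,T)=0\text{ for all }T\in\mathcal{T}\}$. For a homomorphism $\sigma:P_{-1}\to P_0$ between projective modules, $\mathcal{D}_\sigma=\{X\in\mathrm{Mod}\text{-}R\mid \mathrm{Hom}_R(\sigma,X)\text{ is an epimorphism}\}$. A torsion class is a class of modules closed under isomorphic images, epimorphic images, direct sums and extensions. A module $T$ is silting if there is a projective presentation $P_{-1}\xrightarrow{\sigma}P_0\to T\to 0$ (exact, with $P_{-1},P_0$ projective) such that $\mathcal{D}_\sigma$ is a torsion class, $T\in\mathcal{D}_\sigma$, and $\mathcal{D}_\sigma=\mathrm{Gen}(T)$. A homomorphism $\epsilon:X\to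 T$ with $T\in\mathcal{T}$ is a $\mathcal{T}$-preenvelope of $X$ if every homomorphism $X\to T'$ with $T'\in\mathcal{T}$ factors through $\epsilon$. *)

theory Defs
  imports "HOL-Algebra.AbelCoset" "HOL-Algebra.Module" "HOL-Algebra.Elementary_Groups"
    "HOL-Library.Equipollence"
begin

section \<open>Right modules\<close>

text \<open>
  The library locale for modules requires a commutative ring of scalars. Here \<open>R\<close> is an arbitrary
  unital ring and modules are right modules; the library record is kept, so the scalar operation
  \<open>a \<odot>\<^bsub>M\<^esub> x\<close> is to be read as the right action \<open>x \<cdot> a\<close> (see \<open>smult_assoc\<close>).
  The multiplicative fields \<open>mult\<close> and \<open>one\<close> inherited by the record play no role.
\<close>

locale right_module = R?: ring R + M?: abelian_group M
  for R :: "('a, 'r) ring_scheme" (structure) and M :: "('a, 'b, 'm) module_scheme" (structure) +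
  assumes smult_closed [simp, intro]:
      "\<lbrakk>a \<in> carrier R; x \<in> carrier M\<rbrakk> \<Longrightarrow> a \<odot>\<^bsub>M\<^esub> x \<in> carrier M"
    and smult_l_distr:
      "\<lbrakk>a \<in> carrier R; b \<in> carrier R; x \<in> carrier M\<rbrakk> \<Longrightarrow>
        (a \<oplus>\<^bsub>R\<^esub> b) \<odot>\<^bsub>M\<^esub> x = a \<odot>\<^bsub>M\<^esub> x \<oplus>\<^bsub>M\<^esub> b \<odot>\<^bsub>M\<^esub> x"
    and smult_r_distr:
      "\<lbrakk>a \<in> carrier R; x \<in> carrier M; y \<in> carrier M\<rbrakk> \<Longrightarrow>
        a \<odot>\<^bsub>M\<^esub> (x \<oplus>\<^bsub>M\<^esub> y) = a \<odot>\<^bsub>M\<^esub> x \<oplus>\<^bsub>M\<^esub> a \<odot>\<^bsub>M\<^esub> y"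
    and smult_assoc:
      "\<lbrakk>a \<in> carrier R; b \<in> carrier R; x \<in> carrier M\<rbrakk> \<Longrightarrow>
        (a \<otimes>\<^bsub>R\<^esub> b) \<odot>\<^bsub>M\<^esub> x = b \<odot>\<^bsub>M\<^esub> (a \<odot>\<^bsub>M\<^esub> x)"
    and smult_one [simp]:
      "x \<in> carrier M \<Longrightarrow> \<one>\<^bsub>R\<^esub> \<odot>\<^bsub>M\<^esub> x = x"

definition regular_module :: "('a, 'r) ring_scheme \<Rightarrow> ('a, 'a) module" where
  "regular_module R = \<lparr>carrier = carrier R, monoid.mult = (\<otimes>\<^bsub>R\<^esub>), one = \<one>\<^bsub>R\<^esub>,
     ring.zero = \<zero>\<^bsub>R\<^esub>, ring.add = (\<oplus>\<^bsub>R\<^esub>), smult = (\<lambda>a x. x \<otimes>\<^bsub>R\<^esub> a)\<rparr>"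

text \<open>Homomorphisms are extensional functions, so that equality of homomorphisms is equality in HOL.\<close>

definition rhom :: "('a, 'r) ring_scheme \<Rightarrow> ('a, 'b) module \<Rightarrow> ('a, 'c) module \<Rightarrow> ('b \<Rightarrow> 'c) set" where
  "rhom R M N = {f \<in> carrier M \<rightarrow>\<^sub>E carrier N.
     (\<forall>x \<in> carrier M. \<forall>y \<in> carrier M. f (x \<oplus>\<^bsub>M\<^esub> y) = f x \<oplus>\<^bsub>N\<^esub> f y) \<and>
     (\<forall>a \<in> carrier R. \<forall>x \<in> carrier M. f (a \<odot>\<^bsub>M\<^esub> x) = a \<odot>\<^bsub>N\<^esub> f x)}"

definition epis :: "('a, 'r) ring_scheme \<Rightarrow> ('a, 'b) module \<Rightarrow> ('a, 'c) module \<Rightarrow> ('b \<Rightarrow> 'c) set" where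
  "epis R M N = {f \<in> rhom R M N. f ` carrier M = carrier N}"

definition isomorphic :: "('a, 'r) ring_scheme \<Rightarrow> ('a, 'b) module \<Rightarrow> ('a, 'c) module \<Rightarrow> bool" where
  "isomorphic R M N \<longleftrightarrow> (\<exists>f \<in> rhom R M N. bij_betw f (carrier M) (carrier N))"

definition direct_sum :: "'i set \<Rightarrow> ('i \<Rightarrow> ('a, 'b) module) \<Rightarrow> ('a, 'i \<Rightarrow> 'b) module" where
  "direct_sum I M = \<lparr>carrier = {f \<in> \<Pi>\<^sub>E i \<in> I. carrier (M i). finite {i \<in> I. f i \<noteq> \<zero>\<^bsub>M i\<^esub>}},
     monoid.mult = undefined, one = undefined,
     ring.zero = (\<lambda>i \<in> I. \<zero>\<^bsub>M i\<^esub>),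
     ring.add = (\<lambda>f g. \<lambda>i \<in> I. f i \<oplus>\<^bsub>M i\<^esub> g i),
     smult = (\<lambda>a f. \<lambda>i \<in> I. a \<odot>\<^bsub>M i\<^esub> f i)\<rparr>"

definition direct_sum2 :: "('a, 'b) module \<Rightarrow> ('a, 'c) module \<Rightarrow> ('a, 'b \<times> 'c) module" where
  "direct_sum2 M N = \<lparr>carrier = carrier M \<times> carrier N, monoid.mult = undefined, one = undefined,
     ring.zero = (\<zero>\<^bsub>M\<^esub>, \<zero>\<^bsub>N\<^esub>),
     ring.add = (\<lambda>(x, y) (x', y'). (x \<oplus>\<^bsub>M\<^esub> x', y \<oplus>\<^bsub>N\<^esub> y')),
     smult = (\<lambda>a (x, y). (a \<odot>\<^bsub>M\<^esub> x, a \<odot>\<^bsub>N\<^esub> y))\<rparr>"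

definition quotient_module :: "('a, 'b) module \<Rightarrow> 'b set \<Rightarrow> ('a, 'b set) module" where
  "quotient_module M H = \<lparr>carrier = a_rcosets\<^bsub>M\<^esub> H, monoid.mult = undefined, one = undefined,
     ring.zero = H, ring.add = (<+>\<^bsub>M\<^esub>),
     smult = (\<lambda>a C. \<Union>x \<in> C. H +>\<^bsub>M\<^esub> (a \<odot>\<^bsub>M\<^esub> x))\<rparr>"

definition cokernel :: "('a, 'b) module \<Rightarrow> ('a, 'c) module \<Rightarrow> ('b \<Rightarrow> 'c) \<Rightarrow> ('a, 'c set) module" where
  "cokernel M N f = quotient_module N (f ` carrier M)"


section \<open>The group \<open>Ext\<close> in degree one\<close>

text \<open>\<open>pullback P \<sigma>\<close> is \<open>Hom(\<sigma>, X) : Hom(Q, X) \<rightarrow> Hom(P, X)\<close> for \<open>\<sigma> : P \<rightarrow> Q\<close>.\<close>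

definition pullback :: "('a, 'b) module \<Rightarrow> ('b \<Rightarrow> 'c) \<Rightarrow> ('c \<Rightarrow> 'd) \<Rightarrow> 'b \<Rightarrow> 'd" where
  "pullback P \<sigma> g = compose (carrier P) g \<sigma>"

definition hom_group :: "('a, 'r) ring_scheme \<Rightarrow> ('a, 'b) module \<Rightarrow> ('a, 'c) module \<Rightarrow> ('b \<Rightarrow> 'c) monoid" where
  "hom_group R M N = \<lparr>carrier = rhom R M N,
     monoid.mult = (\<lambda>f g. \<lambda>x \<in> carrier M. f x \<oplus>\<^bsub>N\<^esub> g x),
     one = (\<lambda>x \<in> carrier M. \<zero>\<^bsub>N\<^esub>)\<rparr>"

definition free_module :: "('a, 'r) ring_scheme \<Rightarrow> 'x set \<Rightarrow> ('a, 'x \<Rightarrow> 'a) module" where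
  "free_module R S = direct_sum S (\<lambda>_. regular_module R)"

text \<open>The homomorphism from the free module on \<open>S \<subseteq> carrier M\<close> to \<open>M\<close> that extends the inclusion;
  its image is the submodule generated by \<open>S\<close>.\<close>

definition lincomb :: "('a, 'r) ring_scheme \<Rightarrow> ('a, 'x) module \<Rightarrow> 'x set \<Rightarrow> ('x \<Rightarrow> 'a) \<Rightarrow> 'x" where
  "lincomb R M S = (\<lambda>c \<in> carrier (free_module R S).
     finsum M (\<lambda>x. c x \<odot>\<^bsub>M\<^esub> x) {x \<in> S. c x \<noteq> \<zero>\<^bsub>R\<^esub>})"

text \<open>\<open>Ext1 R X Y\<close> is the first cohomology group of \<open>Hom(P\<^sub>\<bullet>, Y)\<close>, where
  \<open>P\<^sub>2 \<rightarrow> P\<^sub>1 \<rightarrow> P\<^sub>0 \<rightarrow> X \<rightarrow> 0\<close> is the beginning of the standard free resolution of \<open>X\<close>: at each step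
  all elements of the kernel (at first: of \<open>X\<close>) serve as generators.\<close>

definition Ext1 :: "('a, 'r) ring_scheme \<Rightarrow> ('a, 'b) module \<Rightarrow> ('a, 'c) module \<Rightarrow>
    ((('b \<Rightarrow> 'a) \<Rightarrow> 'a) \<Rightarrow> 'c) set monoid" where
  "Ext1 R X Y =
    (let P0 = free_module R (carrier X);
         d0 = lincomb R X (carrier X);
         K0 = a_kernel P0 X d0;
         P1 = free_module R K0;
         d1 = lincomb R P0 K0;
         K1 = a_kernel P1 P0 d1;
         P2 = free_module R K1;
         d2 = lincomb R P1 K1;
         cocycles = kernel (hom_group R P1 Y) (hom_group R P2 Y) (pullback P2 d2);
         coboundaries = pullback P1 d1 ` carrier (hom_group R P0 Y)
     in (hom_group R P1 Y)\<lparr>carrier := cocycles\<rparr> Mod coboundaries)"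


section \<open>The category of right modules\<close>

text \<open>
  The proper class of all right modules is modelled relative to a universe of sets, given by a
  type \<open>'u\<close>: a set is small if its cardinality is less than that of \<open>'u\<close>, and small sets
  are required to be closed under power sets and under unions of small families. Thus the cardinality
  of \<open>'u\<close> is a regular strong limit cardinal, and the small sets are, up to bijection, the members of
  a Grothendieck universe (the degenerate universe of hereditarily finite sets is not excluded).
\<close>

definition small :: "'u itself \<Rightarrow> 'x set \<Rightarrow> bool" where
  "small _ A \<longleftrightarrow> A \<prec> (UNIV :: 'u set)"

definition module_universe :: "'u itself \<Rightarrow> bool" where
  "module_universe U \<longleftrightarrow> infinite (UNIV :: 'u set) \<and>
     (\<forall>A :: 'u set. small U A \<longrightarrow> small U (Pow A)) \<and>
     (\<forall>(A :: 'u set) (F :: 'u \<Rightarrow> 'u set).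
        small U A \<and> (\<forall>a \<in> A. small U (F a)) \<longrightarrow> small U (\<Union>a \<in> A. F a))"

definition right_modules :: "('a, 'r) ring_scheme \<Rightarrow> ('a, 'u) module set" where
  "right_modules R = {M. right_module R M \<and> small TYPE('u) (carrier M)}"

definition projective :: "('a, 'r) ring_scheme \<Rightarrow> ('a, 'u) module \<Rightarrow> bool" where
  "projective R P \<longleftrightarrow> P \<in> right_modules R \<and>
     (\<forall>A \<in> right_modules R. \<forall>B \<in> right_modules R. \<forall>p \<in> epis R (A :: ('a, 'u) module) (B :: ('a, 'u) module).
        \<forall>f \<in> rhom R P B. \<exists>g \<in> rhom R P A. compose (carrier P) p g = f)"

definition superfluous :: "('a, 'r) ring_scheme \<Rightarrow> ('a, 'b) module \<Rightarrow> 'b set \<Rightarrow> bool" where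
  "superfluous R M H \<longleftrightarrow> submodule H R M \<and>
     (\<forall>U. submodule U R M \<and> U <+>\<^bsub>M\<^esub> H = carrier M \<longrightarrow> U = carrier M)"

definition projective_cover ::
    "('a, 'r) ring_scheme \<Rightarrow> ('a, 'u) module \<Rightarrow> ('a, 'u) module \<Rightarrow> ('u \<Rightarrow> 'u) \<Rightarrow> bool" where
  "projective_cover R M P p \<longleftrightarrow> projective R P \<and> p \<in> epis R P M \<and> superfluous R P (a_kernel P M p)"

definition right_perfect :: "'u itself \<Rightarrow> ('a, 'r) ring_scheme \<Rightarrow> bool" where
  "right_perfect _ R \<longleftrightarrow> ring R \<and>
     (\<forall>M \<in> right_modules R. \<exists>(P :: ('a, 'u) module) p. projective_cover R M P p)"


section \<open>Torsion classes and silting modules\<close>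

definition Gen :: "('a, 'r) ring_scheme \<Rightarrow> ('a, 'u) module \<Rightarrow> ('a, 'u) module set" where
  "Gen R T = {X \<in> right_modules R. \<exists>I :: 'u set. small TYPE('u) I \<and> epis R (direct_sum I (\<lambda>_. T)) X \<noteq> {}}"

definition left_Ext_orth :: "('a, 'r) ring_scheme \<Rightarrow> ('a, 'u) module set \<Rightarrow> ('a, 'u) module set" where
  "left_Ext_orth R \<T> = {X \<in> right_modules R. \<forall>T \<in> \<T>. trivial_group (Ext1 R X T)}"

definition short_exact :: "('a, 'r) ring_scheme \<Rightarrow> ('a, 'b) module \<Rightarrow> ('b \<Rightarrow> 'c) \<Rightarrow>
    ('a, 'c) module \<Rightarrow> ('c \<Rightarrow> 'd) \<Rightarrow> ('a, 'd) module \<Rightarrow> bool" where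
  "short_exact R A i B p C \<longleftrightarrow> i \<in> rhom R A B \<and> inj_on i (carrier A) \<and>
     p \<in> epis R B C \<and> i ` carrier A = a_kernel B C p"

definition torsion_class :: "('a, 'r) ring_scheme \<Rightarrow> ('a, 'u) module set \<Rightarrow> bool" where
  "torsion_class R \<T> \<longleftrightarrow> \<T> \<subseteq> right_modules R \<and>
     (\<forall>X \<in> \<T>. \<forall>Y \<in> right_modules R. isomorphic R X Y \<longrightarrow> Y \<in> \<T>) \<and>
     (\<forall>X \<in> \<T>. \<forall>Y \<in> right_modules R. epis R X Y \<noteq> {} \<longrightarrow> Y \<in> \<T>) \<and>
     (\<forall>(I :: 'u set) M. small TYPE('u) I \<and> (\<forall>i \<in> I. M i \<in> \<T>) \<longrightarrow>
        (\<forall>Y \<in> right_modules R. isomorphic R (direct_sum I M) Y \<longrightarrow> Y \<in> \<T>)) \<and>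
     (\<forall>A \<in> \<T>. \<forall>C \<in> \<T>. \<forall>B \<in> right_modules R. \<forall>i p. short_exact R A i B p C \<longrightarrow> B \<in> \<T>)"

text \<open>The class \<open>\<D>\<^sub>\<sigma>\<close> for \<open>\<sigma> : P \<rightarrow> Q\<close>.\<close>

definition D_class :: "('a, 'r) ring_scheme \<Rightarrow> ('a, 'u) module \<Rightarrow> ('a, 'u) module \<Rightarrow>
    ('u \<Rightarrow> 'u) \<Rightarrow> ('a, 'u) module set" where
  "D_class R P Q \<sigma> = {X \<in> right_modules R. pullback P \<sigma> ` rhom R Q X = rhom R P X}"

definition projective_presentation :: "('a, 'r) ring_scheme \<Rightarrow> ('a, 'u) module \<Rightarrow> ('u \<Rightarrow> 'u) \<Rightarrow>
    ('a, 'u) module \<Rightarrow> ('u \<Rightarrow> 'u) \<Rightarrow> ('a, 'u) module \<Rightarrow> bool" where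
  "projective_presentation R P \<sigma> Q \<pi> T \<longleftrightarrow> projective R P \<and> projective R Q \<and>
     \<sigma> \<in> rhom R P Q \<and> \<pi> \<in> epis R Q T \<and> \<sigma> ` carrier P = a_kernel Q T \<pi>"

definition silting :: "('a, 'r) ring_scheme \<Rightarrow> ('a, 'u) module \<Rightarrow> bool" where
  "silting R T \<longleftrightarrow> T \<in> right_modules R \<and>
     (\<exists>P \<sigma> Q \<pi>. projective_presentation R P \<sigma> Q \<pi> T \<and>
        torsion_class R (D_class R P Q \<sigma>) \<and> T \<in> D_class R P Q \<sigma> \<and> D_class R P Q \<sigma> = Gen R T)"

definition preenvelope :: "('a, 'r) ring_scheme \<Rightarrow> ('a, 'u) module set \<Rightarrow> ('a, 'b) module \<Rightarrow>
    ('a, 'u) module \<Rightarrow> ('b \<Rightarrow> 'u) \<Rightarrow> bool" where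
  "preenvelope R \<T> X T \<epsilon> \<longleftrightarrow> T \<in> \<T> \<and> \<epsilon> \<in> rhom R X T \<and>
     (\<forall>T' \<in> \<T>. \<forall>f \<in> rhom R X T'. \<exists>g \<in> rhom R T T'. compose (carrier X) g \<epsilon> = f)"

end

theory Submission
  imports Defs
begin

text \<open>
  Three conditions in the theorem have the same shape: for a linear map \<open>s : P \<rightarrow> Q\<close> and a module \<open>X\<close>,
  every linear map \<open>P \<rightarrow> X\<close> factors through \<open>s\<close>. If \<open>s\<close> is a presentation, this is membership of \<open>X\<close> in
  \<open>\<D>\<^sub>s\<close> (\<open>D_class_iff\<close>); if \<open>s\<close> is the inclusion of the kernel of a projective presentation of \<open>M\<close>, it
  is \<open>Ext\<^sup>1(M, X) = 0\<close> (\<open>Ext1_trivial_iff\<close>); if \<open>s = \<epsilon>\<close>, it is the preenvelope property at \<open>X\<close>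
  (\<open>preenvelope_iff\<close>). The proof moves such factorizations from one map to another.

  From a preenvelope \<open>\<epsilon> : R \<rightarrow> M\<close> to a silting module. An element \<open>x\<close> of \<open>X \<in> \<T>\<close> is a map \<open>R \<rightarrow> X\<close> and
  extends to \<open>M\<close>, so \<open>x\<close> lies in the image of \<open>M\<close>; therefore \<open>\<T> = Gen(M)\<close>, which is also \<open>Gen(M \<oplus> K)\<close>.
  It remains to find a presentation of \<open>M \<oplus> K\<close> whose class is \<open>\<T>\<close>. Let \<open>P\<^sub>0 \<rightarrow> M\<close> be an epimorphism from
  a free module. Since \<open>R\<close> is perfect, its kernel has a projective cover, which gives a presentation
  \<open>s : P\<^sub>1 \<rightarrow> P\<^sub>0\<close> of \<open>M\<close> with superfluous kernel. Vanishing of \<open>Ext\<^sup>1(M, \<T>)\<close> handles those maps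
  \<open>f : P\<^sub>1 \<rightarrow> X\<close> that vanish on \<open>ker s\<close>. Any \<open>f\<close> with \<open>X \<in> \<T>\<close> becomes one of these modulo \<open>f(ker s)\<close>, and
  the quotient is still in \<open>\<T>\<close>; lifting the factorization to \<open>X\<close> gives \<open>g : P\<^sub>0 \<rightarrow> X\<close> such that
  \<open>k = f - g s\<close> has image in \<open>f(ker s) = k(ker s)\<close>. Hence \<open>P\<^sub>1 = ker k + ker s\<close>, and superfluity forces
  \<open>k = 0\<close> (\<open>factors_minimal_presentation\<close>). So \<open>\<T>\<close> is contained in the class of \<open>s\<close>. If \<open>e : R \<rightarrow> P\<^sub>0\<close> lifts
  \<open>\<epsilon>\<close>, then \<open>(s, e) : P\<^sub>1 \<oplus> R \<rightarrow> P\<^sub>0\<close> is a presentation of \<open>K\<close>, and its class is exactly \<open>\<T>\<close>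
  (\<open>factors_cone_iff\<close>). The direct sum of the two presentations is the required one.

  From a silting module \<open>T\<close>, with presentation \<open>\<sigma> : P \<rightarrow> Q\<close>, to a preenvelope. As in Bongartz's
  construction for tilting modules, let \<open>M\<close> be the pushout of the direct sum of copies of \<open>\<sigma>\<close> indexed by
  \<open>Hom(P, R)\<close> along the tautological map from the copies of \<open>P\<close> to \<open>R\<close>. Factorization through \<open>\<sigma>\<close>
  passes to direct sums and pushouts, which yields at once the preenvelope property of \<open>\<epsilon> : R \<rightarrow> M\<close> and
  \<open>Ext\<^sup>1(M, \<T>) = 0\<close> (\<open>factors_pushout\<close>). For \<open>M \<in> \<T> = \<D>\<^sub>\<sigma>\<close>, note that \<open>M/\<epsilon>(R)\<close> is generated by \<open>T\<close>, so
  that a map \<open>P \<rightarrow> M\<close> factors through \<open>\<sigma>\<close> up to a map into \<open>\<epsilon>(R)\<close>; this remainder lifts to \<open>R\<close>, is then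
  one of the indices, and factors through \<open>\<sigma>\<close> by the pushout square.

  Direct sums, quotients and pushouts are built on new types. As small sets are closed under products
  and function spaces, the results can be copied back to the type of the universe (\<open>ex_copy\<close>).
\<close>

section \<open>Small sets\<close>

lemma small_lepoll: "small U A \<Longrightarrow> B \<lesssim> A \<Longrightarrow> small U B"
  unfolding small_def using lesspoll_trans1 by blast

lemma small_subset: "small U A \<Longrightarrow> B \<subseteq> A \<Longrightarrow> small U B"
  using small_lepoll subset_imp_lepoll by blast

lemma small_image: "small U A \<Longrightarrow> small U (f ` A)"
  using small_lepoll image_lepoll by blast

lemma small_code:
  assumes "small TYPE('u) A"
  obtains A' :: "'u set" where "A' \<approx> A" "small TYPE('u) A'"
proof -
  obtain f :: "_ \<Rightarrow> 'u" where "inj_on f A"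
    using assms unfolding small_def lesspoll_def lepoll_def by blast
  then have "f ` A \<approx> A" by (rule inj_on_image_eqpoll_self)
  then show thesis using that small_image[OF assms] by blast
qed

lemma small_Pow:
  assumes U: "module_universe TYPE('u)" and A: "small TYPE('u) A"
  shows "small TYPE('u) (Pow A)"
proof -
  obtain A' :: "'u set" where A': "A' \<approx> A" "small TYPE('u) A'" using small_code[OF A] .
  then obtain h where "bij_betw h A' A" unfolding eqpoll_def by blast
  then have "bij_betw ((`) h) (Pow A') (Pow A)" by (rule bij_betw_Pow)
  then have "Pow A \<lesssim> Pow A'" using eqpoll_def eqpoll_sym eqpoll_imp_lepoll by blast
  moreover have "small TYPE('u) (Pow A')" using U A' unfolding module_universe_def by blast
  ultimately show ?thesis by (rule small_lepoll[rotated])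
qed

text \<open>An injection of pairs into the infinite type \<open>'u\<close> turns the product into a small union of small
  sets.\<close>

lemma small_Times:
  assumes U: "module_universe TYPE('u)" and A: "small TYPE('u) A" and B: "small TYPE('u) B"
  shows "small TYPE('u) (A \<times> B)"
proof -
  obtain A' :: "'u set" where A': "A' \<approx> A" "small TYPE('u) A'" using small_code[OF A] .
  obtain B' :: "'u set" where B': "B' \<approx> B" "small TYPE('u) B'" using small_code[OF B] .
  have "infinite (UNIV :: 'u set)" using U unfolding module_universe_def by blast
  then have "(UNIV :: 'u set) \<times> (UNIV :: 'u set) \<approx> (UNIV :: 'u set)"
    unfolding eqpoll_iff_card_of_ordIso by (rule card_of_Times_same_infinite)
  then obtain h :: "'u \<times> 'u \<Rightarrow> 'u" where h: "inj h"
    unfolding eqpoll_def by (auto simp: bij_betw_def)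
  have "small TYPE('u) (\<Union>a \<in> A'. (\<lambda>b. h (a, b)) ` B')"
  proof -
    have "\<forall>(A :: 'u set) (F :: 'u \<Rightarrow> 'u set).
        small TYPE('u) A \<and> (\<forall>a \<in> A. small TYPE('u) (F a)) \<longrightarrow> small TYPE('u) (\<Union>a \<in> A. F a)"
      using U unfolding module_universe_def by (elim conjE) assumption
    from this[THEN spec, THEN spec, of A' "\<lambda>a. (\<lambda>b. h (a, b)) ` B'"] show ?thesis
      using A'(2) small_image[OF B'(2)] by blast
  qed
  moreover have "(\<Union>a \<in> A'. (\<lambda>b. h (a, b)) ` B') = h ` (A' \<times> B')" by auto
  moreover have "A \<times> B \<lesssim> h ` (A' \<times> B')"
    by (rule eqpoll_imp_lepoll, rule eqpoll_sym,
        rule eqpoll_trans[OF inj_on_image_eqpoll_self times_eqpoll_cong[OF A'(1) B'(1)]])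
      (rule inj_on_subset[OF h subset_UNIV])
  ultimately show ?thesis using small_lepoll by metis
qed

text \<open>Functions are identified with their graphs, which are subsets of the product.\<close>

lemma small_PiE:
  assumes U: "module_universe TYPE('u)" and A: "small TYPE('u) A" and B: "small TYPE('u) B"
  shows "small TYPE('u) (A \<rightarrow>\<^sub>E B)"
proof -
  let ?g = "\<lambda>f. (\<lambda>a. (a, f a)) ` A"
  have "inj_on ?g (A \<rightarrow>\<^sub>E B)"
  proof (rule inj_onI)
    fix f g assume "f \<in> A \<rightarrow>\<^sub>E B" "g \<in> A \<rightarrow>\<^sub>E B" "?g f = ?g g"
    then show "f = g" by (intro PiE_ext) (auto simp: image_iff set_eq_iff)
  qed
  moreover have "?g ` (A \<rightarrow>\<^sub>E B) \<subseteq> Pow (A \<times> B)" by (auto simp: PiE_iff)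
  ultimately have "(A \<rightarrow>\<^sub>E B) \<lesssim> Pow (A \<times> B)" unfolding lepoll_def by blast
  then show ?thesis using small_lepoll small_Pow[OF U small_Times[OF U A B]] by blast
qed


section \<open>Linear maps\<close>

text \<open>Homomorphisms are taken here without the requirement of extensionality, so that they compose and
  add as plain functions; extensional representatives appear only where the categorical notions of
  the statement are unfolded.\<close>

locale linear_map = M: right_module R M + N: right_module R N
  for R :: "('a, 'r) ring_scheme" and M :: "('a, 'b) module" and N :: "('a, 'c) module" +
  fixes f :: "'b \<Rightarrow> 'c"
  assumes map_closed [simp, intro]: "x \<in> carrier M \<Longrightarrow> f x \<in> carrier N"
    and map_add: "\<lbrakk>x \<in> carrier M; y \<in> carrier M\<rbrakk> \<Longrightarrow> f (x \<oplus>\<^bsub>M\<^esub> y) = f x \<oplus>\<^bsub>N\<^esub> f y"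
    and map_smult: "\<lbrakk>a \<in> carrier R; x \<in> carrier M\<rbrakk> \<Longrightarrow> f (a \<odot>\<^bsub>M\<^esub> x) = a \<odot>\<^bsub>N\<^esub> f x"
begin

lemma map_zero [simp]: "f \<zero>\<^bsub>M\<^esub> = \<zero>\<^bsub>N\<^esub>"
  using map_add[of "\<zero>\<^bsub>M\<^esub>" "\<zero>\<^bsub>M\<^esub>"] by (simp add: N.add.l_cancel_one')

lemma map_uminus: "x \<in> carrier M \<Longrightarrow> f (\<ominus>\<^bsub>M\<^esub> x) = \<ominus>\<^bsub>N\<^esub> f x"
  using map_add[of "\<ominus>\<^bsub>M\<^esub> x" x] by (simp add: M.l_neg N.minus_equality)

lemma map_minus: "\<lbrakk>x \<in> carrier M; y \<in> carrier M\<rbrakk> \<Longrightarrow> f (x \<ominus>\<^bsub>M\<^esub> y) = f x \<ominus>\<^bsub>N\<^esub> f y"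
  by (simp add: a_minus_def map_add map_uminus)

end

context right_module
begin

lemma smult_zero: "a \<in> carrier R \<Longrightarrow> a \<odot>\<^bsub>M\<^esub> \<zero>\<^bsub>M\<^esub> = \<zero>\<^bsub>M\<^esub>"
  using smult_r_distr[of a "\<zero>\<^bsub>M\<^esub>" "\<zero>\<^bsub>M\<^esub>"] by (simp add: M.add.l_cancel_one')

lemma zero_smult: "x \<in> carrier M \<Longrightarrow> \<zero>\<^bsub>R\<^esub> \<odot>\<^bsub>M\<^esub> x = \<zero>\<^bsub>M\<^esub>"
  using smult_l_distr[of "\<zero>\<^bsub>R\<^esub>" "\<zero>\<^bsub>R\<^esub>" x] by (simp add: M.add.l_cancel_one')

lemma smult_uminus:
  assumes "a \<in> carrier R" "x \<in> carrier M"
  shows "a \<odot>\<^bsub>M\<^esub> (\<ominus>\<^bsub>M\<^esub> x) = \<ominus>\<^bsub>M\<^esub> (a \<odot>\<^bsub>M\<^esub> x)"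
proof -
  have "a \<odot>\<^bsub>M\<^esub> (\<ominus>\<^bsub>M\<^esub> x) \<oplus>\<^bsub>M\<^esub> a \<odot>\<^bsub>M\<^esub> x = \<zero>\<^bsub>M\<^esub>"
    using assms by (simp add: smult_r_distr[symmetric] M.l_neg smult_zero)
  then show ?thesis using assms by (simp add: M.minus_equality)
qed

lemma minus_add_cancel: "x \<in> carrier M \<Longrightarrow> y \<in> carrier M \<Longrightarrow> (x \<ominus>\<^bsub>M\<^esub> y) \<oplus>\<^bsub>M\<^esub> y = x"
  by (simp add: a_minus_def M.a_assoc M.l_neg)

lemma add_minus_cancel: "x \<in> carrier M \<Longrightarrow> y \<in> carrier M \<Longrightarrow> y \<oplus>\<^bsub>M\<^esub> (x \<ominus>\<^bsub>M\<^esub> y) = x"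
  by (simp add: M.a_comm[of y] minus_add_cancel)

lemma minus_eq_zero_iff: "x \<in> carrier M \<Longrightarrow> y \<in> carrier M \<Longrightarrow> x \<ominus>\<^bsub>M\<^esub> y = \<zero>\<^bsub>M\<^esub> \<longleftrightarrow> x = y"
  using minus_add_cancel[of x y] by (auto simp: a_minus_def M.r_neg)

lemma submoduleI:
  assumes "H \<subseteq> carrier M" "\<zero>\<^bsub>M\<^esub> \<in> H"
    and "\<And>x y. x \<in> H \<Longrightarrow> y \<in> H \<Longrightarrow> x \<oplus>\<^bsub>M\<^esub> y \<in> H"
    and smult: "\<And>a x. a \<in> carrier R \<Longrightarrow> x \<in> H \<Longrightarrow> a \<odot>\<^bsub>M\<^esub> x \<in> H"
  shows "submodule H R M"
proof -
  have "\<ominus>\<^bsub>M\<^esub> x \<in> H" if "x \<in> H" for x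
  proof -
    have x: "x \<in> carrier M" using that assms(1) by blast
    have "(\<ominus>\<^bsub>R\<^esub> \<one>\<^bsub>R\<^esub>) \<odot>\<^bsub>M\<^esub> x \<oplus>\<^bsub>M\<^esub> x = \<zero>\<^bsub>M\<^esub>"
      using x smult_l_distr[of "\<ominus>\<^bsub>R\<^esub> \<one>\<^bsub>R\<^esub>" "\<one>\<^bsub>R\<^esub>" x] by (simp add: R.l_neg zero_smult)
    then have "\<ominus>\<^bsub>M\<^esub> x = (\<ominus>\<^bsub>R\<^esub> \<one>\<^bsub>R\<^esub>) \<odot>\<^bsub>M\<^esub> x" using x by (simp add: M.minus_equality)
    then show ?thesis using smult that by simp
  qed
  then show ?thesis
    by (unfold_locales) (use assms in \<open>auto simp: a_inv_def\<close>)
qed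

lemma submoduleD:
  assumes "submodule H R M"
  shows "H \<subseteq> carrier M" "\<zero>\<^bsub>M\<^esub> \<in> H"
    and "\<And>x y. x \<in> H \<Longrightarrow> y \<in> H \<Longrightarrow> x \<oplus>\<^bsub>M\<^esub> y \<in> H"
    and "\<And>a x. a \<in> carrier R \<Longrightarrow> x \<in> H \<Longrightarrow> a \<odot>\<^bsub>M\<^esub> x \<in> H"
    and "\<And>x. x \<in> H \<Longrightarrow> \<ominus>\<^bsub>M\<^esub> x \<in> H"
    and "\<And>x y. x \<in> H \<Longrightarrow> y \<in> H \<Longrightarrow> x \<ominus>\<^bsub>M\<^esub> y \<in> H"
proof -
  interpret submodule H R M by fact
  show *: "H \<subseteq> carrier M" "\<zero>\<^bsub>M\<^esub> \<in> H"
    "\<And>x y. x \<in> H \<Longrightarrow> y \<in> H \<Longrightarrow> x \<oplus>\<^bsub>M\<^esub> y \<in> H"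
    "\<And>a x. a \<in> carrier R \<Longrightarrow> x \<in> H \<Longrightarrow> a \<odot>\<^bsub>M\<^esub> x \<in> H"
    using subset one_closed m_closed by auto
  show **: "\<And>x. x \<in> H \<Longrightarrow> \<ominus>\<^bsub>M\<^esub> x \<in> H"
    using m_inv_closed by (simp add: a_inv_def)
  show "\<And>x y. x \<in> H \<Longrightarrow> y \<in> H \<Longrightarrow> x \<ominus>\<^bsub>M\<^esub> y \<in> H" using * ** by (simp add: a_minus_def)
qed

end

text \<open>The module axioms pass to any structure onto which a module maps compatibly with the
  operations. This serves for quotients and for copies of a module on another type.\<close>

lemma right_module_image:
  assumes M: "right_module R M"
    and carrier: "carrier N = f ` carrier M" and zero: "\<zero>\<^bsub>N\<^esub> = f \<zero>\<^bsub>M\<^esub>"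
    and add: "\<And>x y. \<lbrakk>x \<in> carrier M; y \<in> carrier M\<rbrakk> \<Longrightarrow> f (x \<oplus>\<^bsub>M\<^esub> y) = f x \<oplus>\<^bsub>N\<^esub> f y"
    and smult: "\<And>a x. \<lbrakk>a \<in> carrier R; x \<in> carrier M\<rbrakk> \<Longrightarrow> f (a \<odot>\<^bsub>M\<^esub> x) = a \<odot>\<^bsub>N\<^esub> f x"
  shows "linear_map R M N f"
proof -
  interpret M: right_module R M by fact
  have N: "right_module R N"
  proof (intro right_module.intro right_module_axioms.intro abelian_groupI)
    show "ring R" by (rule M.R.ring_axioms)
    fix x y z assume "x \<in> carrier N" "y \<in> carrier N" "z \<in> carrier N"
    then show "x \<oplus>\<^bsub>N\<^esub> y \<oplus>\<^bsub>N\<^esub> z = x \<oplus>\<^bsub>N\<^esub> (y \<oplus>\<^bsub>N\<^esub> z)"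
      unfolding carrier by (auto simp: add[symmetric] M.M.a_assoc)
  next
    fix x y assume "x \<in> carrier N" "y \<in> carrier N"
    then show "x \<oplus>\<^bsub>N\<^esub> y = y \<oplus>\<^bsub>N\<^esub> x"
      unfolding carrier by (auto simp: add[symmetric] M.M.a_comm)
  next
    fix x assume "x \<in> carrier N"
    then obtain m where m: "m \<in> carrier M" "x = f m" unfolding carrier by blast
    then show "\<exists>y\<in>carrier N. y \<oplus>\<^bsub>N\<^esub> x = \<zero>\<^bsub>N\<^esub>"
      unfolding carrier zero using add[of "\<ominus>\<^bsub>M\<^esub> m" m] M.M.l_neg by auto
  qed (auto simp: carrier zero add[symmetric] smult[symmetric]
      M.smult_l_distr M.smult_r_distr M.smult_assoc)
  show ?thesis
    by (intro linear_map.intro linear_map_axioms.intro M N) (auto simp: carrier add smult)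
qed

lemma linear_mapI:
  assumes "right_module R M" "right_module R N"
    and "\<And>x. x \<in> carrier M \<Longrightarrow> f x \<in> carrier N"
    and "\<And>x y. \<lbrakk>x \<in> carrier M; y \<in> carrier M\<rbrakk> \<Longrightarrow> f (x \<oplus>\<^bsub>M\<^esub> y) = f x \<oplus>\<^bsub>N\<^esub> f y"
    and "\<And>a x. \<lbrakk>a \<in> carrier R; x \<in> carrier M\<rbrakk> \<Longrightarrow> f (a \<odot>\<^bsub>M\<^esub> x) = a \<odot>\<^bsub>N\<^esub> f x"
  shows "linear_map R M N f"
  using assms by (auto intro!: linear_map.intro linear_map_axioms.intro)

lemma linear_mapD:
  assumes "linear_map R M N f"
  shows "right_module R M" "right_module R N"
    and "\<And>x. x \<in> carrier M \<Longrightarrow> f x \<in> carrier N"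
  using assms unfolding linear_map_def linear_map_axioms_def by auto

lemma linear_map_cong:
  assumes "linear_map R M N f" "\<And>x. x \<in> carrier M \<Longrightarrow> g x = f x"
  shows "linear_map R M N g"
proof -
  interpret linear_map R M N f by fact
  show ?thesis
    by (rule linear_mapI)
      (auto simp: assms(2) map_add map_smult M.right_module_axioms N.right_module_axioms)
qed

lemma linear_map_compose:
  assumes "linear_map R A B f" "linear_map R B C g"
  shows "linear_map R A C (\<lambda>x. g (f x))"
proof -
  interpret f: linear_map R A B f by fact
  interpret g: linear_map R B C g by fact
  show ?thesis
    by (rule linear_mapI) (auto simp: f.map_add f.map_smult g.map_add g.map_smult
        f.M.right_module_axioms g.N.right_module_axioms)
qed

lemma linear_map_id: "right_module R M \<Longrightarrow> linear_map R M M (\<lambda>x. x)"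
  by (rule linear_mapI) auto

lemma linear_map_zero:
  assumes "right_module R M" "right_module R N"
  shows "linear_map R M N (\<lambda>_. \<zero>\<^bsub>N\<^esub>)"
proof -
  interpret N: right_module R N by fact
  show ?thesis by (rule linear_mapI) (auto simp: assms N.smult_zero)
qed

lemma linear_map_add:
  assumes "linear_map R M N f" "linear_map R M N g"
  shows "linear_map R M N (\<lambda>x. f x \<oplus>\<^bsub>N\<^esub> g x)"
proof -
  interpret f: linear_map R M N f by fact
  interpret g: linear_map R M N g by fact
  show ?thesis
    by (rule linear_mapI) (auto simp: f.map_add f.map_smult g.map_add g.map_smult
        f.M.right_module_axioms f.N.right_module_axioms f.N.M.a_ac f.N.smult_r_distr)
qed

lemma linear_map_uminus:
  assumes "linear_map R M N f"
  shows "linear_map R M N (\<lambda>x. \<ominus>\<^bsub>N\<^esub> f x)"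
proof -
  interpret f: linear_map R M N f by fact
  show ?thesis
    by (rule linear_mapI) (auto simp: f.map_add f.map_smult f.N.smult_uminus
        f.M.right_module_axioms f.N.right_module_axioms f.N.M.minus_add)
qed

lemma linear_map_minus:
  assumes "linear_map R M N f" "linear_map R M N g"
  shows "linear_map R M N (\<lambda>x. f x \<ominus>\<^bsub>N\<^esub> g x)"
  unfolding a_minus_def using assms by (intro linear_map_add linear_map_uminus)

lemma mem_a_kernel [simp]: "x \<in> a_kernel M N f \<longleftrightarrow> x \<in> carrier M \<and> f x = \<zero>\<^bsub>N\<^esub>"
  by (auto simp: a_kernel_def kernel_def)

lemma (in linear_map) submodule_kernel: "submodule (a_kernel M N f) R M"
  by (rule M.submoduleI) (auto simp: map_add map_smult N.smult_zero)

lemma (in linear_map) submodule_image: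
  assumes "submodule H R M"
  shows "submodule (f ` H) R N"
proof -
  note H = M.submoduleD[OF assms]
  show ?thesis
  proof (rule N.submoduleI)
    show "\<zero>\<^bsub>N\<^esub> \<in> f ` H" using H(2) map_zero by (metis image_eqI)
  next
    fix x y assume "x \<in> f ` H" "y \<in> f ` H"
    then show "x \<oplus>\<^bsub>N\<^esub> y \<in> f ` H" using H by (auto simp: map_add[symmetric] subset_iff)
  next
    fix a x assume "a \<in> carrier R" "x \<in> f ` H"
    then show "a \<odot>\<^bsub>N\<^esub> x \<in> f ` H" using H by (auto simp: map_smult[symmetric] subset_iff)
  qed (use H in auto)
qed

lemma (in right_module) submodule_carrier: "submodule (carrier M) R M"
  by (rule submoduleI) auto

lemma submodule_right_module:
  assumes "right_module R M" "submodule H R M"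
  shows "right_module R (M\<lparr>carrier := H\<rparr>)"
proof -
  interpret M: right_module R M by fact
  note H = M.submoduleD[OF assms(2)]
  have sub: "x \<in> H \<Longrightarrow> x \<in> carrier M" for x using H by blast
  show ?thesis
  proof (intro right_module.intro right_module_axioms.intro abelian_groupI)
    show "ring R" by (rule M.R.ring_axioms)
    fix x assume "x \<in> carrier (M\<lparr>carrier := H\<rparr>)"
    then have "\<ominus>\<^bsub>M\<^esub> x \<in> H" "\<ominus>\<^bsub>M\<^esub> x \<oplus>\<^bsub>M\<^esub> x = \<zero>\<^bsub>M\<^esub>" using H sub M.M.l_neg by auto
    then show "\<exists>y\<in>carrier (M\<lparr>carrier := H\<rparr>). y \<oplus>\<^bsub>M\<lparr>carrier := H\<rparr>\<^esub> x = \<zero>\<^bsub>M\<lparr>carrier := H\<rparr>\<^esub>"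
      by auto
  qed (use H sub in \<open>auto simp: M.M.a_ac M.smult_l_distr M.smult_r_distr M.smult_assoc\<close>)
qed

lemma linear_map_restrict:
  assumes "linear_map R M N f" "submodule H R M"
  shows "linear_map R (M\<lparr>carrier := H\<rparr>) N f"
proof -
  interpret linear_map R M N f by fact
  note H = M.submoduleD[OF assms(2)]
  have sub: "x \<in> H \<Longrightarrow> x \<in> carrier M" for x using H by blast
  show ?thesis
    by (rule linear_mapI)
      (use sub N.right_module_axioms submodule_right_module[OF M.right_module_axioms assms(2)]
        in \<open>auto simp: map_add map_smult\<close>)
qed

lemma linear_map_corestrict:
  assumes "linear_map R M N f" "submodule H R N" "\<And>x. x \<in> carrier M \<Longrightarrow> f x \<in> H"
  shows "linear_map R M (N\<lparr>carrier := H\<rparr>) f"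
proof -
  interpret linear_map R M N f by fact
  show ?thesis
    by (rule linear_mapI)
      (use assms M.right_module_axioms submodule_right_module[OF N.right_module_axioms assms(2)]
        in \<open>auto simp: map_add map_smult\<close>)
qed

text \<open>The homomorphism theorem. The value of the factorization at \<open>y\<close> is read off at any preimage of \<open>y\<close>
  under \<open>p\<close>; preimages differ by elements of the kernel.\<close>

lemma linear_map_factor:
  assumes p: "linear_map R A B p" "p ` carrier A = carrier B"
    and f: "linear_map R A C f" and ker: "a_kernel A B p \<subseteq> a_kernel A C f"
  obtains g where "linear_map R B C g" "\<And>x. x \<in> carrier A \<Longrightarrow> g (p x) = f x"
proof -
  interpret p: linear_map R A B p by fact
  interpret f: linear_map R A C f by fact
  define g where "g = (\<lambda>y. f (SOME x. x \<in> carrier A \<and> p x = y))"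
  have g: "g (p x) = f x" if x: "x \<in> carrier A" for x
  proof -
    define x' where "x' = (SOME x'. x' \<in> carrier A \<and> p x' = p x)"
    have x': "x' \<in> carrier A \<and> p x' = p x" unfolding x'_def using x by (intro someI) auto
    then have "x' \<ominus>\<^bsub>A\<^esub> x \<in> a_kernel A B p"
      using x by (simp add: p.map_minus p.N.minus_eq_zero_iff)
    then have "f (x' \<ominus>\<^bsub>A\<^esub> x) = \<zero>\<^bsub>C\<^esub>" using ker by auto
    then have "f x' = f x" using x x' by (simp add: f.map_minus f.N.minus_eq_zero_iff)
    then show ?thesis by (simp add: g_def x'_def)
  qed
  have "linear_map R B C g"
  proof (rule linear_mapI)
    show "right_module R B" "right_module R C"
      by (rule p.N.right_module_axioms f.N.right_module_axioms)+
  qed (auto simp: p(2)[symmetric] g f.map_add f.map_smult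
      p.map_add[symmetric] p.map_smult[symmetric])
  then show thesis using g that by blast
qed

lemma linear_map_inverse:
  assumes f: "linear_map R A B f" and bij: "bij_betw f (carrier A) (carrier B)"
  obtains g where "linear_map R B A g" "\<And>x. x \<in> carrier A \<Longrightarrow> g (f x) = x"
    "\<And>y. y \<in> carrier B \<Longrightarrow> f (g y) = y"
proof -
  interpret linear_map R A B f by fact
  have surj: "f ` carrier A = carrier B" using bij by (simp add: bij_betw_def)
  have "a_kernel A B f \<subseteq> a_kernel A A (\<lambda>x. x)"
    using bij_betw_imp_inj_on[OF bij] by (auto simp: map_zero dest: inj_onD[of f _ _ "\<zero>\<^bsub>A\<^esub>"])
  then obtain g where g: "linear_map R B A g" "\<And>x. x \<in> carrier A \<Longrightarrow> g (f x) = x"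
    using linear_map_factor[OF f surj linear_map_id[OF M.right_module_axioms]] by blast
  moreover have "f (g y) = y" if "y \<in> carrier B" for y
    using that g(2) unfolding surj[symmetric] by auto
  ultimately show thesis using that by blast
qed


subsection \<open>Comparison with extensional homomorphisms\<close>

lemma linear_map_of_rhom:
  assumes "f \<in> rhom R M N" "right_module R M" "right_module R N"
  shows "linear_map R M N f"
  using assms by (intro linear_mapI) (auto simp: rhom_def)

lemma restrict_rhom:
  assumes "linear_map R M N f"
  shows "restrict f (carrier M) \<in> rhom R M N"
proof -
  interpret linear_map R M N f by fact
  show ?thesis by (auto simp: rhom_def map_add map_smult)
qed


section \<open>Quotients and copies\<close>

text \<open>The scalar action on cosets is a union of cosets, all of which coincide because the submodule is
  stable under the action.\<close>

lemma quotient_module_map: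
  assumes M: "right_module R M" and H: "submodule H R M"
  shows "linear_map R M (quotient_module M H) (\<lambda>x. H +>\<^bsub>M\<^esub> x)"
    and "(\<lambda>x. H +>\<^bsub>M\<^esub> x) ` carrier M = carrier (quotient_module M H)"
    and "a_kernel M (quotient_module M H) (\<lambda>x. H +>\<^bsub>M\<^esub> x) = H"
proof -
  interpret M: right_module R M by fact
  note HD = M.submoduleD[OF H]
  have sub: "subgroup H (add_monoid M)" using H by (rule submodule.axioms)
  interpret abelian_subgroup H M
    by (rule abelian_subgroupI3) (use sub M.M.abelian_group_axioms in \<open>auto simp: additive_subgroup_def\<close>)
  show surj: "(\<lambda>x. H +>\<^bsub>M\<^esub> x) ` carrier M = carrier (quotient_module M H)"
    by (auto simp: quotient_module_def A_RCOSETS_def')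
  show "linear_map R M (quotient_module M H) (\<lambda>x. H +>\<^bsub>M\<^esub> x)"
  proof (rule right_module_image[OF M surj[symmetric]])
    show "\<zero>\<^bsub>quotient_module M H\<^esub> = H +>\<^bsub>M\<^esub> \<zero>\<^bsub>M\<^esub>"
      using HD(1) by (simp add: quotient_module_def M.M.a_coset_add_zero)
  next
    fix x y assume "x \<in> carrier M" "y \<in> carrier M"
    then show "H +>\<^bsub>M\<^esub> (x \<oplus>\<^bsub>M\<^esub> y) = (H +>\<^bsub>M\<^esub> x) \<oplus>\<^bsub>quotient_module M H\<^esub> (H +>\<^bsub>M\<^esub> y)"
      by (simp add: quotient_module_def a_rcos_sum)
  next
    fix a x assume a: "a \<in> carrier R" and x: "x \<in> carrier M"
    have "H +>\<^bsub>M\<^esub> (a \<odot>\<^bsub>M\<^esub> z) = H +>\<^bsub>M\<^esub> (a \<odot>\<^bsub>M\<^esub> x)" if z: "z \<in> H +>\<^bsub>M\<^esub> x" for z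
    proof -
      obtain h where h: "h \<in> H" "z = h \<oplus>\<^bsub>M\<^esub> x" using z by (auto simp: a_r_coset_def')
      have "a \<odot>\<^bsub>M\<^esub> z = a \<odot>\<^bsub>M\<^esub> h \<oplus>\<^bsub>M\<^esub> a \<odot>\<^bsub>M\<^esub> x" using h HD(1) a x by (auto simp: M.smult_r_distr)
      then have "a \<odot>\<^bsub>M\<^esub> z \<in> H +>\<^bsub>M\<^esub> (a \<odot>\<^bsub>M\<^esub> x)"
        using HD(4)[OF a h(1)] by (auto simp: a_r_coset_def')
      then show ?thesis using M.M.a_repr_independence[OF _ _ sub] a x by simp
    qed
    moreover have "x \<in> H +>\<^bsub>M\<^esub> x" using a_rcos_self[OF x] .
    ultimately have "(\<Union>z\<in>H +>\<^bsub>M\<^esub> x. H +>\<^bsub>M\<^esub> (a \<odot>\<^bsub>M\<^esub> z)) = H +>\<^bsub>M\<^esub> (a \<odot>\<^bsub>M\<^esub> x)" by blast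
    then show "H +>\<^bsub>M\<^esub> (a \<odot>\<^bsub>M\<^esub> x) = a \<odot>\<^bsub>quotient_module M H\<^esub> (H +>\<^bsub>M\<^esub> x)"
      by (simp add: quotient_module_def)
  qed
  have "H +>\<^bsub>M\<^esub> x = H \<longleftrightarrow> x \<in> H" if "x \<in> carrier M" for x
    using that sub HD M.M.a_coset_join1[of H x] M.M.a_coset_join2[of x H] by blast
  then show "a_kernel M (quotient_module M H) (\<lambda>x. H +>\<^bsub>M\<^esub> x) = H"
    using HD(1) by (auto simp: quotient_module_def)
qed

lemma ex_copy:
  fixes M :: "('a, 'b) module"
  assumes M: "right_module R M" and small: "small TYPE('u) (carrier M)"
  obtains M' :: "('a, 'u) module" and b
  where "M' \<in> right_modules R" "linear_map R M M' b" "bij_betw b (carrier M) (carrier M')"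
proof -
  obtain b :: "'b \<Rightarrow> 'u" where b: "inj_on b (carrier M)"
    using small unfolding small_def lesspoll_def lepoll_def by blast
  interpret M: right_module R M by fact
  let ?i = "inv_into (carrier M) b"
  define M' :: "('a, 'u) module" where
    "M' = \<lparr>carrier = b ` carrier M, monoid.mult = undefined, one = undefined,
      ring.zero = b \<zero>\<^bsub>M\<^esub>, ring.add = (\<lambda>x y. b (?i x \<oplus>\<^bsub>M\<^esub> ?i y)), smult = (\<lambda>a x. b (a \<odot>\<^bsub>M\<^esub> ?i x))\<rparr>"
  have lin: "linear_map R M M' b"
    by (rule right_module_image[OF M]) (auto simp: M'_def b)
  moreover have "M' \<in> right_modules R"
    using linear_mapD(2)[OF lin] small_image[OF small] by (auto simp: right_modules_def M'_def)
  moreover have "bij_betw b (carrier M) (carrier M')"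
    using b by (simp add: M'_def bij_betw_def)
  ultimately show thesis using that by blast
qed

lemma ex_copy_inverse:
  fixes M :: "('a, 'b) module"
  assumes M: "right_module R M" and small: "small TYPE('u) (carrier M)"
  obtains M' :: "('a, 'u) module" and b b'
  where "M' \<in> right_modules R" "linear_map R M M' b" "linear_map R M' M b'"
    "\<And>x. x \<in> carrier M \<Longrightarrow> b' (b x) = x" "\<And>y. y \<in> carrier M' \<Longrightarrow> b (b' y) = y"
proof -
  obtain M' :: "('a, 'u) module" and b
    where *: "M' \<in> right_modules R" "linear_map R M M' b" "bij_betw b (carrier M) (carrier M')"
    using ex_copy[OF assms] .
  obtain b' where "linear_map R M' M b'" "\<And>x. x \<in> carrier M \<Longrightarrow> b' (b x) = x"
    "\<And>y. y \<in> carrier M' \<Longrightarrow> b (b' y) = y"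
    using linear_map_inverse[OF *(2,3)] by blast
  with * that show thesis by blast
qed

lemma ex_quotient:
  fixes M :: "('a, 'b) module"
  assumes M: "right_module R M" and small: "small TYPE('u) (carrier M)" and H: "submodule H R M"
  obtains M' :: "('a, 'u) module" and q
  where "M' \<in> right_modules R" "linear_map R M M' q" "q ` carrier M = carrier M'"
    "a_kernel M M' q = H"
proof -
  note Q = quotient_module_map[OF M H]
  have "small TYPE('u) (carrier (quotient_module M H))"
    using small_image[OF small] Q(2) by metis
  then obtain M' :: "('a, 'u) module" and b where b: "M' \<in> right_modules R"
    "linear_map R (quotient_module M H) M' b"
    "bij_betw b (carrier (quotient_module M H)) (carrier M')"
    using ex_copy[OF linear_mapD(2)[OF Q(1)]] by blast
  interpret q: linear_map R M "quotient_module M H" "\<lambda>x. H +>\<^bsub>M\<^esub> x" by (rule Q(1))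
  interpret b: linear_map R "quotient_module M H" M' b by (rule b(2))
  have inj: "inj_on b (carrier (quotient_module M H))"
    and surj: "b ` carrier (quotient_module M H) = carrier M'"
    using b(3) by (auto simp: bij_betw_def)
  have zero: "b y = \<zero>\<^bsub>M'\<^esub> \<longleftrightarrow> y = \<zero>\<^bsub>quotient_module M H\<^esub>"
    if "y \<in> carrier (quotient_module M H)" for y
    using inj_on_eq_iff[OF inj that q.N.zero_closed] by simp
  show thesis
  proof (rule that[OF b(1) linear_map_compose[OF Q(1) b(2)]])
    show "(\<lambda>x. b (H +>\<^bsub>M\<^esub> x)) ` carrier M = carrier M'"
      using surj Q(2) by (auto simp: image_image[symmetric])
    show "a_kernel M M' (\<lambda>x. b (H +>\<^bsub>M\<^esub> x)) = H"
    proof -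
      have "a_kernel M M' (\<lambda>x. b (H +>\<^bsub>M\<^esub> x)) = a_kernel M (quotient_module M H) (\<lambda>x. H +>\<^bsub>M\<^esub> x)"
        using zero by auto
      then show ?thesis using Q(3) by simp
    qed
  qed
qed


section \<open>Direct sums\<close>

lemma carrier_direct_sum2 [simp]: "carrier (direct_sum2 M N) = carrier M \<times> carrier N"
  and zero_direct_sum2 [simp]: "\<zero>\<^bsub>direct_sum2 M N\<^esub> = (\<zero>\<^bsub>M\<^esub>, \<zero>\<^bsub>N\<^esub>)"
  and add_direct_sum2 [simp]: "(x, y) \<oplus>\<^bsub>direct_sum2 M N\<^esub> (x', y') = (x \<oplus>\<^bsub>M\<^esub> x', y \<oplus>\<^bsub>N\<^esub> y')"
  and smult_direct_sum2 [simp]: "a \<odot>\<^bsub>direct_sum2 M N\<^esub> (x, y) = (a \<odot>\<^bsub>M\<^esub> x, a \<odot>\<^bsub>N\<^esub> y)"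
  by (auto simp: direct_sum2_def)

lemma direct_sum2_right_module:
  assumes "right_module R M" "right_module R N"
  shows "right_module R (direct_sum2 M N)"
proof -
  interpret M: right_module R M by fact
  interpret N: right_module R N by fact
  show ?thesis
  proof (intro right_module.intro right_module_axioms.intro abelian_groupI)
    show "ring R" by (rule M.R.ring_axioms)
    fix x assume "x \<in> carrier (direct_sum2 M N)"
    then show "\<exists>y\<in>carrier (direct_sum2 M N). y \<oplus>\<^bsub>direct_sum2 M N\<^esub> x = \<zero>\<^bsub>direct_sum2 M N\<^esub>"
      by (auto simp: M.M.l_neg N.M.l_neg intro!: bexI[of _ "(\<ominus>\<^bsub>M\<^esub> fst x, \<ominus>\<^bsub>N\<^esub> snd x)"])
  qed (auto simp: M.M.a_ac N.M.a_ac M.smult_l_distr N.smult_l_distr M.smult_r_distr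
      N.smult_r_distr M.smult_assoc N.smult_assoc)
qed

lemma
  assumes "right_module R M" "right_module R N"
  shows linear_map_fst: "linear_map R (direct_sum2 M N) M fst"
    and linear_map_snd: "linear_map R (direct_sum2 M N) N snd"
    and linear_map_inl: "linear_map R M (direct_sum2 M N) (\<lambda>x. (x, \<zero>\<^bsub>N\<^esub>))"
    and linear_map_inr: "linear_map R N (direct_sum2 M N) (\<lambda>y. (\<zero>\<^bsub>M\<^esub>, y))"
proof -
  interpret M: right_module R M by fact
  interpret N: right_module R N by fact
  note * = assms direct_sum2_right_module[OF assms]
  show "linear_map R (direct_sum2 M N) M fst" "linear_map R (direct_sum2 M N) N snd"
    "linear_map R M (direct_sum2 M N) (\<lambda>x. (x, \<zero>\<^bsub>N\<^esub>))"
    "linear_map R N (direct_sum2 M N) (\<lambda>y. (\<zero>\<^bsub>M\<^esub>, y))"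
    by (auto intro!: linear_mapI * simp: M.smult_zero N.smult_zero)
qed

lemma linear_map_pair:
  assumes "linear_map R L M f" "linear_map R L N g"
  shows "linear_map R L (direct_sum2 M N) (\<lambda>x. (f x, g x))"
proof -
  interpret f: linear_map R L M f by fact
  interpret g: linear_map R L N g by fact
  show ?thesis
    by (rule linear_mapI) (auto simp: f.map_add g.map_add f.map_smult g.map_smult
        f.M.right_module_axioms f.N.right_module_axioms g.N.right_module_axioms
        intro!: direct_sum2_right_module)
qed

lemma linear_map_copair:
  assumes f: "linear_map R M L f" and g: "linear_map R N L g"
  shows "linear_map R (direct_sum2 M N) L (\<lambda>z. f (fst z) \<oplus>\<^bsub>L\<^esub> g (snd z))"
  by (intro linear_map_add linear_map_compose[OF linear_map_fst f]
      linear_map_compose[OF linear_map_snd g] linear_mapD(1)[OF f] linear_mapD(1)[OF g])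

lemma linear_map_direct_sum2:
  assumes "linear_map R M M' f" "linear_map R N N' g"
  shows "linear_map R (direct_sum2 M N) (direct_sum2 M' N') (\<lambda>z. (f (fst z), g (snd z)))"
  using assms
  by (intro linear_map_pair linear_map_compose[OF linear_map_fst assms(1)]
      linear_map_compose[OF linear_map_snd assms(2)]) (auto dest: linear_mapD)

lemma linear_map_split:
  assumes "linear_map R (direct_sum2 M N) L h" "right_module R M" "right_module R N"
    and "x \<in> carrier M" "y \<in> carrier N"
  shows "h (x, y) = h (x, \<zero>\<^bsub>N\<^esub>) \<oplus>\<^bsub>L\<^esub> h (\<zero>\<^bsub>M\<^esub>, y)"
proof -
  interpret h: linear_map R "direct_sum2 M N" L h by fact
  interpret M: right_module R M by fact
  interpret N: right_module R N by fact
  show ?thesis using h.map_add[of "(x, \<zero>\<^bsub>N\<^esub>)" "(\<zero>\<^bsub>M\<^esub>, y)"] assms(4,5) by simp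
qed

lemma carrier_direct_sum:
    "carrier (direct_sum I M) = {f \<in> \<Pi>\<^sub>E i \<in> I. carrier (M i). finite {i \<in> I. f i \<noteq> \<zero>\<^bsub>M i\<^esub>}}"
  and zero_direct_sum: "\<zero>\<^bsub>direct_sum I M\<^esub> = (\<lambda>i \<in> I. \<zero>\<^bsub>M i\<^esub>)"
  and add_direct_sum: "f \<oplus>\<^bsub>direct_sum I M\<^esub> g = (\<lambda>i \<in> I. f i \<oplus>\<^bsub>M i\<^esub> g i)"
  and smult_direct_sum: "a \<odot>\<^bsub>direct_sum I M\<^esub> f = (\<lambda>i \<in> I. a \<odot>\<^bsub>M i\<^esub> f i)"
  by (auto simp: direct_sum_def)

lemmas direct_sum_simps = carrier_direct_sum zero_direct_sum add_direct_sum smult_direct_sum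

lemma (in right_module) uminus_zero: "\<ominus>\<^bsub>M\<^esub> \<zero>\<^bsub>M\<^esub> = \<zero>\<^bsub>M\<^esub>"
  by (rule M.minus_equality) auto

lemma direct_sum_right_module:
  assumes R: "ring R" and M: "\<And>i. i \<in> I \<Longrightarrow> right_module R (M i)"
  shows "right_module R (direct_sum I M)"
proof -
  note mod = right_module.axioms(2)[OF M]
  note ab = abelian_group.axioms(1)[OF mod]
  note [simp] = abelian_monoid.zero_closed[OF ab] abelian_monoid.a_closed[OF ab]
    abelian_monoid.l_zero[OF ab] abelian_group.a_inv_closed[OF mod] abelian_group.l_neg[OF mod]
    right_module.smult_closed[OF M] right_module.smult_zero[OF M] right_module.smult_one[OF M]
  have fin: "finite {i \<in> I. h i \<noteq> \<zero>\<^bsub>M i\<^esub>}"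
    if "finite {i \<in> I. f i \<noteq> \<zero>\<^bsub>M i\<^esub>}" "\<And>i. i \<in> I \<Longrightarrow> f i = \<zero>\<^bsub>M i\<^esub> \<Longrightarrow> h i = \<zero>\<^bsub>M i\<^esub>" for f h
    by (rule finite_subset[OF _ that(1)]) (use that(2) in auto)
  show ?thesis
  proof (intro right_module.intro right_module_axioms.intro abelian_groupI)
    show "ring R" by (rule R)
  next
    fix f g assume fg: "f \<in> carrier (direct_sum I M)" "g \<in> carrier (direct_sum I M)"
    have "{i \<in> I. f i \<oplus>\<^bsub>M i\<^esub> g i \<noteq> \<zero>\<^bsub>M i\<^esub>} \<subseteq> {i \<in> I. f i \<noteq> \<zero>\<^bsub>M i\<^esub>} \<union> {i \<in> I. g i \<noteq> \<zero>\<^bsub>M i\<^esub>}"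
      by auto
    then have "finite {i \<in> I. f i \<oplus>\<^bsub>M i\<^esub> g i \<noteq> \<zero>\<^bsub>M i\<^esub>}"
      using fg by (auto simp: carrier_direct_sum intro: finite_subset)
    then show "f \<oplus>\<^bsub>direct_sum I M\<^esub> g \<in> carrier (direct_sum I M)"
      using fg by (auto simp: direct_sum_simps PiE_iff cong: conj_cong)
  next
    fix f assume f: "f \<in> carrier (direct_sum I M)"
    let ?g = "\<lambda>i\<in>I. \<ominus>\<^bsub>M i\<^esub> f i"
    have "finite {i \<in> I. ?g i \<noteq> \<zero>\<^bsub>M i\<^esub>}"
      by (rule fin[of f]) (use f in \<open>auto simp: carrier_direct_sum right_module.uminus_zero[OF M]\<close>)
    then have "?g \<in> carrier (direct_sum I M)"
      using f by (auto simp: carrier_direct_sum PiE_iff)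
    moreover have "?g \<oplus>\<^bsub>direct_sum I M\<^esub> f = \<zero>\<^bsub>direct_sum I M\<^esub>"
      using f by (auto simp: direct_sum_simps PiE_iff intro!: restrict_ext)
    ultimately show "\<exists>y\<in>carrier (direct_sum I M). y \<oplus>\<^bsub>direct_sum I M\<^esub> f = \<zero>\<^bsub>direct_sum I M\<^esub>"
      by blast
  next
    fix a f assume a: "a \<in> carrier R" and f: "f \<in> carrier (direct_sum I M)"
    have "finite {i \<in> I. a \<odot>\<^bsub>M i\<^esub> f i \<noteq> \<zero>\<^bsub>M i\<^esub>}"
      by (rule fin[of f]) (use a f in \<open>auto simp: carrier_direct_sum\<close>)
    then show "a \<odot>\<^bsub>direct_sum I M\<^esub> f \<in> carrier (direct_sum I M)"
      using a f by (auto simp: direct_sum_simps PiE_iff cong: conj_cong)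
  qed (auto simp: direct_sum_simps PiE_iff extensional_def fun_eq_iff restrict_def
      abelian_monoid.a_assoc[OF ab] abelian_monoid.a_comm[OF ab]
      abelian_monoid.a_lcomm[OF ab] abelian_monoid.r_zero[OF ab]
      right_module.smult_l_distr[OF M] right_module.smult_r_distr[OF M]
      right_module.smult_assoc[OF M])
qed

definition single :: "'i set \<Rightarrow> ('i \<Rightarrow> ('a, 'b) module) \<Rightarrow> 'i \<Rightarrow> 'b \<Rightarrow> 'i \<Rightarrow> 'b" where
  "single I M i x = (\<lambda>j \<in> I. if j = i then x else \<zero>\<^bsub>M j\<^esub>)"

lemma linear_map_single:
  assumes "ring R" and M: "\<And>i. i \<in> I \<Longrightarrow> right_module R (M i)" and i: "i \<in> I"
  shows "linear_map R (M i) (direct_sum I M) (single I M i)"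
proof (rule linear_mapI)
  note mod = right_module.axioms(2)[OF M]
  note ab = abelian_group.axioms(1)[OF mod]
  show "right_module R (M i)" "right_module R (direct_sum I M)"
    using assms by (auto intro: direct_sum_right_module)
  fix x assume x: "x \<in> carrier (M i)"
  have "finite {j \<in> I. single I M i x j \<noteq> \<zero>\<^bsub>M j\<^esub>}"
    by (rule finite_subset[of _ "{i}"]) (auto simp: single_def)
  then show "single I M i x \<in> carrier (direct_sum I M)"
    using x by (auto simp: carrier_direct_sum single_def PiE_iff abelian_monoid.zero_closed[OF ab])
  fix y assume "y \<in> carrier (M i)"
  then show "single I M i (x \<oplus>\<^bsub>M i\<^esub> y) = single I M i x \<oplus>\<^bsub>direct_sum I M\<^esub> single I M i y"
    by (auto simp: direct_sum_simps single_def abelian_monoid.l_zero[OF ab]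
        abelian_monoid.zero_closed[OF ab] intro!: restrict_ext)
next
  fix a x assume "a \<in> carrier R" "x \<in> carrier (M i)"
  then show "single I M i (a \<odot>\<^bsub>M i\<^esub> x) = a \<odot>\<^bsub>direct_sum I M\<^esub> single I M i x"
    by (auto simp: direct_sum_simps single_def right_module.smult_zero[OF M] intro!: restrict_ext)
qed

lemma single_closed:
  assumes "ring R" "\<And>i. i \<in> I \<Longrightarrow> right_module R (M i)" "i \<in> I" "x \<in> carrier (M i)"
  shows "single I M i x \<in> carrier (direct_sum I M)"
  using linear_mapD(3)[OF linear_map_single[where M = M and I = I, OF assms(1-3)] assms(4)] .

text \<open>The universal map out of a direct sum. For the maps \<open>r \<mapsto> x \<cdot> r\<close> from the regular module it is
  \<open>lincomb\<close>.\<close>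

definition copair :: "'i set \<Rightarrow> ('i \<Rightarrow> ('a, 'b) module) \<Rightarrow> ('a, 'c) module \<Rightarrow>
    ('i \<Rightarrow> 'b \<Rightarrow> 'c) \<Rightarrow> ('i \<Rightarrow> 'b) \<Rightarrow> 'c" where
  "copair I M N g c = finsum N (\<lambda>i. g i (c i)) {i \<in> I. c i \<noteq> \<zero>\<^bsub>M i\<^esub>}"

lemma (in right_module) smult_finsum:
  assumes "finite F" "a \<in> carrier R" "h \<in> F \<rightarrow> carrier M"
  shows "a \<odot>\<^bsub>M\<^esub> finsum M h F = finsum M (\<lambda>i. a \<odot>\<^bsub>M\<^esub> h i) F"
  using assms
proof (induction F)
  case empty then show ?case by (simp add: smult_zero)
next
  case (insert i F)
  then have "h \<in> F \<rightarrow> carrier M" "h i \<in> carrier M" by auto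
  with insert show ?case by (simp add: smult_r_distr Pi_def)
qed

text \<open>Different elements have different supports; enlarging the index set of the sum makes their images
  comparable.\<close>

lemma copair_superset:
  assumes N: "right_module R N" and g: "\<And>i. i \<in> I \<Longrightarrow> linear_map R (M i) N (g i)"
    and c: "c \<in> carrier (direct_sum I M)"
    and F: "finite F" "F \<subseteq> I" "{i \<in> I. c i \<noteq> \<zero>\<^bsub>M i\<^esub>} \<subseteq> F"
  shows "copair I M N g c = finsum N (\<lambda>i. g i (c i)) F"
proof -
  interpret N: right_module R N by fact
  have ci: "c i \<in> carrier (M i)" if "i \<in> I" for i using c that by (auto simp: carrier_direct_sum)
  show ?thesis unfolding copair_def
  proof (rule N.M.add.finprod_mono_neutral_cong_left[OF F(1,3)])
    show "g i (c i) = \<zero>\<^bsub>N\<^esub>" if "i \<in> F - {i \<in> I. c i \<noteq> \<zero>\<^bsub>M i\<^esub>}" for i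
      using that F(2) linear_map.map_zero[OF g] by auto
    show "(\<lambda>i. g i (c i)) \<in> F \<rightarrow> carrier N" using F(2) ci linear_mapD(3)[OF g] by auto
  qed simp
qed

lemma linear_map_direct_sum:
  assumes R: "ring R" and M: "\<And>i. i \<in> I \<Longrightarrow> right_module R (M i)"
    and N: "right_module R N" and g: "\<And>i. i \<in> I \<Longrightarrow> linear_map R (M i) N (g i)"
  shows "linear_map R (direct_sum I M) N (copair I M N g)"
proof -
  interpret N: right_module R N by fact
  interpret S: right_module R "direct_sum I M" by (rule direct_sum_right_module[OF R M])
  let ?s = "\<lambda>c. {i \<in> I. c i \<noteq> \<zero>\<^bsub>M i\<^esub>}"
  have ci: "c i \<in> carrier (M i)" if "i \<in> I" "c \<in> carrier (direct_sum I M)" for c i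
    using that by (auto simp: carrier_direct_sum)
  have fin: "finite (?s c)" if "c \<in> carrier (direct_sum I M)" for c
    using that by (simp add: carrier_direct_sum)
  have gc: "(\<lambda>i. g i (c i)) \<in> F \<rightarrow> carrier N" if "c \<in> carrier (direct_sum I M)" "F \<subseteq> I" for c F
    using that ci linear_mapD(3)[OF g] by auto
  note sup = copair_superset[OF N g]
  show ?thesis
  proof (rule linear_mapI[OF S.right_module_axioms N])
    fix c assume "c \<in> carrier (direct_sum I M)"
    then show "copair I M N g c \<in> carrier N"
      using gc[of c "?s c"] unfolding copair_def by (intro N.M.finsum_closed) auto
  next
    fix c d assume c: "c \<in> carrier (direct_sum I M)" and d: "d \<in> carrier (direct_sum I M)"
    let ?F = "?s c \<union> ?s d \<union> ?s (c \<oplus>\<^bsub>direct_sum I M\<^esub> d)"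
    have cd: "c \<oplus>\<^bsub>direct_sum I M\<^esub> d \<in> carrier (direct_sum I M)" using c d by simp
    have F: "finite ?F" "?F \<subseteq> I" using fin c d cd by auto
    have "copair I M N g (c \<oplus>\<^bsub>direct_sum I M\<^esub> d) = finsum N (\<lambda>i. g i ((c \<oplus>\<^bsub>direct_sum I M\<^esub> d) i)) ?F"
      by (rule sup[OF _ cd F]) auto
    also have "\<dots> = finsum N (\<lambda>i. g i (c i) \<oplus>\<^bsub>N\<^esub> g i (d i)) ?F"
    proof (rule N.M.finsum_cong'[OF refl])
      show "(\<lambda>i. g i (c i) \<oplus>\<^bsub>N\<^esub> g i (d i)) \<in> ?F \<rightarrow> carrier N"
        using gc[OF c F(2)] gc[OF d F(2)] by (simp add: Pi_def)
      fix i assume "i \<in> ?F"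
      then show "g i ((c \<oplus>\<^bsub>direct_sum I M\<^esub> d) i) = g i (c i) \<oplus>\<^bsub>N\<^esub> g i (d i)"
        using F(2) c d linear_map.map_add[OF g] ci by (auto simp: add_direct_sum)
    qed
    also have "\<dots> = finsum N (\<lambda>i. g i (c i)) ?F \<oplus>\<^bsub>N\<^esub> finsum N (\<lambda>i. g i (d i)) ?F"
      by (rule N.M.finsum_addf[OF gc[OF c F(2)] gc[OF d F(2)]])
    also have "finsum N (\<lambda>i. g i (c i)) ?F = copair I M N g c"
      by (rule sup[OF _ c F, symmetric]) auto
    also have "finsum N (\<lambda>i. g i (d i)) ?F = copair I M N g d"
      by (rule sup[OF _ d F, symmetric]) auto
    finally show "copair I M N g (c \<oplus>\<^bsub>direct_sum I M\<^esub> d) = copair I M N g c \<oplus>\<^bsub>N\<^esub> copair I M N g d" .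
  next
    fix a c assume a: "a \<in> carrier R" and c: "c \<in> carrier (direct_sum I M)"
    have ac: "a \<odot>\<^bsub>direct_sum I M\<^esub> c \<in> carrier (direct_sum I M)" using a c by simp
    have "copair I M N g (a \<odot>\<^bsub>direct_sum I M\<^esub> c) = finsum N (\<lambda>i. g i ((a \<odot>\<^bsub>direct_sum I M\<^esub> c) i)) (?s c)"
      using a by (intro sup[OF _ ac fin[OF c]])
        (auto simp: smult_direct_sum right_module.smult_zero[OF M])
    also have "\<dots> = finsum N (\<lambda>i. a \<odot>\<^bsub>N\<^esub> g i (c i)) (?s c)"
    proof (rule N.M.finsum_cong'[OF refl])
      show "(\<lambda>i. a \<odot>\<^bsub>N\<^esub> g i (c i)) \<in> ?s c \<rightarrow> carrier N"
        using gc[OF c, of "?s c"] a by (auto simp: Pi_def)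
      fix i assume "i \<in> ?s c"
      then show "g i ((a \<odot>\<^bsub>direct_sum I M\<^esub> c) i) = a \<odot>\<^bsub>N\<^esub> g i (c i)"
        using a c linear_map.map_smult[OF g] ci by (auto simp: smult_direct_sum)
    qed
    also have "\<dots> = a \<odot>\<^bsub>N\<^esub> copair I M N g c"
      unfolding copair_def using gc[OF c] a fin[OF c] by (intro N.smult_finsum[symmetric]) auto
    finally show "copair I M N g (a \<odot>\<^bsub>direct_sum I M\<^esub> c) = a \<odot>\<^bsub>N\<^esub> copair I M N g c" .
  qed
qed

lemma copair_single:
  assumes N: "right_module R N" and g: "\<And>i. i \<in> I \<Longrightarrow> linear_map R (M i) N (g i)"
    and i: "i \<in> I" and x: "x \<in> carrier (M i)"
  shows "copair I M N g (single I M i x) = g i x"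
proof -
  interpret N: right_module R N by fact
  have R: "ring R" by (rule N.R.ring_axioms)
  have gx: "g i x \<in> carrier N" using linear_mapD(3)[OF g[OF i] x] .
  have "copair I M N g (single I M i x) = finsum N (\<lambda>j. g j (single I M i x j)) {i}"
  proof (rule copair_superset[OF N g])
    show "single I M i x \<in> carrier (direct_sum I M)"
      using single_closed[where M = M and I = I, OF R linear_mapD(1)[OF g] i x] .
  qed (auto simp: single_def i)
  also have "\<dots> = g i x" using i gx by (simp add: single_def)
  finally show ?thesis .
qed

text \<open>Every element of a direct sum is the finite sum of its components, by induction over a finite set of
  indices that contains the support.\<close>

lemma copair_eq:
  assumes M: "\<And>i. i \<in> I \<Longrightarrow> right_module R (M i)"
    and h: "linear_map R (direct_sum I M) N h" and c: "c \<in> carrier (direct_sum I M)"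
  shows "h c = copair I M N (\<lambda>i x. h (single I M i x)) c"
proof -
  interpret h: linear_map R "direct_sum I M" N h by fact
  have R: "ring R" by (rule h.M.R.ring_axioms)
  note ab = abelian_group.axioms(1)[OF right_module.axioms(2)[OF M]]
  note sing = single_closed[where M = M and I = I, OF R M]
  have ci: "c i \<in> carrier (M i)" if "i \<in> I" for i using that c by (auto simp: carrier_direct_sum)
  let ?c = "\<lambda>F. \<lambda>i\<in>I. if i \<in> F then c i else \<zero>\<^bsub>M i\<^esub>"
  have "?c F \<in> carrier (direct_sum I M) \<and> finsum N (\<lambda>i. h (single I M i (c i))) F = h (?c F)"
    if "finite F" "F \<subseteq> I" for F
    using that
  proof (induction F)
    case empty
    have "?c {} = \<zero>\<^bsub>direct_sum I M\<^esub>" by (simp add: zero_direct_sum)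
    then show ?case using h.map_zero by simp
  next
    case (insert i F)
    have i: "i \<in> I" using insert by simp
    have s: "single I M i (c i) \<in> carrier (direct_sum I M)"
      by (rule sing[OF _ i ci[OF i]])
    have cF: "?c F \<in> carrier (direct_sum I M)" "finsum N (\<lambda>i. h (single I M i (c i))) F = h (?c F)"
      using insert by (auto simp del: restrict_apply)
    have *: "?c (insert i F) = single I M i (c i) \<oplus>\<^bsub>direct_sum I M\<^esub> ?c F"
      using insert(2) ci by (auto simp: add_direct_sum single_def abelian_monoid.l_zero[OF ab]
          abelian_monoid.r_zero[OF ab] abelian_monoid.zero_closed[OF ab] fun_eq_iff)
    have "(\<lambda>i. h (single I M i (c i))) \<in> F \<rightarrow> carrier N"
      using insert sing ci by (auto intro!: h.map_closed)
    then have "finsum N (\<lambda>i. h (single I M i (c i))) (insert i F) = h (single I M i (c i)) \<oplus>\<^bsub>N\<^esub> h (?c F)"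
      using insert(1,2) h.map_closed[OF s] cF(2) by simp
    also have "\<dots> = h (?c (insert i F))" unfolding * by (rule h.map_add[OF s cF(1), symmetric])
    finally show ?case unfolding * using h.M.M.a_closed[OF s cF(1)] by blast
  qed
  moreover have "?c {i \<in> I. c i \<noteq> \<zero>\<^bsub>M i\<^esub>} = c"
    using c by (auto simp: carrier_direct_sum fun_eq_iff PiE_iff extensional_def)
  ultimately show ?thesis using c by (auto simp: copair_def carrier_direct_sum)
qed

lemma direct_sum_map_eqI:
  assumes M: "\<And>i. i \<in> I \<Longrightarrow> right_module R (M i)"
    and h: "linear_map R (direct_sum I M) N h" and k: "linear_map R (direct_sum I M) N k"
    and eq: "\<And>i x. i \<in> I \<Longrightarrow> x \<in> carrier (M i) \<Longrightarrow> h (single I M i x) = k (single I M i x)"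
    and c: "c \<in> carrier (direct_sum I M)"
  shows "h c = k c"
proof -
  interpret h: linear_map R "direct_sum I M" N h by fact
  have R: "ring R" by (rule h.M.R.ring_axioms)
  have ci: "c i \<in> carrier (M i)" if "i \<in> I" for i using that c by (auto simp: carrier_direct_sum)
  have "copair I M N (\<lambda>i x. h (single I M i x)) c = copair I M N (\<lambda>i x. k (single I M i x)) c"
    unfolding copair_def
  proof (rule h.N.M.finsum_cong'[OF refl])
    show "(\<lambda>i. k (single I M i (c i))) \<in> {i \<in> I. c i \<noteq> \<zero>\<^bsub>M i\<^esub>} \<rightarrow> carrier N"
      using single_closed[where M = M and I = I, OF R M] ci by (auto intro!: linear_mapD(3)[OF k])
  qed (use eq ci in auto)
  then show ?thesis using copair_eq[OF M h c] copair_eq[OF M k c] by simp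
qed


section \<open>Lifting and extension of linear maps\<close>

text \<open>Projectivity of \<open>P\<close> relative to epimorphisms from \<open>A\<close> to \<open>B\<close>. The two modules are parameters because
  their types vary, and types cannot be quantified inside a formula.\<close>

definition lifts :: "('a, 'r) ring_scheme \<Rightarrow> ('a, 'b) module \<Rightarrow> ('a, 'c) module \<Rightarrow> ('a, 'd) module \<Rightarrow> bool" where
  "lifts R P A B \<longleftrightarrow> (\<forall>p f. linear_map R A B p \<and> p ` carrier A = carrier B \<and> linear_map R P B f \<longrightarrow>
     (\<exists>g. linear_map R P A g \<and> (\<forall>x \<in> carrier P. p (g x) = f x)))"

text \<open>Surjectivity of \<open>Hom(s, X) : Hom(Q, X) \<rightarrow> Hom(P, X)\<close>.\<close>

definition factors :: "('a, 'r) ring_scheme \<Rightarrow> ('a, 'b) module \<Rightarrow> ('a, 'c) module \<Rightarrow> ('b \<Rightarrow> 'c) \<Rightarrow>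
    ('a, 'd) module \<Rightarrow> bool" where
  "factors R P Q s X \<longleftrightarrow> (\<forall>f. linear_map R P X f \<longrightarrow>
     (\<exists>g. linear_map R Q X g \<and> (\<forall>x \<in> carrier P. g (s x) = f x)))"

lemma liftsE:
  assumes "lifts R P A B" "linear_map R A B p" "p ` carrier A = carrier B" "linear_map R P B f"
  obtains g where "linear_map R P A g" "\<And>x. x \<in> carrier P \<Longrightarrow> p (g x) = f x"
  using assms unfolding lifts_def by blast

lemma liftsD:
  assumes "lifts R P A B" "linear_map R A B p" "p ` carrier A = carrier B" "linear_map R P B f"
  shows "\<exists>g. linear_map R P A g \<and> (\<forall>x \<in> carrier P. p (g x) = f x)"
  using assms unfolding lifts_def by blast

lemma factorsE:
  assumes "factors R P Q s X" "linear_map R P X f"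
  obtains g where "linear_map R Q X g" "\<And>x. x \<in> carrier P \<Longrightarrow> g (s x) = f x"
  using assms unfolding factors_def by blast

lemma factorsI:
  assumes "\<And>f. linear_map R P X f \<Longrightarrow> \<exists>g. linear_map R Q X g \<and> (\<forall>x \<in> carrier P. g (s x) = f x)"
  shows "factors R P Q s X"
  using assms unfolding factors_def by blast

lemma carrier_regular [simp]: "carrier (regular_module R) = carrier R"
  and zero_regular [simp]: "\<zero>\<^bsub>regular_module R\<^esub> = \<zero>\<^bsub>R\<^esub>"
  and add_regular [simp]: "x \<oplus>\<^bsub>regular_module R\<^esub> y = x \<oplus>\<^bsub>R\<^esub> y"
  and smult_regular [simp]: "a \<odot>\<^bsub>regular_module R\<^esub> x = x \<otimes>\<^bsub>R\<^esub> a"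
  by (auto simp: regular_module_def)

lemma regular_right_module:
  assumes "ring R"
  shows "right_module R (regular_module R)"
proof -
  interpret ring R by fact
  show ?thesis
  proof (intro right_module.intro right_module_axioms.intro abelian_groupI)
    fix x assume "x \<in> carrier (regular_module R)"
    then show "\<exists>y\<in>carrier (regular_module R). y \<oplus>\<^bsub>regular_module R\<^esub> x = \<zero>\<^bsub>regular_module R\<^esub>"
      using l_neg by auto
  qed (auto simp: assms a_ac r_distr l_distr m_assoc)
qed

lemma linear_map_orbit:
  assumes "right_module R M" "m \<in> carrier M"
  shows "linear_map R (regular_module R) M (\<lambda>r. r \<odot>\<^bsub>M\<^esub> m)"
proof -
  interpret M: right_module R M by fact
  show ?thesis
    by (rule linear_mapI)
      (use assms regular_right_module[OF M.R.ring_axioms] in \<open>auto simp: M.smult_l_distr M.smult_assoc\<close>)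
qed

text \<open>A map on the regular module is determined by its value at \<open>1\<close>; this is what makes the module
  projective, as only that value has to be lifted.\<close>

lemma regular_map_eq:
  assumes "linear_map R (regular_module R) M f" "r \<in> carrier R"
  shows "f r = r \<odot>\<^bsub>M\<^esub> f \<one>\<^bsub>R\<^esub>"
proof -
  interpret f: linear_map R "regular_module R" M f by fact
  show ?thesis using f.map_smult[of r "\<one>\<^bsub>R\<^esub>"] assms(2) by simp
qed

lemma lifts_regular: "lifts R (regular_module R) A B"
  unfolding lifts_def
proof (intro allI impI, elim conjE)
  fix p f assume p: "linear_map R A B p" "p ` carrier A = carrier B"
    and f: "linear_map R (regular_module R) B f"
  interpret p: linear_map R A B p by fact
  interpret f: linear_map R "regular_module R" B f by fact
  have "f \<one>\<^bsub>R\<^esub> \<in> p ` carrier A" unfolding p(2) by (rule f.map_closed) simp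
  then obtain m where m: "m \<in> carrier A" "p m = f \<one>\<^bsub>R\<^esub>" by auto
  have "p (r \<odot>\<^bsub>A\<^esub> m) = f r" if "r \<in> carrier R" for r
    using regular_map_eq[OF f that] m that by (simp add: p.map_smult)
  then show "\<exists>g. linear_map R (regular_module R) A g \<and> (\<forall>x\<in>carrier (regular_module R). p (g x) = f x)"
    using linear_map_orbit[OF p.M.right_module_axioms m(1)] by (intro exI conjI) auto
qed

lemma lifts_direct_sum2:
  assumes "lifts R P A B" "lifts R Q A B" "right_module R P" "right_module R Q"
  shows "lifts R (direct_sum2 P Q) A B"
  unfolding lifts_def
proof (intro allI impI, elim conjE)
  fix p f assume p: "linear_map R A B p" "p ` carrier A = carrier B"
    and f: "linear_map R (direct_sum2 P Q) B f"
  interpret p: linear_map R A B p by fact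
  obtain g where g: "linear_map R P A g" "\<And>x. x \<in> carrier P \<Longrightarrow> p (g x) = f (x, \<zero>\<^bsub>Q\<^esub>)"
    using liftsE[OF assms(1) p linear_map_compose[OF linear_map_inl[OF assms(3,4)] f]] by blast
  obtain h where h: "linear_map R Q A h" "\<And>y. y \<in> carrier Q \<Longrightarrow> p (h y) = f (\<zero>\<^bsub>P\<^esub>, y)"
    using liftsE[OF assms(2) p linear_map_compose[OF linear_map_inr[OF assms(3,4)] f]] by blast
  have "p (g (fst z) \<oplus>\<^bsub>A\<^esub> h (snd z)) = f z" if zc: "z \<in> carrier (direct_sum2 P Q)" for z
  proof -
    obtain x y where z: "z = (x, y)" "x \<in> carrier P" "y \<in> carrier Q" using zc by (cases z) auto
    have "p (g x \<oplus>\<^bsub>A\<^esub> h y) = f (x, \<zero>\<^bsub>Q\<^esub>) \<oplus>\<^bsub>B\<^esub> f (\<zero>\<^bsub>P\<^esub>, y)"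
      using p.map_add[OF linear_mapD(3)[OF g(1) z(2)] linear_mapD(3)[OF h(1) z(3)]]
      by (simp only: g(2)[OF z(2)] h(2)[OF z(3)])
    then show ?thesis using linear_map_split[OF f assms(3,4) z(2,3)] z(1) by simp
  qed
  then show "\<exists>g. linear_map R (direct_sum2 P Q) A g \<and> (\<forall>x\<in>carrier (direct_sum2 P Q). p (g x) = f x)"
    by (intro exI[of _ "\<lambda>z. g (fst z) \<oplus>\<^bsub>A\<^esub> h (snd z)"] conjI ballI linear_map_copair[OF g(1) h(1)])
qed

lemma lifts_direct_sum:
  assumes R: "ring R" and lifts: "\<And>i. i \<in> I \<Longrightarrow> lifts R (P i) A B"
    and P: "\<And>i. i \<in> I \<Longrightarrow> right_module R (P i)"
  shows "lifts R (direct_sum I P) A B"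
  unfolding lifts_def
proof (intro allI impI, elim conjE)
  fix p f assume p: "linear_map R A B p" "p ` carrier A = carrier B"
    and f: "linear_map R (direct_sum I P) B f"
  interpret p: linear_map R A B p by fact
  have "\<exists>g. linear_map R (P i) A g \<and> (\<forall>x \<in> carrier (P i). p (g x) = f (single I P i x))"
    if i: "i \<in> I" for i
    by (rule liftsD[OF lifts[OF i] p linear_map_compose[OF linear_map_single[where M = P and I = I, OF R P i] f]])
  then obtain g where g: "\<And>i. i \<in> I \<Longrightarrow> linear_map R (P i) A (g i)"
    "\<And>i x. i \<in> I \<Longrightarrow> x \<in> carrier (P i) \<Longrightarrow> p (g i x) = f (single I P i x)" by metis
  have A: "right_module R A" by (rule p.M.right_module_axioms)
  have lin: "linear_map R (direct_sum I P) A (copair I P A g)"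
    by (rule linear_map_direct_sum[OF R P A g(1)])
  have "p (copair I P A g c) = f c" if c: "c \<in> carrier (direct_sum I P)" for c
    by (rule direct_sum_map_eqI[where M = P and I = I, OF P linear_map_compose[OF lin p(1)] f _ c])
      (auto simp: g copair_single[where M = P and I = I, OF A g(1)])
  then show "\<exists>g. linear_map R (direct_sum I P) A g \<and> (\<forall>x\<in>carrier (direct_sum I P). p (g x) = f x)"
    by (intro exI[of _ "copair I P A g"] conjI ballI lin)
qed

lemma lifts_retract:
  assumes P: "lifts R P A B" and r: "linear_map R P P' r" and s: "linear_map R P' P s"
    and rs: "\<And>y. y \<in> carrier P' \<Longrightarrow> r (s y) = y"
  shows "lifts R P' A B"
  unfolding lifts_def
proof (intro allI impI, elim conjE)
  fix p f assume p: "linear_map R A B p" "p ` carrier A = carrier B" and f: "linear_map R P' B f"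
  obtain g where "linear_map R P A g" "\<And>x. x \<in> carrier P \<Longrightarrow> p (g x) = f (r x)"
    using liftsE[OF P p linear_map_compose[OF r f]] by blast
  then show "\<exists>g. linear_map R P' A g \<and> (\<forall>x\<in>carrier P'. p (g x) = f x)"
    using rs linear_mapD(3)[OF s] linear_map_compose[OF s] by (intro exI[of _ "\<lambda>y. g (s y)"]) auto
qed

lemma right_modulesD:
  assumes "M \<in> right_modules R"
  shows "right_module R M" "small TYPE('u) (carrier (M :: ('a, 'u) module))"
  using assms by (auto simp: right_modules_def)

text \<open>Projectivity is tested on the type of the universe only, but every small module on another type has a
  copy there.\<close>

lemma projective_lifts:
  fixes P :: "('a, 'u) module" and A :: "('a, 'b) module" and B :: "('a, 'c) module"
  assumes P: "projective R P"
    and A: "small TYPE('u) (carrier A)" and B: "small TYPE('u) (carrier B)"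
  shows "lifts R P A B"
  unfolding lifts_def
proof (intro allI impI, elim conjE)
  fix p f assume p: "linear_map R A B p" "p ` carrier A = carrier B" and f: "linear_map R P B f"
  obtain A' :: "('a, 'u) module" and a a' where A': "A' \<in> right_modules R" "linear_map R A A' a"
    "linear_map R A' A a'" "\<And>x. x \<in> carrier A \<Longrightarrow> a' (a x) = x" "\<And>y. y \<in> carrier A' \<Longrightarrow> a (a' y) = y"
    using ex_copy_inverse[OF linear_mapD(1)[OF p(1)] A] by blast
  obtain B' :: "('a, 'u) module" and b b' where B': "B' \<in> right_modules R" "linear_map R B B' b"
    "linear_map R B' B b'" "\<And>x. x \<in> carrier B \<Longrightarrow> b' (b x) = x" "\<And>y. y \<in> carrier B' \<Longrightarrow> b (b' y) = y"
    using ex_copy_inverse[OF linear_mapD(2)[OF p(1)] B] by blast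
  let ?p = "restrict (\<lambda>x. b (p (a' x))) (carrier A')"
  let ?f = "restrict (\<lambda>x. b (f x)) (carrier P)"
  have p': "?p \<in> rhom R A' B'"
    by (intro restrict_rhom linear_map_compose[OF linear_map_compose[OF A'(3) p(1)] B'(2)])
  have f': "?f \<in> rhom R P B'" by (intro restrict_rhom linear_map_compose[OF f B'(2)])
  have "y \<in> ?p ` carrier A'" if y: "y \<in> carrier B'" for y
  proof -
    have "b' y \<in> p ` carrier A" unfolding p(2) by (rule linear_mapD(3)[OF B'(3) y])
    then obtain x where x: "x \<in> carrier A" "p x = b' y" by auto
    then have "?p (a x) = y" using A'(4) B'(5)[OF y] linear_mapD(3)[OF A'(2)] by simp
    then show ?thesis using linear_mapD(3)[OF A'(2) x(1)] by force
  qed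
  then have "?p \<in> epis R A' B'" using p' by (auto simp: epis_def rhom_def)
  then obtain g where g: "g \<in> rhom R P A'" "compose (carrier P) ?p g = ?f"
    using P A'(1) B'(1) f' unfolding projective_def by blast
  have P': "right_module R P" by (rule linear_mapD(1)[OF f])
  have lin: "linear_map R P A' g"
    by (rule linear_map_of_rhom[OF g(1) P' linear_mapD(2)[OF A'(2)]])
  have "p (a' (g x)) = f x" if x: "x \<in> carrier P" for x
  proof -
    have gx: "g x \<in> carrier A'" by (rule linear_mapD(3)[OF lin x])
    have "b (p (a' (g x))) = b (f x)"
      using fun_cong[OF g(2), of x] x gx by (simp add: compose_def)
    then have "b' (b (p (a' (g x)))) = b' (b (f x))" by simp
    then show ?thesis
      using B'(4) x linear_mapD(3)[OF p(1) linear_mapD(3)[OF A'(3) gx]] linear_mapD(3)[OF f x] by simp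
  qed
  then show "\<exists>g. linear_map R P A g \<and> (\<forall>x\<in>carrier P. p (g x) = f x)"
    by (intro exI[of _ "\<lambda>x. a' (g x)"] conjI ballI linear_map_compose[OF lin A'(3)])
qed

lemma projectiveI:
  fixes P :: "('a, 'u) module"
  assumes P: "P \<in> right_modules R" and lifts: "\<And>(A :: ('a, 'u) module) (B :: ('a, 'u) module).
    A \<in> right_modules R \<Longrightarrow> B \<in> right_modules R \<Longrightarrow> lifts R P A B"
  shows "projective R P"
  unfolding projective_def
proof (intro conjI ballI P)
  fix A B :: "('a, 'u) module" and p f
  assume A: "A \<in> right_modules R" and B: "B \<in> right_modules R" and p: "p \<in> epis R A B"
    and f: "f \<in> rhom R P B"
  have "linear_map R A B p" "p ` carrier A = carrier B" "linear_map R P B f"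
    using p f A B P by (auto simp: epis_def intro: linear_map_of_rhom dest: right_modulesD)
  then obtain g where g: "linear_map R P A g" "\<And>x. x \<in> carrier P \<Longrightarrow> p (g x) = f x"
    using liftsE[OF lifts[OF A B]] by blast
  have "compose (carrier P) p (restrict g (carrier P)) = f"
    using g f by (auto simp: compose_def rhom_def fun_eq_iff PiE_iff extensional_def)
  then show "\<exists>g\<in>rhom R P A. compose (carrier P) p g = f" using restrict_rhom[OF g(1)] by blast
qed

lemma pullback_rhom:
  assumes s: "linear_map R P Q s" and X: "right_module R X" and g: "g \<in> rhom R Q X"
  shows "pullback P s g \<in> rhom R P X"
proof -
  have "linear_map R P X (\<lambda>x. g (s x))"
    by (rule linear_map_compose[OF s linear_map_of_rhom[OF g linear_mapD(2)[OF s] X]])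
  then show ?thesis using restrict_rhom unfolding pullback_def compose_def by blast
qed

lemma factors_iff_pullback:
  assumes s: "linear_map R P Q s" and X: "right_module R X"
  shows "factors R P Q s X \<longleftrightarrow> rhom R P X \<subseteq> pullback P s ` rhom R Q X"
proof (intro iffI subsetI)
  assume sub: "rhom R P X \<subseteq> pullback P s ` rhom R Q X"
  show "factors R P Q s X"
  proof (rule factorsI)
    fix f assume "linear_map R P X f"
    then obtain g where g: "g \<in> rhom R Q X" "restrict f (carrier P) = pullback P s g"
      using sub restrict_rhom by blast
    have "g (s x) = f x" if "x \<in> carrier P" for x
      using fun_cong[OF g(2), of x] that by (simp add: pullback_def compose_def)
    then show "\<exists>g. linear_map R Q X g \<and> (\<forall>x\<in>carrier P. g (s x) = f x)"
      using linear_map_of_rhom[OF g(1) linear_mapD(2)[OF s] X] by blast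
  qed
next
  fix f assume fac: "factors R P Q s X" and f: "f \<in> rhom R P X"
  obtain g where g: "linear_map R Q X g" "\<And>x. x \<in> carrier P \<Longrightarrow> g (s x) = f x"
    using factorsE[OF fac linear_map_of_rhom[OF f linear_mapD(1)[OF s] X]] by blast
  have "f = pullback P s (restrict g (carrier Q))"
    using f g linear_mapD(3)[OF s]
    by (auto simp: pullback_def compose_def rhom_def fun_eq_iff PiE_iff extensional_def)
  then show "f \<in> pullback P s ` rhom R Q X" using restrict_rhom[OF g(1)] by blast
qed

lemma D_class_iff:
  fixes X :: "('a, 'u) module"
  assumes s: "linear_map R P Q s"
  shows "X \<in> D_class R P Q s \<longleftrightarrow> X \<in> right_modules R \<and> factors R P Q s X"
proof -
  have "pullback P s ` rhom R Q X = rhom R P X \<longleftrightarrow> factors R P Q s X" if X: "right_module R X"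
    using pullback_rhom[OF s X] unfolding factors_iff_pullback[OF s X] by blast
  then show ?thesis unfolding D_class_def right_modules_def by blast
qed


section \<open>Free modules and the group Ext\<close>

lemma free_right_module: "ring R \<Longrightarrow> right_module R (free_module R S)"
  unfolding free_module_def by (intro direct_sum_right_module regular_right_module)

lemma small_direct_sum:
  assumes "module_universe TYPE('u)" "small TYPE('u) I" "small TYPE('u) (carrier M)"
  shows "small TYPE('u) (carrier (direct_sum I (\<lambda>_. M)))"
  by (rule small_subset[OF small_PiE[OF assms]]) (auto simp: carrier_direct_sum)

lemma lifts_free:
  assumes "ring R"
  shows "lifts R (free_module R S) A B"
  unfolding free_module_def by (intro lifts_direct_sum assms lifts_regular regular_right_module)

lemma
  assumes M: "right_module R M" and S: "S \<subseteq> carrier M"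
  shows linear_map_lincomb: "linear_map R (free_module R S) M (lincomb R M S)"
    and lincomb_single: "x \<in> S \<Longrightarrow> r \<in> carrier R \<Longrightarrow>
      lincomb R M S (single S (\<lambda>_. regular_module R) x r) = r \<odot>\<^bsub>M\<^esub> x"
proof -
  interpret M: right_module R M by fact
  have R: "ring R" by (rule M.R.ring_axioms)
  let ?c = "copair S (\<lambda>_. regular_module R) M (\<lambda>x r. r \<odot>\<^bsub>M\<^esub> x)"
  have orbit: "linear_map R (regular_module R) M (\<lambda>r. r \<odot>\<^bsub>M\<^esub> x)" if "x \<in> S" for x
    using linear_map_orbit[OF M] S that by blast
  have eq: "lincomb R M S c = ?c c" if "c \<in> carrier (free_module R S)" for c
    using that by (simp add: lincomb_def copair_def)
  show "linear_map R (free_module R S) M (lincomb R M S)"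
    by (rule linear_map_cong[OF _ eq]) (auto simp: free_module_def
        intro!: linear_map_direct_sum R regular_right_module M orbit)
  assume x: "x \<in> S" and r: "r \<in> carrier R"
  have "single S (\<lambda>_. regular_module R) x r \<in> carrier (free_module R S)"
    unfolding free_module_def
    using single_closed[where M = "\<lambda>_. regular_module R", OF R regular_right_module[OF R] x] r by simp
  moreover have "?c (single S (\<lambda>_. regular_module R) x r) = r \<odot>\<^bsub>M\<^esub> x"
    using copair_single[where M = "\<lambda>_. regular_module R" and g = "\<lambda>x r. r \<odot>\<^bsub>M\<^esub> x", OF M orbit x] r
    by simp
  ultimately show "lincomb R M S (single S (\<lambda>_. regular_module R) x r) = r \<odot>\<^bsub>M\<^esub> x"
    using eq by simp
qed

lemma lincomb_image:
  assumes M: "right_module R M" and S: "S \<subseteq> carrier M"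
  shows "S \<subseteq> lincomb R M S ` carrier (free_module R S)"
proof
  interpret M: right_module R M by fact
  have R: "ring R" by (rule M.R.ring_axioms)
  fix x assume x: "x \<in> S"
  have "single S (\<lambda>_. regular_module R) x \<one>\<^bsub>R\<^esub> \<in> carrier (free_module R S)"
    unfolding free_module_def
    using single_closed[where M = "\<lambda>_. regular_module R", OF R regular_right_module[OF R] x] by simp
  moreover have "lincomb R M S (single S (\<lambda>_. regular_module R) x \<one>\<^bsub>R\<^esub>) = x"
    using lincomb_single[OF M S x] x S by auto
  ultimately show "x \<in> lincomb R M S ` carrier (free_module R S)" by force
qed

lemma lincomb_surj:
  assumes "right_module R M"
  shows "lincomb R M (carrier M) ` carrier (free_module R (carrier M)) = carrier M"
  using lincomb_image[OF assms order_refl] linear_mapD(3)[OF linear_map_lincomb[OF assms order_refl]]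
  by blast

text \<open>Exactness of the standard free resolution: its differential maps onto the kernel of the previous one,
  as all elements of the kernel serve as generators.\<close>

lemma lincomb_kernel:
  assumes d: "linear_map R M N d"
  shows "lincomb R M (a_kernel M N d) ` carrier (free_module R (a_kernel M N d)) = a_kernel M N d"
proof (intro equalityI lincomb_image)
  interpret d: linear_map R M N d by fact
  have R: "ring R" by (rule d.M.R.ring_axioms)
  let ?K = "a_kernel M N d"
  have M: "right_module R M" by (rule d.M.right_module_axioms)
  have N: "right_module R N" by (rule d.N.right_module_axioms)
  have K: "?K \<subseteq> carrier M" by auto
  show "right_module R M" "?K \<subseteq> carrier M" by fact+
  note lin = linear_map_lincomb[OF M K]
  have "d (lincomb R M ?K c) = \<zero>\<^bsub>N\<^esub>" if c: "c \<in> carrier (free_module R ?K)" for c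
  proof (rule direct_sum_map_eqI[where k = "\<lambda>_. \<zero>\<^bsub>N\<^esub>" and h = "\<lambda>c. d (lincomb R M ?K c)"])
    show "c \<in> carrier (direct_sum ?K (\<lambda>_. regular_module R))"
      using c by (simp add: free_module_def)
    show "linear_map R (direct_sum ?K (\<lambda>_. regular_module R)) N (\<lambda>c. d (lincomb R M ?K c))"
      using linear_map_compose[OF lin d] by (simp add: free_module_def)
    show "linear_map R (direct_sum ?K (\<lambda>_. regular_module R)) N (\<lambda>_. \<zero>\<^bsub>N\<^esub>)"
      by (intro linear_map_zero direct_sum_right_module R regular_right_module N)
    fix x r assume "x \<in> ?K" "r \<in> carrier (regular_module R)"
    then show "d (lincomb R M ?K (single ?K (\<lambda>_. regular_module R) x r)) = \<zero>\<^bsub>N\<^esub>"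
      using lincomb_single[OF M K] by (simp add: d.map_smult d.N.smult_zero)
  qed (rule regular_right_module[OF R])
  then show "lincomb R M ?K ` carrier (free_module R ?K) \<subseteq> ?K"
    using linear_mapD(3)[OF lin] by auto
qed

lemma hom_group_comm_group:
  assumes M: "right_module R M" and N: "right_module R N"
  shows "comm_group (hom_group R M N)"
proof -
  interpret N: right_module R N by fact
  have lin: "linear_map R M N f" if "f \<in> rhom R M N" for f
    by (rule linear_map_of_rhom[OF that M N])
  have cl: "f x \<in> carrier N" if "f \<in> rhom R M N" "x \<in> carrier M" for f x
    using linear_mapD(3)[OF lin] that by blast
  show ?thesis
  proof (rule comm_groupI)
    fix f g assume "f \<in> carrier (hom_group R M N)" "g \<in> carrier (hom_group R M N)"
    then show "f \<otimes>\<^bsub>hom_group R M N\<^esub> g \<in> carrier (hom_group R M N)"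
      using restrict_rhom[OF linear_map_add[OF lin[of f] lin[of g]]] by (simp add: hom_group_def)
  next
    show "\<one>\<^bsub>hom_group R M N\<^esub> \<in> carrier (hom_group R M N)"
      using restrict_rhom[OF linear_map_zero[OF M N]] by (simp add: hom_group_def)
  next
    fix f assume f: "f \<in> carrier (hom_group R M N)"
    then have "restrict (\<lambda>x. \<ominus>\<^bsub>N\<^esub> f x) (carrier M) \<in> carrier (hom_group R M N)"
      using restrict_rhom[OF linear_map_uminus[OF lin[of f]]] by (simp add: hom_group_def)
    moreover have "restrict (\<lambda>x. \<ominus>\<^bsub>N\<^esub> f x) (carrier M) \<otimes>\<^bsub>hom_group R M N\<^esub> f = \<one>\<^bsub>hom_group R M N\<^esub>"
      using f cl by (auto simp: hom_group_def N.M.l_neg intro!: restrict_ext)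
    ultimately show "\<exists>g\<in>carrier (hom_group R M N). g \<otimes>\<^bsub>hom_group R M N\<^esub> f = \<one>\<^bsub>hom_group R M N\<^esub>"
      by blast
    show "\<one>\<^bsub>hom_group R M N\<^esub> \<otimes>\<^bsub>hom_group R M N\<^esub> f = f"
    proof (rule extensionalityI)
      show "f \<in> extensional (carrier M)" using f by (auto simp: hom_group_def rhom_def PiE_def)
      show "(\<one>\<^bsub>hom_group R M N\<^esub> \<otimes>\<^bsub>hom_group R M N\<^esub> f) x = f x" if "x \<in> carrier M" for x
        using cl[of f x] f that by (simp add: hom_group_def)
    qed (simp add: hom_group_def)
  next
    fix f g h assume "f \<in> carrier (hom_group R M N)" "g \<in> carrier (hom_group R M N)"
      "h \<in> carrier (hom_group R M N)"
    then show "f \<otimes>\<^bsub>hom_group R M N\<^esub> g \<otimes>\<^bsub>hom_group R M N\<^esub> h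
        = f \<otimes>\<^bsub>hom_group R M N\<^esub> (g \<otimes>\<^bsub>hom_group R M N\<^esub> h)"
      using cl[of f] cl[of g] cl[of h] by (simp add: hom_group_def N.M.a_assoc cong: restrict_cong)
  next
    fix f g assume "f \<in> carrier (hom_group R M N)" "g \<in> carrier (hom_group R M N)"
    then show "f \<otimes>\<^bsub>hom_group R M N\<^esub> g = g \<otimes>\<^bsub>hom_group R M N\<^esub> f"
      using cl[of f] cl[of g] by (simp add: hom_group_def N.M.a_comm cong: restrict_cong)
  qed
qed

lemma pullback_group_hom:
  assumes s: "linear_map R P Q s" and X: "right_module R X"
  shows "group_hom (hom_group R Q X) (hom_group R P X) (pullback P s)"
proof -
  interpret s: linear_map R P Q s by fact
  have P: "right_module R P" and Q: "right_module R Q"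
    by (rule s.M.right_module_axioms s.N.right_module_axioms)+
  interpret G: comm_group "hom_group R Q X" by (rule hom_group_comm_group[OF Q X])
  interpret H: comm_group "hom_group R P X" by (rule hom_group_comm_group[OF P X])
  have "pullback P s f \<in> rhom R P X" if "f \<in> rhom R Q X" for f
    using restrict_rhom[OF linear_map_compose[OF s linear_map_of_rhom[OF that Q X]]]
    by (simp add: pullback_def compose_def)
  then have "pullback P s \<in> hom (hom_group R Q X) (hom_group R P X)"
    by (auto simp: hom_def hom_group_def pullback_def compose_def fun_eq_iff)
  then show ?thesis
    by (simp add: group_hom_def group_hom_axioms_def G.group_axioms H.group_axioms)
qed

text \<open>A cocycle on \<open>P1\<close> vanishes on the image of \<open>P2\<close>, which is the kernel of the map from \<open>P1\<close> onto \<open>K0\<close>.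
  So cocycles are the linear maps on \<open>K0\<close>, and coboundaries are those that extend to \<open>P0\<close>.\<close>

lemma Ext1_trivial_iff_free:
  fixes X :: "('a, 'b) module"
  assumes X: "right_module R X" and Y: "right_module R Y"
  defines "P0 \<equiv> free_module R (carrier X)" and "d0 \<equiv> lincomb R X (carrier X)"
  shows "trivial_group (Ext1 R X Y) \<longleftrightarrow>
    factors R (P0\<lparr>carrier := a_kernel P0 X d0\<rparr>) P0 (\<lambda>x. x) Y"
proof -
  interpret X: right_module R X by fact
  interpret Y: right_module R Y by fact
  have R: "ring R" by (rule X.R.ring_axioms)
  define K0 where "K0 = a_kernel P0 X d0"
  define P1 where "P1 = free_module R K0"
  define d1 where "d1 = lincomb R P0 K0"
  define K1 where "K1 = a_kernel P1 P0 d1"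
  define P2 where "P2 = free_module R K1"
  define d2 where "d2 = lincomb R P1 K1"
  have P: "right_module R P0" "right_module R P1" "right_module R P2"
    unfolding P0_def P1_def P2_def by (rule free_right_module[OF R])+
  have d0: "linear_map R P0 X d0" unfolding P0_def d0_def
    by (rule linear_map_lincomb[OF X order_refl])
  have K0: "K0 \<subseteq> carrier P0" "K0 = d1 ` carrier P1" "submodule K0 R P0"
    using linear_map.submodule_kernel[OF d0] lincomb_kernel[OF d0]
    unfolding K0_def P1_def d1_def by auto
  have d1: "linear_map R P1 P0 d1" unfolding P1_def d1_def
    by (rule linear_map_lincomb[OF P(1) K0(1)])
  have K1: "K1 \<subseteq> carrier P1" "K1 = d2 ` carrier P2"
    using lincomb_kernel[OF d1] unfolding K1_def P2_def d2_def by auto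
  have d2: "linear_map R P2 P1 d2" unfolding P2_def d2_def
    by (rule linear_map_lincomb[OF P(2) K1(1)])
  define Z where "Z = kernel (hom_group R P1 Y) (hom_group R P2 Y) (pullback P2 d2)"
  define G where "G = (hom_group R P1 Y)\<lparr>carrier := Z\<rparr>"
  define B where "B = pullback P1 d1 ` rhom R P0 Y"
  have Ext: "Ext1 R X Y = G Mod B"
    by (simp add: Ext1_def Let_def hom_group_def B_def G_def Z_def d2_def P2_def K1_def d1_def
        P1_def K0_def d0_def P0_def)
  interpret d2: group_hom "hom_group R P1 Y" "hom_group R P2 Y" "pullback P2 d2"
    by (rule pullback_group_hom[OF d2 Y])
  interpret d1: group_hom "hom_group R P0 Y" "hom_group R P1 Y" "pullback P1 d1"
    by (rule pullback_group_hom[OF d1 Y])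
  have carr: "carrier (hom_group R M N) = rhom R M N" for M :: "('a, 'x) module" and N :: "('a, 'y) module"
    by (simp add: hom_group_def)
  have Z: "f \<in> Z \<longleftrightarrow> f \<in> rhom R P1 Y \<and> (\<forall>w \<in> K1. f w = \<zero>\<^bsub>Y\<^esub>)" for f
    by (auto simp: Z_def kernel_def hom_group_def pullback_def compose_def fun_eq_iff K1(2))
  have ext: "(\<forall>g. linear_map R (P0\<lparr>carrier := K0\<rparr>) Y g \<longrightarrow>
      (\<exists>h. linear_map R P0 Y h \<and> (\<forall>x \<in> K0. h x = g x))) \<longleftrightarrow> Z \<subseteq> B"
  proof (intro iffI subsetI allI impI)
    fix z assume ext: "\<forall>g. linear_map R (P0\<lparr>carrier := K0\<rparr>) Y g \<longrightarrow>
      (\<exists>h. linear_map R P0 Y h \<and> (\<forall>x \<in> K0. h x = g x))" and z: "z \<in> Z"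
    have zlin: "linear_map R P1 Y z" using z Z by (auto intro: linear_map_of_rhom P Y)
    have d1': "linear_map R P1 (P0\<lparr>carrier := K0\<rparr>) d1"
      by (rule linear_map_corestrict[OF d1 K0(3)]) (auto simp: K0(2))
    obtain g where g: "linear_map R (P0\<lparr>carrier := K0\<rparr>) Y g" "\<And>w. w \<in> carrier P1 \<Longrightarrow> g (d1 w) = z w"
    proof (rule linear_map_factor[OF d1' _ zlin])
      show "a_kernel P1 (P0\<lparr>carrier := K0\<rparr>) d1 \<subseteq> a_kernel P1 Y z"
        using z Z by (auto simp: K1_def)
    qed (use K0(2) in auto)
    obtain h where h: "linear_map R P0 Y h" "\<And>x. x \<in> K0 \<Longrightarrow> h x = g x" using ext g(1) by blast
    have "pullback P1 d1 (restrict h (carrier P0)) w = z w" if w: "w \<in> carrier P1" for w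
    proof -
      have "d1 w \<in> K0" "d1 w \<in> carrier P0" using w K0 by auto
      then show ?thesis using w h(2) g(2)[OF w] by (simp add: pullback_def compose_def)
    qed
    then have "z = pullback P1 d1 (restrict h (carrier P0))"
      using z Z by (intro extensionalityI[of _ "carrier P1"]) (auto simp: rhom_def PiE_def pullback_def)
    then show "z \<in> B" unfolding B_def using restrict_rhom[OF h(1)] by blast
  next
    fix g assume ZB: "Z \<subseteq> B" and g: "linear_map R (P0\<lparr>carrier := K0\<rparr>) Y g"
    let ?z = "restrict (\<lambda>w. g (d1 w)) (carrier P1)"
    have d1': "linear_map R P1 (P0\<lparr>carrier := K0\<rparr>) d1"
      by (rule linear_map_corestrict[OF d1 K0(3)]) (auto simp: K0(2))
    interpret g: linear_map R "P0\<lparr>carrier := K0\<rparr>" Y g by fact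
    have "?z \<in> Z" unfolding Z
      using restrict_rhom[OF linear_map_compose[OF d1' g]] g.map_zero by (auto simp: K1_def)
    then obtain h where h: "h \<in> rhom R P0 Y" "?z = pullback P1 d1 h" using ZB B_def by blast
    have "h (d1 w) = g (d1 w)" if "w \<in> carrier P1" for w
      using fun_cong[OF h(2), of w] that by (simp add: pullback_def compose_def)
    then show "\<exists>h. linear_map R P0 Y h \<and> (\<forall>x \<in> K0. h x = g x)"
      using linear_map_of_rhom[OF h(1) P(1) Y] K0(2) by blast
  qed
  have BZ: "B \<subseteq> Z"
  proof
    fix f assume "f \<in> B"
    then obtain h where h: "h \<in> rhom R P0 Y" "f = pullback P1 d1 h" by (auto simp: B_def)
    have "f \<in> rhom R P1 Y" using d1.hom_closed h by (simp add: carr)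
    moreover have "f w = \<zero>\<^bsub>Y\<^esub>" if "w \<in> K1" for w
      using that linear_map.map_zero[OF linear_map_of_rhom[OF h(1) P(1) Y]]
      by (simp add: h(2) pullback_def compose_def K1_def)
    ultimately show "f \<in> Z" by (simp add: Z)
  qed
  have "trivial_group (G Mod B) \<longleftrightarrow> Z \<subseteq> B"
  proof
    assume triv: "trivial_group (G Mod B)"
    show "Z \<subseteq> B"
    proof
      fix z assume z: "z \<in> Z"
      have "B #>\<^bsub>G\<^esub> z \<in> carrier (G Mod B)" using z by (auto simp: carrier_FactGroup G_def)
      then have "B #>\<^bsub>G\<^esub> z = B" using triv by (simp add: trivial_group_def)
      moreover have "\<one>\<^bsub>hom_group R P1 Y\<^esub> \<in> B"
        unfolding B_def using d1.hom_one d1.G.one_closed by (metis carr image_eqI)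
      then have "\<one>\<^bsub>hom_group R P1 Y\<^esub> \<otimes>\<^bsub>G\<^esub> z \<in> B #>\<^bsub>G\<^esub> z" by (auto simp: r_coset_def)
      moreover have "\<one>\<^bsub>hom_group R P1 Y\<^esub> \<otimes>\<^bsub>G\<^esub> z = z" using z Z by (simp add: G_def carr)
      ultimately show "z \<in> B" by simp
    qed
  next
    assume "Z \<subseteq> B"
    then have B: "B = carrier G" using BZ by (simp add: G_def)
    have sub: "subgroup Z (hom_group R P1 Y)" unfolding Z_def by (rule d2.subgroup_kernel)
    interpret G: group G
      unfolding G_def by (rule subgroup.subgroup_is_group[OF sub d2.G.group_axioms])
    interpret B: normal B G
      unfolding B by (rule G.normal_invI[OF G.subgroup_self]) simp
    have "group (G Mod B)" by (rule B.factorgroup_is_group)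
    moreover have "carrier (G Mod B) = {\<one>\<^bsub>G Mod B\<^esub>}"
      unfolding carrier_FactGroup B using G.coset_join2[OF _ G.subgroup_self] G.one_closed by auto
    ultimately show "trivial_group (G Mod B)" by (simp add: trivial_group_def)
  qed
  then show ?thesis unfolding Ext ext[symmetric] factors_def K0_def by simp
qed

text \<open>The extension property of the kernel does not depend on the choice of the presentation of \<open>M\<close>, by
  the comparison of two presentations that map to each other over \<open>M\<close>.\<close>

lemma factors_kernel_transfer:
  assumes p: "linear_map R P M p" and q: "linear_map R Q M q"
    and h: "linear_map R P Q h" "\<And>x. x \<in> carrier P \<Longrightarrow> q (h x) = p x"
    and k: "linear_map R Q P k" "\<And>x. x \<in> carrier Q \<Longrightarrow> p (k x) = q x"
    and fac: "factors R (P\<lparr>carrier := a_kernel P M p\<rparr>) P (\<lambda>x. x) Y"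
  shows "factors R (Q\<lparr>carrier := a_kernel Q M q\<rparr>) Q (\<lambda>x. x) Y"
proof (rule factorsI)
  interpret p: linear_map R P M p by fact
  interpret q: linear_map R Q M q by fact
  interpret h: linear_map R P Q h by fact
  interpret k: linear_map R Q P k by fact
  note sub = p.submodule_kernel q.submodule_kernel
  fix f assume f: "linear_map R (Q\<lparr>carrier := a_kernel Q M q\<rparr>) Y f"
  interpret f: linear_map R "Q\<lparr>carrier := a_kernel Q M q\<rparr>" Y f by fact
  have h': "linear_map R (P\<lparr>carrier := a_kernel P M p\<rparr>) (Q\<lparr>carrier := a_kernel Q M q\<rparr>) h"
    by (rule linear_map_corestrict[OF linear_map_restrict[OF h(1) sub(1)] sub(2)]) (auto simp: h(2))
  obtain g where g: "linear_map R P Y g" "\<And>x. x \<in> a_kernel P M p \<Longrightarrow> g x = f (h x)"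
    using factorsE[OF fac linear_map_compose[OF h' f]] by auto
  interpret g: linear_map R P Y g by fact
  \<comment> \<open>The identity and \<open>h \<circ> k\<close> differ by a map into the kernel of \<open>q\<close>, since
    \<open>q \<circ> h \<circ> k = p \<circ> k = q\<close>. Hence \<open>g \<circ> k\<close>, which extends \<open>f \<circ> h \<circ> k\<close>, can be corrected.\<close>
  have kh: "linear_map R Q (Q\<lparr>carrier := a_kernel Q M q\<rparr>) (\<lambda>x. x \<ominus>\<^bsub>Q\<^esub> h (k x))"
    by (rule linear_map_corestrict[OF linear_map_minus[OF linear_map_id linear_map_compose[OF k(1) h(1)]] sub(2)])
      (auto simp: q.M.right_module_axioms q.map_minus h(2) k(2) p.N.minus_eq_zero_iff)
  let ?g = "\<lambda>x. g (k x) \<oplus>\<^bsub>Y\<^esub> f (x \<ominus>\<^bsub>Q\<^esub> h (k x))"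
  have "linear_map R Q Y ?g"
    by (rule linear_map_add[OF linear_map_compose[OF k(1) g(1)] linear_map_compose[OF kh f]])
  moreover have "?g x = f x" if x: "x \<in> a_kernel Q M q" for x
  proof -
    have hk: "h (k x) \<in> a_kernel Q M q" "k x \<in> a_kernel P M p" using x by (auto simp: h(2) k(2))
    have d: "x \<ominus>\<^bsub>Q\<^esub> h (k x) \<in> a_kernel Q M q" using linear_mapD(3)[OF kh] x by auto
    have "?g x = f (h (k x)) \<oplus>\<^bsub>Y\<^esub> f (x \<ominus>\<^bsub>Q\<^esub> h (k x))" using g(2)[OF hk(2)] by simp
    also have "\<dots> = f (h (k x) \<oplus>\<^bsub>Q\<^esub> (x \<ominus>\<^bsub>Q\<^esub> h (k x)))"
      using f.map_add[of "h (k x)" "x \<ominus>\<^bsub>Q\<^esub> h (k x)"] hk(1) d by simp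
    also have "h (k x) \<oplus>\<^bsub>Q\<^esub> (x \<ominus>\<^bsub>Q\<^esub> h (k x)) = x"
      using x hk by (intro q.M.add_minus_cancel) auto
    finally show ?thesis .
  qed
  ultimately show "\<exists>g. linear_map R Q Y g \<and>
      (\<forall>x\<in>carrier (Q\<lparr>carrier := a_kernel Q M q\<rparr>). g x = f x)" by auto
qed

text \<open>This frees the group \<open>Ext\<close> from the standard resolution: any presentation that lifts to the free one
  may be used.\<close>

lemma Ext1_trivial_iff:
  fixes X :: "('a, 'b) module"
  assumes X: "right_module R X" and Y: "right_module R Y"
    and q: "linear_map R Q X q" "q ` carrier Q = carrier X"
    and lifts: "lifts R Q (free_module R (carrier X)) X"
  shows "trivial_group (Ext1 R X Y) \<longleftrightarrow> factors R (Q\<lparr>carrier := a_kernel Q X q\<rparr>) Q (\<lambda>x. x) Y"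
proof -
  let ?P = "free_module R (carrier X)" and ?p = "lincomb R X (carrier X)"
  have R: "ring R" using X by (simp add: right_module_def)
  have p: "linear_map R ?P X ?p" "?p ` carrier ?P = carrier X"
    by (rule linear_map_lincomb[OF X order_refl] lincomb_surj[OF X])+
  obtain h where h: "linear_map R ?P Q h" "\<And>x. x \<in> carrier ?P \<Longrightarrow> q (h x) = ?p x"
    using liftsE[OF lifts_free[OF R] q p(1)] by blast
  obtain k where k: "linear_map R Q ?P k" "\<And>x. x \<in> carrier Q \<Longrightarrow> ?p (k x) = q x"
    using liftsE[OF lifts p q(1)] by blast
  show ?thesis
    unfolding Ext1_trivial_iff_free[OF X Y]
  proof (rule iffI)
    assume "factors R (?P\<lparr>carrier := a_kernel ?P X ?p\<rparr>) ?P (\<lambda>x. x) Y"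
    then show "factors R (Q\<lparr>carrier := a_kernel Q X q\<rparr>) Q (\<lambda>x. x) Y"
      by (rule factors_kernel_transfer[OF p(1) q(1) h(1) _ k(1), rotated 2]) (simp_all add: h(2) k(2))
  next
    assume "factors R (Q\<lparr>carrier := a_kernel Q X q\<rparr>) Q (\<lambda>x. x) Y"
    then show "factors R (?P\<lparr>carrier := a_kernel ?P X ?p\<rparr>) ?P (\<lambda>x. x) Y"
      by (rule factors_kernel_transfer[OF q(1) p(1) k(1) _ h(1), rotated 2]) (simp_all add: h(2) k(2))
  qed
qed


section \<open>Torsion classes and generated classes\<close>

lemma torsion_classD:
  fixes \<T> :: "('a, 'u) module set"
  assumes "torsion_class R \<T>"
  shows "\<T> \<subseteq> right_modules R"
    and "\<forall>X \<in> \<T>. \<forall>Y \<in> right_modules R. epis R X Y \<noteq> {} \<longrightarrow> Y \<in> \<T>"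
    and "\<forall>(I :: 'u set) M. small TYPE('u) I \<and> (\<forall>i \<in> I. M i \<in> \<T>) \<longrightarrow>
        (\<forall>Y \<in> right_modules R. isomorphic R (direct_sum I M) Y \<longrightarrow> Y \<in> \<T>)"
    and "\<forall>A \<in> \<T>. \<forall>C \<in> \<T>. \<forall>B \<in> right_modules R. \<forall>i p. short_exact R A i B p C \<longrightarrow> B \<in> \<T>"
proof -
  note * = assms[unfolded torsion_class_def]
  show "\<T> \<subseteq> right_modules R" using * by (elim conjE)
  show "\<forall>X \<in> \<T>. \<forall>Y \<in> right_modules R. epis R X Y \<noteq> {} \<longrightarrow> Y \<in> \<T>" using * by (elim conjE)
  show "\<forall>(I :: 'u set) M. small TYPE('u) I \<and> (\<forall>i \<in> I. M i \<in> \<T>) \<longrightarrow>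
        (\<forall>Y \<in> right_modules R. isomorphic R (direct_sum I M) Y \<longrightarrow> Y \<in> \<T>)" using * by (elim conjE)
  show "\<forall>A \<in> \<T>. \<forall>C \<in> \<T>. \<forall>B \<in> right_modules R. \<forall>i p. short_exact R A i B p C \<longrightarrow> B \<in> \<T>"
    using * by (elim conjE)
qed

lemma torsion_class_right_modules: "torsion_class R \<T> \<Longrightarrow> X \<in> \<T> \<Longrightarrow> X \<in> right_modules R"
  using torsion_classD(1) by (rule subsetD)

lemma epis_of_linear_map:
  assumes "linear_map R X Y p" "p ` carrier X = carrier Y"
  shows "restrict p (carrier X) \<in> epis R X Y"
  using restrict_rhom[OF assms(1)] assms(2) by (simp add: epis_def)

lemma torsion_class_epi:
  fixes \<T> :: "('a, 'u) module set"
  assumes "torsion_class R \<T>" "X \<in> \<T>" "Y \<in> right_modules R"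
    and "linear_map R X Y p" "p ` carrier X = carrier Y"
  shows "Y \<in> \<T>"
proof -
  have "epis R X Y \<noteq> {}" using epis_of_linear_map[OF assms(4,5)] by blast
  with torsion_classD(2)[OF assms(1)] assms(2,3) show ?thesis by simp
qed

lemma torsion_class_direct_sum_epi:
  fixes \<T> :: "('a, 'u) module set" and I :: "'u set"
  assumes U: "module_universe TYPE('u)" and \<T>: "torsion_class R \<T>" and T: "T \<in> \<T>"
    and I: "small TYPE('u) I" and Y: "Y \<in> right_modules R"
    and p: "linear_map R (direct_sum I (\<lambda>_. T)) Y p" "p ` carrier (direct_sum I (\<lambda>_. T)) = carrier Y"
  shows "Y \<in> \<T>"
proof -
  let ?S = "direct_sum I (\<lambda>_. T)"
  have T': "small TYPE('u) (carrier T)" using torsion_class_right_modules[OF \<T> T] by (simp add: right_modules_def)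
  obtain S' :: "('a, 'u) module" and b b' where S': "S' \<in> right_modules R" "linear_map R ?S S' b"
    "linear_map R S' ?S b'" "\<And>x. x \<in> carrier ?S \<Longrightarrow> b' (b x) = x" "\<And>y. y \<in> carrier S' \<Longrightarrow> b (b' y) = y"
    using ex_copy_inverse[OF linear_mapD(1)[OF p(1)] small_direct_sum[OF U I T']] by blast
  have cl: "b x \<in> carrier S'" if "x \<in> carrier ?S" for x using linear_mapD(3)[OF S'(2) that] .
  have cl': "b' y \<in> carrier ?S" if "y \<in> carrier S'" for y using linear_mapD(3)[OF S'(3) that] .
  have "bij_betw (restrict b (carrier ?S)) (carrier ?S) (carrier S')"
    by (rule bij_betw_byWitness[where f' = b']) (use S'(4,5) cl cl' in auto)
  then have "isomorphic R ?S S'" unfolding isomorphic_def using restrict_rhom[OF S'(2)] by blast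
  with torsion_classD(3)[OF \<T>, THEN spec, THEN spec, of I "\<lambda>_. T"] T I S'(1)
  have "S' \<in> \<T>" by simp
  moreover have "linear_map R S' Y (\<lambda>y. p (b' y))" by (rule linear_map_compose[OF S'(3) p(1)])
  moreover have "(\<lambda>y. p (b' y)) ` carrier S' = carrier Y"
  proof (intro equalityI subsetI)
    fix y assume "y \<in> carrier Y"
    then obtain x where "x \<in> carrier ?S" "y = p x" using p(2) by blast
    then have "y = p (b' (b x))" "b x \<in> carrier S'" using S'(4) cl by auto
    then show "y \<in> (\<lambda>y. p (b' y)) ` carrier S'" by blast
  qed (use cl' linear_mapD(3)[OF p(1)] in auto)
  ultimately show ?thesis using torsion_class_epi[OF \<T> _ Y] by blast
qed

lemma Gen_subset_torsion_class:
  fixes \<T> :: "('a, 'u) module set"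
  assumes U: "module_universe TYPE('u)" and \<T>: "torsion_class R \<T>" and T: "T \<in> \<T>"
  shows "Gen R T \<subseteq> \<T>"
proof
  fix X assume "X \<in> Gen R T"
  then obtain I :: "'u set" and p where X: "X \<in> right_modules R" and I: "small TYPE('u) I"
    and p: "p \<in> rhom R (direct_sum I (\<lambda>_. T)) X" "p ` carrier (direct_sum I (\<lambda>_. T)) = carrier X"
    by (auto simp: Gen_def epis_def)
  have Xm: "right_module R X" using X by (simp add: right_modules_def)
  have Tm: "right_module R T"
    using torsion_class_right_modules[OF \<T> T] by (simp add: right_modules_def)
  have "linear_map R (direct_sum I (\<lambda>_. T)) X p"
    using Xm Tm by (intro linear_map_of_rhom[OF p(1)] direct_sum_right_module) (simp_all add: right_module_def)
  then show "X \<in> \<T>" using torsion_class_direct_sum_epi[OF U \<T> T I X _ p(2)] by blast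
qed

text \<open>The elements of \<open>X\<close> serve as indices of the copies of \<open>T\<close>.\<close>

lemma GenI:
  fixes X T :: "('a, 'u) module"
  assumes X: "X \<in> right_modules R" and T: "right_module R T"
    and gen: "\<And>x. x \<in> carrier X \<Longrightarrow> \<exists>g. linear_map R T X g \<and> x \<in> g ` carrier T"
  shows "X \<in> Gen R T"
proof -
  have Xm: "right_module R X" and small: "small TYPE('u) (carrier X)"
    using X by (simp_all add: right_modules_def)
  have R: "ring R" using T by (simp add: right_module_def)
  obtain g where g: "\<And>x. x \<in> carrier X \<Longrightarrow> linear_map R T X (g x)"
    "\<And>x. x \<in> carrier X \<Longrightarrow> x \<in> g x ` carrier T" using gen by metis
  let ?S = "direct_sum (carrier X) (\<lambda>_. T)" and ?c = "copair (carrier X) (\<lambda>_. T) X g"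
  have lin: "linear_map R ?S X ?c" by (rule linear_map_direct_sum[OF R T Xm g(1)])
  have "?c ` carrier ?S = carrier X"
  proof (intro equalityI subsetI)
    fix x assume x: "x \<in> carrier X"
    then obtain t where t: "t \<in> carrier T" "x = g x t" using g(2) by blast
    have "single (carrier X) (\<lambda>_. T) x t \<in> carrier ?S"
      by (rule single_closed[where M = "\<lambda>_. T", OF R T x t(1)])
    moreover have "?c (single (carrier X) (\<lambda>_. T) x t) = x"
      using copair_single[where M = "\<lambda>_. T" and g = g, OF Xm g(1) x t(1)] t(2) by simp
    ultimately show "x \<in> ?c ` carrier ?S" by (metis image_eqI)
  qed (use linear_mapD(3)[OF lin] in auto)
  then have "epis R ?S X \<noteq> {}" using epis_of_linear_map[OF lin] by blast
  then show ?thesis using X small by (auto simp: Gen_def)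
qed

lemma preenvelope_iff:
  fixes \<T> :: "('a, 'u) module set"
  assumes \<T>: "torsion_class R \<T>" and R: "ring R"
  shows "preenvelope R \<T> (regular_module R) M e \<longleftrightarrow> M \<in> \<T> \<and> e \<in> rhom R (regular_module R) M \<and>
    (\<forall>X \<in> \<T>. factors R (regular_module R) M e X)"
proof -
  have mod: "right_module R X" if "X \<in> \<T>" for X
    using torsion_class_right_modules[OF \<T> that] by (simp add: right_modules_def)
  have "(\<forall>f \<in> rhom R (regular_module R) X. \<exists>g \<in> rhom R M X. compose (carrier (regular_module R)) g e = f)
      \<longleftrightarrow> factors R (regular_module R) M e X"
    if X: "X \<in> \<T>" and M: "M \<in> \<T>" and e: "e \<in> rhom R (regular_module R) M" for X
  proof -
    have lin: "linear_map R (regular_module R) M e"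
      by (rule linear_map_of_rhom[OF e regular_right_module[OF R] mod[OF M]])
    show ?thesis unfolding factors_iff_pullback[OF lin mod[OF X]] pullback_def
      by (auto simp: subset_iff image_iff eq_commute)
  qed
  then show ?thesis unfolding preenvelope_def by blast
qed

section \<open>Minimal presentations\<close>

text \<open>The step that needs a minimal presentation. Extension from the kernel of \<open>\<pi>\<close> only concerns maps on \<open>P1\<close>
  that vanish on the kernel of \<open>s\<close>. Passing to the quotient of \<open>X\<close> by the image of that kernel puts an
  arbitrary map into this form, and superfluity removes the error made when lifting back to \<open>X\<close>.\<close>

lemma factors_minimal_presentation:
  fixes \<T> :: "('a, 'u) module set"
  assumes \<T>: "torsion_class R \<T>" and X: "X \<in> \<T>"
    and s: "linear_map R P1 P0 s" and \<pi>: "linear_map R P0 M \<pi>"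
    and exact: "s ` carrier P1 = a_kernel P0 M \<pi>"
    and super: "superfluous R P1 (a_kernel P1 P0 s)"
    and lifts: "\<And>Y :: ('a, 'u) module. Y \<in> \<T> \<Longrightarrow> lifts R P0 X Y"
    and ext: "\<And>Y. Y \<in> \<T> \<Longrightarrow> factors R (P0\<lparr>carrier := a_kernel P0 M \<pi>\<rparr>) P0 (\<lambda>x. x) Y"
  shows "factors R P1 P0 s X"
proof (rule factorsI)
  fix f assume f: "linear_map R P1 X f"
  interpret s: linear_map R P1 P0 s by fact
  interpret f: linear_map R P1 X f by fact
  interpret \<pi>: linear_map R P0 M \<pi> by fact
  let ?L = "a_kernel P1 P0 s" and ?W = "P0\<lparr>carrier := a_kernel P0 M \<pi>\<rparr>"
  note X' = torsion_class_right_modules[OF \<T> X]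
  obtain Y :: "('a, 'u) module" and q where Y: "Y \<in> right_modules R"
    and q: "linear_map R X Y q" "q ` carrier X = carrier Y" "a_kernel X Y q = f ` ?L"
    using ex_quotient[OF _ _ f.submodule_image[OF s.submodule_kernel]] X'
    by (auto simp: right_modules_def)
  interpret q: linear_map R X Y q by fact
  have YT: "Y \<in> \<T>" by (rule torsion_class_epi[OF \<T> X Y q(1,2)])
  have s': "linear_map R P1 ?W s"
    by (rule linear_map_corestrict[OF s \<pi>.submodule_kernel]) (use exact in blast)
  have "\<exists>g. linear_map R ?W Y g \<and> (\<forall>x \<in> carrier P1. g (s x) = q (f x))"
  proof (rule linear_map_factor[OF s' _ linear_map_compose[OF f q(1)]])
    show "s ` carrier P1 = carrier ?W" using exact by simp
    show "a_kernel P1 ?W s \<subseteq> a_kernel P1 Y (\<lambda>x. q (f x))" using q(3) by auto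
  qed blast
  then obtain g0 where g0: "linear_map R ?W Y g0" "\<And>x. x \<in> carrier P1 \<Longrightarrow> g0 (s x) = q (f x)" by blast
  obtain g1 where g1: "linear_map R P0 Y g1" "\<And>w. w \<in> carrier ?W \<Longrightarrow> g1 w = g0 w"
    using factorsE[OF ext[OF YT] g0(1)] by blast
  obtain g where g: "linear_map R P0 X g" "\<And>u. u \<in> carrier P0 \<Longrightarrow> q (g u) = g1 u"
    using liftsE[OF lifts[OF YT] q(1,2) g1(1)] by blast
  interpret g: linear_map R P0 X g by fact
  define k where "k = (\<lambda>x. f x \<ominus>\<^bsub>X\<^esub> g (s x))"
  have k: "linear_map R P1 X k"
    unfolding k_def by (rule linear_map_minus[OF f linear_map_compose[OF s g(1)]])
  interpret k: linear_map R P1 X k by fact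
  have kL: "k l = f l" if "l \<in> ?L" for l using that by (simp add: k_def a_minus_def f.N.uminus_zero)
  have qk: "q (k x) = \<zero>\<^bsub>Y\<^esub>" if x: "x \<in> carrier P1" for x
  proof -
    have "s x \<in> carrier ?W" using exact x by auto
    then have "q (g (s x)) = q (f x)" using g(2) g1(2) g0(2) x by simp
    then show ?thesis using x by (simp add: k_def q.map_minus q.N.minus_eq_zero_iff)
  qed
  \<comment> \<open>On \<open>?L\<close> the maps \<open>k\<close> and \<open>f\<close> agree, so the values of \<open>k\<close>, which lie in \<open>f ` ?L\<close>, are already
    taken on the superfluous submodule.\<close>
  have "a_kernel P1 X k <+>\<^bsub>P1\<^esub> ?L = carrier P1"
  proof (intro equalityI subsetI)
    fix x assume x: "x \<in> carrier P1"
    have "k x \<in> f ` ?L" using qk[OF x] x q(3)[symmetric] by simp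
    then obtain l where l: "l \<in> ?L" "k x = k l" using kL by auto
    have "x \<ominus>\<^bsub>P1\<^esub> l \<in> a_kernel P1 X k" using x l by (simp add: k.map_minus f.N.minus_eq_zero_iff)
    moreover have "x = (x \<ominus>\<^bsub>P1\<^esub> l) \<oplus>\<^bsub>P1\<^esub> l" using x l by (simp add: s.M.minus_add_cancel)
    ultimately show "x \<in> a_kernel P1 X k <+>\<^bsub>P1\<^esub> ?L" 
      unfolding set_add_def' using l(1) by blast
  qed (auto simp: set_add_def')
  then have "a_kernel P1 X k = carrier P1"
    using super k.submodule_kernel unfolding superfluous_def by blast
  then have "k x = \<zero>\<^bsub>X\<^esub>" if "x \<in> carrier P1" for x using that by auto
  then have "g (s x) = f x" if "x \<in> carrier P1" for x
    using that by (simp add: k_def f.N.minus_eq_zero_iff)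
  then show "\<exists>g. linear_map R P0 X g \<and> (\<forall>x\<in>carrier P1. g (s x) = f x)" using g(1) by blast
qed

text \<open>The projective cover is taken of the kernel of the free presentation, not of \<open>M\<close>: it is the kernel of
  \<open>s\<close> that has to be superfluous.\<close>

lemma ex_minimal_presentation:
  fixes M :: "('a, 'u) module"
  assumes U: "module_universe TYPE('u)" and perfect: "right_perfect TYPE('u) R"
    and R: "small TYPE('u) (carrier R)" and M: "M \<in> right_modules R"
  defines "P0 \<equiv> free_module R (carrier M)" and "\<pi> \<equiv> lincomb R M (carrier M)"
  obtains P1 :: "('a, 'u) module" and s where "projective R P1" "linear_map R P1 P0 s"
    "s ` carrier P1 = a_kernel P0 M \<pi>" "superfluous R P1 (a_kernel P1 P0 s)"
proof -
  have Mm: "right_module R M" and small: "small TYPE('u) (carrier M)"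
    using M by (simp_all add: right_modules_def)
  have \<pi>: "linear_map R P0 M \<pi>" unfolding P0_def \<pi>_def by (rule linear_map_lincomb[OF Mm order_refl])
  interpret \<pi>: linear_map R P0 M \<pi> by fact
  let ?K = "a_kernel P0 M \<pi>" and ?W = "P0\<lparr>carrier := a_kernel P0 M \<pi>\<rparr>"
  have W: "right_module R ?W"
    by (rule submodule_right_module[OF \<pi>.M.right_module_axioms \<pi>.submodule_kernel])
  have "small TYPE('u) (carrier P0)"
    unfolding P0_def free_module_def by (rule small_direct_sum[OF U small]) (simp add: R)
  then have "small TYPE('u) (carrier ?W)" by (rule small_subset) auto
  then obtain W' :: "('a, 'u) module" and b b' where W': "W' \<in> right_modules R"
    "linear_map R ?W W' b" "linear_map R W' ?W b'"
    "\<And>x. x \<in> carrier ?W \<Longrightarrow> b' (b x) = x" "\<And>y. y \<in> carrier W' \<Longrightarrow> b (b' y) = y"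
    using ex_copy_inverse[OF W] by blast
  interpret b: linear_map R ?W W' b by fact
  interpret b': linear_map R W' ?W b' by fact
  obtain P1 :: "('a, 'u) module" and c where cover: "projective_cover R W' P1 c"
    using perfect W'(1) unfolding right_perfect_def by blast
  then have P1: "projective R P1" "P1 \<in> right_modules R" and c: "c \<in> epis R P1 W'"
    and super: "superfluous R P1 (a_kernel P1 W' c)"
    by (auto simp: projective_cover_def projective_def)
  have clin: "linear_map R P1 W' c" and csurj: "c ` carrier P1 = carrier W'"
    using c P1(2) W'(1) by (auto simp: epis_def right_modules_def intro: linear_map_of_rhom)
  interpret c: linear_map R P1 W' c by fact
  have "linear_map R ?W P0 (\<lambda>x. x)"
    by (rule linear_map_restrict[OF linear_map_id[OF \<pi>.M.right_module_axioms] \<pi>.submodule_kernel])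
  then have s: "linear_map R P1 P0 (\<lambda>x. b' (c x))"
    by (rule linear_map_compose[OF linear_map_compose[OF clin W'(3)]])
  have img: "(\<lambda>x. b' (c x)) ` carrier P1 = ?K"
  proof (intro equalityI subsetI)
    fix w assume "w \<in> ?K"
    then have w: "w \<in> carrier ?W" by simp
    have "b w \<in> c ` carrier P1" unfolding csurj by (rule b.map_closed[OF w])
    then obtain x where "x \<in> carrier P1" "b w = c x" by blast
    then show "w \<in> (\<lambda>x. b' (c x)) ` carrier P1" using W'(4)[OF w] by force
  qed (use b'.map_closed[OF c.map_closed] in auto)
  have "b' y = \<zero>\<^bsub>P0\<^esub> \<longleftrightarrow> y = \<zero>\<^bsub>W'\<^esub>" if y: "y \<in> carrier W'" for y
    using W'(5)[OF y] b.map_zero b'.map_zero by force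
  then have "a_kernel P1 P0 (\<lambda>x. b' (c x)) = a_kernel P1 W' c" by auto
  then show thesis using that[OF P1(1) s img] super by simp
qed

lemma factors_direct_sum2:
  assumes s: "linear_map R P Q s" and s': "linear_map R P' Q' s'"
  shows "factors R (direct_sum2 P P') (direct_sum2 Q Q') (\<lambda>z. (s (fst z), s' (snd z))) X \<longleftrightarrow>
    factors R P Q s X \<and> factors R P' Q' s' X"
proof (intro iffI conjI)
  interpret s: linear_map R P Q s by fact
  interpret s': linear_map R P' Q' s' by fact
  note mods = s.M.right_module_axioms s'.M.right_module_axioms
    s.N.right_module_axioms s'.N.right_module_axioms
  {
    assume fac: "factors R (direct_sum2 P P') (direct_sum2 Q Q') (\<lambda>z. (s (fst z), s' (snd z))) X"
    show "factors R P Q s X"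
    proof (rule factorsI)
      fix f assume f: "linear_map R P X f"
      obtain g where g: "linear_map R (direct_sum2 Q Q') X g"
        "\<And>z. z \<in> carrier (direct_sum2 P P') \<Longrightarrow> g (s (fst z), s' (snd z)) = f (fst z)"
        using factorsE[OF fac linear_map_compose[OF linear_map_fst[OF mods(1,2)] f]] by blast
      have "g (s x, \<zero>\<^bsub>Q'\<^esub>) = f x" if "x \<in> carrier P" for x
        using g(2)[of "(x, \<zero>\<^bsub>P'\<^esub>)"] that by simp
      then show "\<exists>g. linear_map R Q X g \<and> (\<forall>x\<in>carrier P. g (s x) = f x)"
        by (intro exI[of _ "\<lambda>x. g (x, \<zero>\<^bsub>Q'\<^esub>)"] conjI ballI
            linear_map_compose[OF linear_map_inl[OF mods(3,4)] g(1)])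
    qed
    show "factors R P' Q' s' X"
    proof (rule factorsI)
      fix f assume f: "linear_map R P' X f"
      obtain g where g: "linear_map R (direct_sum2 Q Q') X g"
        "\<And>z. z \<in> carrier (direct_sum2 P P') \<Longrightarrow> g (s (fst z), s' (snd z)) = f (snd z)"
        using factorsE[OF fac linear_map_compose[OF linear_map_snd[OF mods(1,2)] f]] by blast
      have "g (\<zero>\<^bsub>Q\<^esub>, s' x) = f x" if "x \<in> carrier P'" for x
        using g(2)[of "(\<zero>\<^bsub>P\<^esub>, x)"] that by simp
      then show "\<exists>g. linear_map R Q' X g \<and> (\<forall>x\<in>carrier P'. g (s' x) = f x)"
        by (intro exI[of _ "\<lambda>x. g (\<zero>\<^bsub>Q\<^esub>, x)"] conjI ballI
            linear_map_compose[OF linear_map_inr[OF mods(3,4)] g(1)])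
    qed
  }
  assume fac: "factors R P Q s X \<and> factors R P' Q' s' X"
  show "factors R (direct_sum2 P P') (direct_sum2 Q Q') (\<lambda>z. (s (fst z), s' (snd z))) X"
  proof (rule factorsI)
    fix f assume f: "linear_map R (direct_sum2 P P') X f"
    obtain g where g: "linear_map R Q X g" "\<And>x. x \<in> carrier P \<Longrightarrow> g (s x) = f (x, \<zero>\<^bsub>P'\<^esub>)"
      using factorsE[OF conjunct1[OF fac] linear_map_compose[OF linear_map_inl[OF mods(1,2)] f]] by blast
    obtain g' where g': "linear_map R Q' X g'" "\<And>x. x \<in> carrier P' \<Longrightarrow> g' (s' x) = f (\<zero>\<^bsub>P\<^esub>, x)"
      using factorsE[OF conjunct2[OF fac] linear_map_compose[OF linear_map_inr[OF mods(1,2)] f]] by blast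
    have "g (s (fst z)) \<oplus>\<^bsub>X\<^esub> g' (s' (snd z)) = f z" if zc: "z \<in> carrier (direct_sum2 P P')" for z
    proof -
      obtain x y where z: "z = (x, y)" "x \<in> carrier P" "y \<in> carrier P'" using zc by (cases z) auto
      show ?thesis using linear_map_split[OF f mods(1,2) z(2,3)] g(2) g'(2) z by simp
    qed
    then show "\<exists>g. linear_map R (direct_sum2 Q Q') X g \<and>
        (\<forall>x\<in>carrier (direct_sum2 P P'). g (s (fst x), s' (snd x)) = f x)"
      by (intro exI[of _ "\<lambda>z. g (fst z) \<oplus>\<^bsub>X\<^esub> g' (snd z)"] conjI ballI
          linear_map_copair[OF g(1) g'(1)]) simp
  qed
qed

text \<open>The presentations below live on types of pairs and of functions. Copying them to the type of the
  universe changes neither exactness nor projectivity nor the class of the modules \<open>X\<close> for which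
  all maps from \<open>P\<close> to \<open>X\<close> factor through \<open>s\<close>.\<close>

lemma siltingI:
  fixes N :: "('a, 'u) module" and P :: "('a, 'b) module" and Q :: "('a, 'c) module"
  assumes N: "N \<in> right_modules R"
    and s: "linear_map R P Q s" and \<pi>: "linear_map R Q N \<pi>" "\<pi> ` carrier Q = carrier N"
    and exact: "s ` carrier P = a_kernel Q N \<pi>"
    and small: "small TYPE('u) (carrier P)" "small TYPE('u) (carrier Q)"
    and liftsP: "\<And>(A :: ('a, 'u) module) (B :: ('a, 'u) module).
      A \<in> right_modules R \<Longrightarrow> B \<in> right_modules R \<Longrightarrow> lifts R P A B"
    and liftsQ: "\<And>(A :: ('a, 'u) module) (B :: ('a, 'u) module).
      A \<in> right_modules R \<Longrightarrow> B \<in> right_modules R \<Longrightarrow> lifts R Q A B"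
    and D: "\<And>X. X \<in> right_modules R \<Longrightarrow> factors R P Q s X \<longleftrightarrow> X \<in> Gen R N"
    and torsion: "torsion_class R (Gen R N)" and NN: "N \<in> Gen R N"
  shows "silting R N"
proof -
  interpret s: linear_map R P Q s by fact
  interpret \<pi>: linear_map R Q N \<pi> by fact
  obtain P' :: "('a, 'u) module" and a a' where P': "P' \<in> right_modules R" "linear_map R P P' a"
    "linear_map R P' P a'" "\<And>x. x \<in> carrier P \<Longrightarrow> a' (a x) = x" "\<And>y. y \<in> carrier P' \<Longrightarrow> a (a' y) = y"
    using ex_copy_inverse[OF s.M.right_module_axioms small(1)] by blast
  obtain Q' :: "('a, 'u) module" and b b' where Q': "Q' \<in> right_modules R" "linear_map R Q Q' b"
    "linear_map R Q' Q b'" "\<And>x. x \<in> carrier Q \<Longrightarrow> b' (b x) = x" "\<And>y. y \<in> carrier Q' \<Longrightarrow> b (b' y) = y"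
    using ex_copy_inverse[OF s.N.right_module_axioms small(2)] by blast
  interpret a: linear_map R P P' a by fact
  interpret a': linear_map R P' P a' by fact
  interpret b: linear_map R Q Q' b by fact
  interpret b': linear_map R Q' Q b' by fact
  have P'm: "right_module R P'" and Q'm: "right_module R Q'"
    by (rule a.N.right_module_axioms b.N.right_module_axioms)+
  let ?s = "restrict (\<lambda>x. b (s (a' x))) (carrier P')" and ?\<pi> = "restrict (\<lambda>y. \<pi> (b' y)) (carrier Q')"
  have s': "linear_map R P' Q' (\<lambda>x. b (s (a' x)))"
    by (rule linear_map_compose[OF linear_map_compose[OF P'(3) s] Q'(2)])
  have \<pi>': "linear_map R Q' N (\<lambda>y. \<pi> (b' y))" by (rule linear_map_compose[OF Q'(3) \<pi>(1)])
  have s'': "linear_map R P' Q' ?s" by (rule linear_map_cong[OF s']) simp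
  have proj: "projective R P'" "projective R Q'"
    using lifts_retract[OF liftsP P'(2,3,5)] lifts_retract[OF liftsQ Q'(2,3,5)] P'(1) Q'(1)
    by (auto intro!: projectiveI)
  have surj: "?\<pi> ` carrier Q' = carrier N"
  proof (intro equalityI subsetI)
    fix n assume "n \<in> carrier N"
    then obtain y where "y \<in> carrier Q" "n = \<pi> y" using \<pi>(2) by blast
    then have "n = ?\<pi> (b y)" "b y \<in> carrier Q'" using Q'(4) by auto
    then show "n \<in> ?\<pi> ` carrier Q'" by blast
  qed auto
  have ker: "?s ` carrier P' = a_kernel Q' N ?\<pi>"
  proof (intro equalityI subsetI)
    fix y assume "y \<in> ?s ` carrier P'"
    then obtain x where x: "x \<in> carrier P'" "y = b (s (a' x))" by auto
    have "s (a' x) \<in> a_kernel Q N \<pi>" using exact x(1) by auto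
    then show "y \<in> a_kernel Q' N ?\<pi>" using x Q'(4) by simp
  next
    fix y assume y: "y \<in> a_kernel Q' N ?\<pi>"
    then have "b' y \<in> s ` carrier P" unfolding exact by auto
    then obtain x where x: "x \<in> carrier P" "b' y = s x" by blast
    then have "?s (a x) = y" using y P'(4) Q'(5)[of y] by simp
    then show "y \<in> ?s ` carrier P'" using x(1) a.map_closed by (metis image_eqI)
  qed
  have fac: "factors R P' Q' ?s X \<longleftrightarrow> factors R P Q s X" if X: "X \<in> right_modules R" for X :: "('a, 'u) module"
  proof
    assume fac: "factors R P' Q' ?s X"
    show "factors R P Q s X"
    proof (rule factorsI)
      fix f assume f: "linear_map R P X f"
      obtain g where g: "linear_map R Q' X g" "\<And>x. x \<in> carrier P' \<Longrightarrow> g (?s x) = f (a' x)"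
        using factorsE[OF fac linear_map_compose[OF P'(3) f]] by blast
      have "g (b (s x)) = f x" if "x \<in> carrier P" for x using g(2)[of "a x"] that P'(4) by simp
      then show "\<exists>g. linear_map R Q X g \<and> (\<forall>x\<in>carrier P. g (s x) = f x)"
        by (intro exI[of _ "\<lambda>x. g (b x)"] conjI ballI linear_map_compose[OF Q'(2) g(1)])
    qed
  next
    assume fac: "factors R P Q s X"
    show "factors R P' Q' ?s X"
    proof (rule factorsI)
      fix f assume f: "linear_map R P' X f"
      obtain g where g: "linear_map R Q X g" "\<And>x. x \<in> carrier P \<Longrightarrow> g (s x) = f (a x)"
        using factorsE[OF fac linear_map_compose[OF P'(2) f]] by blast
      have "g (b' (?s x)) = f x" if "x \<in> carrier P'" for x
        using g(2)[of "a' x"] that P'(5) Q'(4) by simp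
      then show "\<exists>g. linear_map R Q' X g \<and> (\<forall>x\<in>carrier P'. g (?s x) = f x)"
        by (intro exI[of _ "\<lambda>x. g (b' x)"] conjI ballI linear_map_compose[OF Q'(3) g(1)])
    qed
  qed
  have "D_class R P' Q' ?s = Gen R N"
    using D fac by (auto simp: D_class_iff[OF s''] Gen_def)
  moreover have "projective_presentation R P' ?s Q' ?\<pi> N"
    using proj restrict_rhom[OF s'] restrict_rhom[OF \<pi>'] surj ker
    by (simp add: projective_presentation_def epis_def)
  ultimately show ?thesis unfolding silting_def using N torsion NN by metis
qed


section \<open>From a preenvelope to a silting module\<close>

text \<open>The module is an extension of a quotient of \<open>M\<close> by \<open>M\<close> itself.\<close>

lemma torsion_class_sum_quotient:
  fixes \<T> :: "('a, 'u) module set" and K :: "('a, 'b) module"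
  assumes \<T>: "torsion_class R \<T>" and MT: "M \<in> \<T>"
    and \<kappa>: "linear_map R M K \<kappa>" "\<kappa> ` carrier M = carrier K" and N: "N \<in> right_modules R"
    and \<theta>: "linear_map R (direct_sum2 M K) N \<theta>"
    and \<eta>: "linear_map R N (direct_sum2 M K) \<eta>"
      "\<And>z. z \<in> carrier (direct_sum2 M K) \<Longrightarrow> \<eta> (\<theta> z) = z" "\<And>n. n \<in> carrier N \<Longrightarrow> \<theta> (\<eta> n) = n"
  shows "N \<in> \<T>"
proof -
  have Mm: "right_module R M" and Msmall: "small TYPE('u) (carrier M)"
    using torsion_class_right_modules[OF \<T> MT] by (simp_all add: right_modules_def)
  interpret \<kappa>: linear_map R M K \<kappa> by fact
  interpret \<theta>: linear_map R "direct_sum2 M K" N \<theta> by fact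
  interpret \<eta>: linear_map R N "direct_sum2 M K" \<eta> by fact
  have Km: "right_module R K" by (rule \<kappa>.N.right_module_axioms)
  obtain K' :: "('a, 'u) module" and b b' where K': "K' \<in> right_modules R" "linear_map R K K' b"
    "linear_map R K' K b'" "\<And>x. x \<in> carrier K \<Longrightarrow> b' (b x) = x" "\<And>y. y \<in> carrier K' \<Longrightarrow> b (b' y) = y"
    using ex_copy_inverse[OF Km] small_image[OF Msmall, of \<kappa>] unfolding \<kappa>(2) by blast
  interpret b: linear_map R K K' b by fact
  interpret b': linear_map R K' K b' by fact
  have bzero: "b z = \<zero>\<^bsub>K'\<^esub> \<longleftrightarrow> z = \<zero>\<^bsub>K\<^esub>" if "z \<in> carrier K" for z
    using K'(4)[OF that] b.map_zero b'.map_zero by metis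
  have K'T: "K' \<in> \<T>"
  proof (rule torsion_class_epi[OF \<T> MT K'(1) linear_map_compose[OF \<kappa>(1) K'(2)]])
    have "b ` carrier K = carrier K'"
      by (rule bij_betw_imp_surj_on[OF bij_betw_byWitness[where f' = b']]) (use K'(4,5) in auto)
    then show "(\<lambda>x. b (\<kappa> x)) ` carrier M = carrier K'"
      unfolding \<kappa>(2)[symmetric] image_image .
  qed
  let ?i = "restrict (\<lambda>x. \<theta> (x, \<zero>\<^bsub>K\<^esub>)) (carrier M)" and ?p = "restrict (\<lambda>n. b (snd (\<eta> n))) (carrier N)"
  have p: "linear_map R N K' (\<lambda>n. b (snd (\<eta> n)))"
    by (rule linear_map_compose[OF linear_map_compose[OF \<eta>(1) linear_map_snd[OF Mm Km]] K'(2)])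
  have inj: "inj_on ?i (carrier M)"
  proof (rule inj_onI)
    fix x y assume xy: "x \<in> carrier M" "y \<in> carrier M" "?i x = ?i y"
    then have "\<eta> (\<theta> (x, \<zero>\<^bsub>K\<^esub>)) = \<eta> (\<theta> (y, \<zero>\<^bsub>K\<^esub>))" by simp
    then show "x = y" using xy \<eta>(2) by simp
  qed
  have surj: "(\<lambda>n. b (snd (\<eta> n))) ` carrier N = carrier K'"
  proof (intro equalityI subsetI)
    fix y assume y: "y \<in> carrier K'"
    have z: "(\<zero>\<^bsub>M\<^esub>, b' y) \<in> carrier (direct_sum2 M K)" using y by simp
    have "y = b (snd (\<eta> (\<theta> (\<zero>\<^bsub>M\<^esub>, b' y))))" using \<eta>(2)[OF z] K'(5)[OF y] by simp
    then show "y \<in> (\<lambda>n. b (snd (\<eta> n))) ` carrier N" using \<theta>.map_closed[OF z] by blast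
  qed (use linear_mapD(3)[OF p] in auto)
  have ker: "?i ` carrier M = a_kernel N K' ?p"
  proof (intro equalityI subsetI)
    fix n assume "n \<in> ?i ` carrier M"
    then obtain x where x: "x \<in> carrier M" "n = \<theta> (x, \<zero>\<^bsub>K\<^esub>)" by auto
    then show "n \<in> a_kernel N K' ?p" using \<eta>(2) \<theta>.map_closed by simp
  next
    fix n assume "n \<in> a_kernel N K' ?p"
    then have n: "n \<in> carrier N" "b (snd (\<eta> n)) = \<zero>\<^bsub>K'\<^esub>" by auto
    obtain x y where xy: "\<eta> n = (x, y)" by (cases "\<eta> n")
    then have c: "x \<in> carrier M" "y \<in> carrier K" using \<eta>.map_closed[OF n(1)] by auto
    then have "y = \<zero>\<^bsub>K\<^esub>" using n(2) bzero xy by simp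
    then have "n = ?i x" using \<eta>(3)[OF n(1)] xy c by simp
    then show "n \<in> ?i ` carrier M" using c by blast
  qed
  have "short_exact R M ?i N ?p K'"
    unfolding short_exact_def
  proof (intro conjI inj ker)
    show "?i \<in> rhom R M N"
      by (rule restrict_rhom[OF linear_map_compose[OF linear_map_inl[OF Mm Km] \<theta>(1)]])
    show "?p \<in> epis R N K'" by (rule epis_of_linear_map[OF p surj])
  qed
  then show ?thesis using torsion_classD(4)[OF \<T>] MT K'T N by blast
qed

text \<open>The cokernel of the mapping cone of \<open>e\<close> over a presentation of \<open>M\<close> is the cokernel of the induced map
  from \<open>L\<close> to \<open>M\<close>.\<close>

lemma cone_image:
  assumes s: "linear_map R P1 P0 s" and \<pi>: "linear_map R P0 M \<pi>" and e: "linear_map R L P0 e"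
    and exact: "s ` carrier P1 = a_kernel P0 M \<pi>"
  shows "(\<lambda>z. s (fst z) \<oplus>\<^bsub>P0\<^esub> e (snd z)) ` carrier (direct_sum2 P1 L) =
    {v \<in> carrier P0. \<pi> v \<in> (\<lambda>r. \<pi> (e r)) ` carrier L}"
    (is "?t ` _ = ?V")
proof (intro equalityI subsetI)
  interpret s: linear_map R P1 P0 s by fact
  interpret \<pi>: linear_map R P0 M \<pi> by fact
  interpret e: linear_map R L P0 e by fact
  have \<pi>s: "\<pi> (s x) = \<zero>\<^bsub>M\<^esub>" if "x \<in> carrier P1" for x using exact that by auto
  {
    fix v assume "v \<in> ?t ` carrier (direct_sum2 P1 L)"
    then obtain x r where xr: "x \<in> carrier P1" "r \<in> carrier L" "v = s x \<oplus>\<^bsub>P0\<^esub> e r" by auto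
    then have "\<pi> v = \<pi> (e r)" using \<pi>s by (simp add: \<pi>.map_add)
    then show "v \<in> ?V" using xr by auto
  }
  fix v assume "v \<in> ?V"
  then obtain r where v: "v \<in> carrier P0" and r: "r \<in> carrier L" "\<pi> v = \<pi> (e r)" by auto
  have "v \<ominus>\<^bsub>P0\<^esub> e r \<in> a_kernel P0 M \<pi>"
    using v r by (simp add: \<pi>.map_minus \<pi>.N.minus_eq_zero_iff)
  then obtain x where x: "x \<in> carrier P1" "s x = v \<ominus>\<^bsub>P0\<^esub> e r" unfolding exact[symmetric] by force
  have "?t (x, r) = v" using v r x by (simp add: s.N.minus_add_cancel)
  then show "v \<in> ?t ` carrier (direct_sum2 P1 L)" using x r by force
qed

text \<open>A map on \<open>P1 \<oplus> R\<close> that is zero on \<open>P1\<close> and sends \<open>1\<close> to \<open>x\<close> factors only if some map \<open>M \<rightarrow> X\<close> reaches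
  \<open>x\<close>; so every module in the class of the cone is generated by \<open>M\<close>. Conversely, a map on
  \<open>P1 \<oplus> R\<close> is factored first on \<open>P1\<close>, and the error on \<open>R\<close> is then removed by a map that factors through \<open>M\<close> and
  therefore does not disturb the values on \<open>P1\<close>.\<close>

lemma factors_cone_iff:
  fixes \<T> :: "('a, 'u) module set"
  assumes U: "module_universe TYPE('u)" and \<T>: "torsion_class R \<T>" and MT: "M \<in> \<T>"
    and s: "linear_map R P1 P0 s" and \<pi>: "linear_map R P0 M \<pi>" "\<pi> ` carrier P0 = carrier M"
    and exact: "s ` carrier P1 = a_kernel P0 M \<pi>"
    and e: "linear_map R (regular_module R) P0 e"
    and fac: "\<And>X. X \<in> \<T> \<Longrightarrow> factors R P1 P0 s X"
    and env: "\<And>X. X \<in> \<T> \<Longrightarrow> factors R (regular_module R) M (\<lambda>r. \<pi> (e r)) X"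
    and X: "X \<in> right_modules R"
  shows "factors R (direct_sum2 P1 (regular_module R)) P0 (\<lambda>z. s (fst z) \<oplus>\<^bsub>P0\<^esub> e (snd z)) X \<longleftrightarrow> X \<in> \<T>"
proof
  let ?P = "direct_sum2 P1 (regular_module R)"
  define t where "t = (\<lambda>z. s (fst z) \<oplus>\<^bsub>P0\<^esub> e (snd z))"
  interpret s: linear_map R P1 P0 s by fact
  interpret \<pi>: linear_map R P0 M \<pi> by fact
  interpret e: linear_map R "regular_module R" P0 e by fact
  have Rm: "right_module R (regular_module R)" and P1m: "right_module R P1" and Mm: "right_module R M"
    by (rule e.M.right_module_axioms s.M.right_module_axioms \<pi>.N.right_module_axioms)+
  have \<pi>s: "\<pi> (s x) = \<zero>\<^bsub>M\<^esub>" if "x \<in> carrier P1" for x using exact that by auto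
  have Xm: "right_module R X" using X by (simp add: right_modules_def)
  interpret X: right_module R X by fact
  {
    assume "factors R ?P P0 (\<lambda>z. s (fst z) \<oplus>\<^bsub>P0\<^esub> e (snd z)) X"
    then have fac: "factors R ?P P0 t X" unfolding t_def .
    have "X \<in> Gen R M"
    proof (rule GenI[OF X Mm])
      fix x assume x: "x \<in> carrier X"
      obtain g where g: "linear_map R P0 X g" "\<And>z. z \<in> carrier ?P \<Longrightarrow> g (t z) = snd z \<odot>\<^bsub>X\<^esub> x"
        using factorsE[OF fac linear_map_compose[OF linear_map_snd[OF P1m Rm] linear_map_orbit[OF Xm x]]]
        by blast
      have gs: "g (s y) = \<zero>\<^bsub>X\<^esub>" if "y \<in> carrier P1" for y
        using g(2)[of "(y, \<zero>\<^bsub>R\<^esub>)"] that x e.map_zero by (simp add: t_def X.zero_smult)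
      have "a_kernel P0 M \<pi> \<subseteq> a_kernel P0 X g"
        using gs s.map_closed unfolding exact[symmetric] by auto
      then obtain h where h: "linear_map R M X h" "\<And>v. v \<in> carrier P0 \<Longrightarrow> h (\<pi> v) = g v"
        using linear_map_factor[OF \<pi> g(1)] by blast
      have "h (\<pi> (e \<one>\<^bsub>R\<^esub>)) = x"
        using h(2)[of "e \<one>\<^bsub>R\<^esub>"] g(2)[of "(\<zero>\<^bsub>P1\<^esub>, \<one>\<^bsub>R\<^esub>)"] x by (simp add: t_def)
      moreover have "\<pi> (e \<one>\<^bsub>R\<^esub>) \<in> carrier M" by simp
      ultimately show "\<exists>g. linear_map R M X g \<and> x \<in> g ` carrier M" using h(1) by blast
    qed
    then show "X \<in> \<T>" using Gen_subset_torsion_class[OF U \<T> MT] by blast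
  }
  assume XT: "X \<in> \<T>"
  have "factors R ?P P0 t X"
  proof (rule factorsI)
    fix f assume f: "linear_map R ?P X f"
    interpret f: linear_map R ?P X f by fact
    obtain g where g: "linear_map R P0 X g" "\<And>x. x \<in> carrier P1 \<Longrightarrow> g (s x) = f (x, \<zero>\<^bsub>R\<^esub>)"
      using factorsE[OF fac[OF XT] linear_map_compose[OF linear_map_inl[OF P1m Rm] f]] by auto
    interpret g: linear_map R P0 X g by fact
    have fr: "linear_map R (regular_module R) X (\<lambda>r. f (\<zero>\<^bsub>P1\<^esub>, r) \<ominus>\<^bsub>X\<^esub> g (e r))"
      by (rule linear_map_minus[OF linear_map_compose[OF linear_map_inr[OF P1m Rm] f]
            linear_map_compose[OF e g(1)]])
    obtain h where h: "linear_map R M X h"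
      "\<And>r. r \<in> carrier R \<Longrightarrow> h (\<pi> (e r)) = f (\<zero>\<^bsub>P1\<^esub>, r) \<ominus>\<^bsub>X\<^esub> g (e r)"
      using factorsE[OF env[OF XT] fr] by auto
    interpret h: linear_map R M X h by fact
    have "g (t z) \<oplus>\<^bsub>X\<^esub> h (\<pi> (t z)) = f z" if zc: "z \<in> carrier ?P" for z
    proof -
      obtain x r where z: "z = (x, r)" "x \<in> carrier P1" "r \<in> carrier R" using zc by (cases z) auto
      have c: "f (x, \<zero>\<^bsub>R\<^esub>) \<in> carrier X" "f (\<zero>\<^bsub>P1\<^esub>, r) \<in> carrier X" "g (e r) \<in> carrier X"
        using z by auto
      have "g (t z) = f (x, \<zero>\<^bsub>R\<^esub>) \<oplus>\<^bsub>X\<^esub> g (e r)" using z g(2) by (simp add: t_def g.map_add)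
      moreover have "h (\<pi> (t z)) = f (\<zero>\<^bsub>P1\<^esub>, r) \<ominus>\<^bsub>X\<^esub> g (e r)"
        using z h(2) \<pi>s by (simp add: t_def \<pi>.map_add)
      ultimately have "g (t z) \<oplus>\<^bsub>X\<^esub> h (\<pi> (t z))
          = f (x, \<zero>\<^bsub>R\<^esub>) \<oplus>\<^bsub>X\<^esub> (g (e r) \<oplus>\<^bsub>X\<^esub> (f (\<zero>\<^bsub>P1\<^esub>, r) \<ominus>\<^bsub>X\<^esub> g (e r)))"
        using c by (simp add: X.M.a_assoc)
      also have "\<dots> = f (x, \<zero>\<^bsub>R\<^esub>) \<oplus>\<^bsub>X\<^esub> f (\<zero>\<^bsub>P1\<^esub>, r)" using c by (simp add: X.add_minus_cancel)
      also have "\<dots> = f z" using linear_map_split[OF f P1m Rm, of x r] z by simp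
      finally show ?thesis .
    qed
    then show "\<exists>g. linear_map R P0 X g \<and> (\<forall>x\<in>carrier ?P. g (t x) = f x)"
      by (intro exI[of _ "\<lambda>v. g v \<oplus>\<^bsub>X\<^esub> h (\<pi> v)"] conjI ballI
          linear_map_add[OF g(1) linear_map_compose[OF \<pi>(1) h(1)]])
  qed
  then show "factors R ?P P0 (\<lambda>z. s (fst z) \<oplus>\<^bsub>P0\<^esub> e (snd z)) X" unfolding t_def .
qed

lemma preenvelope_silting:
  fixes \<T> :: "('a, 'u) module set" and N :: "('a, 'u) module"
  assumes U: "module_universe TYPE('u)" and small: "small TYPE('u) (carrier R)"
    and perfect: "right_perfect TYPE('u) R" and \<T>: "torsion_class R \<T>"
    and pre: "preenvelope R \<T> (regular_module R) M \<epsilon>" and orth: "M \<in> left_Ext_orth R \<T>"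
    and N: "N \<in> right_modules R"
    and iso: "isomorphic R (direct_sum2 M (cokernel (regular_module R) M \<epsilon>)) N"
  shows "silting R N" "\<T> = Gen R N"
proof -
  have R: "ring R" using perfect by (simp add: right_perfect_def)
  have Rm: "right_module R (regular_module R)" by (rule regular_right_module[OF R])
  have MT: "M \<in> \<T>" and \<epsilon>: "\<epsilon> \<in> rhom R (regular_module R) M"
    and env: "\<And>X. X \<in> \<T> \<Longrightarrow> factors R (regular_module R) M \<epsilon> X"
    using pre unfolding preenvelope_iff[OF \<T> R] by auto
  have M: "M \<in> right_modules R" by (rule torsion_class_right_modules[OF \<T> MT])
  have Mm: "right_module R M" and Msmall: "small TYPE('u) (carrier M)"
    using M by (simp_all add: right_modules_def)
  have \<epsilon>lin: "linear_map R (regular_module R) M \<epsilon>" by (rule linear_map_of_rhom[OF \<epsilon> Rm Mm])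
  interpret \<epsilon>: linear_map R "regular_module R" M \<epsilon> by fact
  let ?H = "\<epsilon> ` carrier (regular_module R)" and ?K = "cokernel (regular_module R) M \<epsilon>"
  let ?\<kappa> = "\<lambda>x. ?H +>\<^bsub>M\<^esub> x"
  have H: "submodule ?H R M" by (rule \<epsilon>.submodule_image[OF \<epsilon>.M.submodule_carrier])
  have \<kappa>: "linear_map R M ?K ?\<kappa>" "?\<kappa> ` carrier M = carrier ?K" "a_kernel M ?K ?\<kappa> = ?H"
    unfolding cokernel_def using quotient_module_map[OF Mm H] by auto
  interpret \<kappa>: linear_map R M ?K ?\<kappa> by fact
  have Km: "right_module R ?K" by (rule \<kappa>.N.right_module_axioms)
  have MK: "right_module R (direct_sum2 M ?K)" by (rule direct_sum2_right_module[OF Mm Km])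
  have Nm: "right_module R N" using N by (simp add: right_modules_def)
  obtain \<theta> where \<theta>: "linear_map R (direct_sum2 M ?K) N \<theta>"
    "bij_betw \<theta> (carrier (direct_sum2 M ?K)) (carrier N)"
    using iso linear_map_of_rhom[OF _ MK Nm] unfolding isomorphic_def by blast
  interpret \<theta>: linear_map R "direct_sum2 M ?K" N \<theta> by fact
  obtain \<eta> where \<eta>: "linear_map R N (direct_sum2 M ?K) \<eta>"
    "\<And>z. z \<in> carrier (direct_sum2 M ?K) \<Longrightarrow> \<eta> (\<theta> z) = z" "\<And>n. n \<in> carrier N \<Longrightarrow> \<theta> (\<eta> n) = n"
    using linear_map_inverse[OF \<theta>] by blast
  interpret \<eta>: linear_map R N "direct_sum2 M ?K" \<eta> by fact
  have \<theta>zero: "\<theta> z = \<zero>\<^bsub>N\<^esub> \<longleftrightarrow> z = \<zero>\<^bsub>direct_sum2 M ?K\<^esub>" if "z \<in> carrier (direct_sum2 M ?K)" for z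
    using \<eta>(2)[OF that] \<eta>.map_zero \<theta>.map_zero by metis

  have orbit: "\<exists>h. linear_map R M X h \<and> h (\<epsilon> \<one>\<^bsub>R\<^esub>) = x" if X: "X \<in> \<T>" and x: "x \<in> carrier X" for X x
  proof -
    have Xm: "right_module R X"
      using torsion_class_right_modules[OF \<T> X] by (simp add: right_modules_def)
    interpret X: right_module R X by fact
    obtain h where "linear_map R M X h" "\<And>r. r \<in> carrier R \<Longrightarrow> h (\<epsilon> r) = r \<odot>\<^bsub>X\<^esub> x"
      using factorsE[OF env[OF X] linear_map_orbit[OF Xm x]] by auto
    then show ?thesis using x by auto
  qed

  have NT: "N \<in> \<T>" by (rule torsion_class_sum_quotient[OF \<T> MT \<kappa>(1,2) N \<theta>(1) \<eta>])
  show Gen: "\<T> = Gen R N"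
  proof (intro equalityI subsetI)
    fix X assume X: "X \<in> \<T>"
    show "X \<in> Gen R N"
    proof (rule GenI[OF torsion_class_right_modules[OF \<T> X] Nm])
      fix x assume "x \<in> carrier X"
      then obtain h where h: "linear_map R M X h" "h (\<epsilon> \<one>\<^bsub>R\<^esub>) = x" using orbit[OF X] by blast
      have z: "(\<epsilon> \<one>\<^bsub>R\<^esub>, \<zero>\<^bsub>?K\<^esub>) \<in> carrier (direct_sum2 M ?K)" by simp
      have "x = h (fst (\<eta> (\<theta> (\<epsilon> \<one>\<^bsub>R\<^esub>, \<zero>\<^bsub>?K\<^esub>))))" using \<eta>(2)[OF z] h(2) by simp
      then have "x \<in> (\<lambda>n. h (fst (\<eta> n))) ` carrier N" using \<theta>.map_closed[OF z] by blast
      then show "\<exists>g. linear_map R N X g \<and> x \<in> g ` carrier N"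
        using linear_map_compose[OF linear_map_compose[OF \<eta>(1) linear_map_fst[OF Mm Km]] h(1)]
        by (intro exI[of _ "\<lambda>n. h (fst (\<eta> n))"] conjI)
    qed
  qed (use Gen_subset_torsion_class[OF U \<T> NT] in blast)

  define P0 where "P0 = free_module R (carrier M)"
  define \<pi> where "\<pi> = lincomb R M (carrier M)"
  have \<pi>: "linear_map R P0 M \<pi>" "\<pi> ` carrier P0 = carrier M"
    unfolding P0_def \<pi>_def by (rule linear_map_lincomb[OF Mm order_refl] lincomb_surj[OF Mm])+
  interpret \<pi>: linear_map R P0 M \<pi> by fact
  have P0m: "right_module R P0" by (rule \<pi>.M.right_module_axioms)
  have P0small: "small TYPE('u) (carrier P0)"
    unfolding P0_def free_module_def by (rule small_direct_sum[OF U Msmall]) (simp add: small)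
  obtain P1 :: "('a, 'u) module" and s where P1: "projective R P1" and s: "linear_map R P1 P0 s"
    "s ` carrier P1 = a_kernel P0 M \<pi>" "superfluous R P1 (a_kernel P1 P0 s)"
    using ex_minimal_presentation[OF U perfect small M] unfolding P0_def \<pi>_def by blast
  interpret s: linear_map R P1 P0 s by fact
  have P1m: "right_module R P1" by (rule s.M.right_module_axioms)
  have liftP0: "lifts R P0 A B" for A :: "('a, 'x) module" and B :: "('a, 'y) module"
    unfolding P0_def by (rule lifts_free[OF R])
  have liftP1: "lifts R P1 A B" if "A \<in> right_modules R" "B \<in> right_modules R" for A B :: "('a, 'u) module"
    using that by (intro projective_lifts[OF P1]) (simp_all add: right_modules_def)
  have fac1: "factors R P1 P0 s X" if X: "X \<in> \<T>" for X
  proof (rule factors_minimal_presentation[OF \<T> X s(1) \<pi>(1) s(2,3) liftP0])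
    fix Y assume Y: "Y \<in> \<T>"
    have Ym: "right_module R Y"
      using torsion_class_right_modules[OF \<T> Y] by (simp add: right_modules_def)
    have "trivial_group (Ext1 R M Y)" using orth Y by (auto simp: left_Ext_orth_def)
    then show "factors R (P0\<lparr>carrier := a_kernel P0 M \<pi>\<rparr>) P0 (\<lambda>x. x) Y"
      using Ext1_trivial_iff[OF Mm Ym \<pi> liftP0] by simp
  qed
  obtain e where e: "linear_map R (regular_module R) P0 e" "\<And>r. r \<in> carrier R \<Longrightarrow> \<pi> (e r) = \<epsilon> r"
    using liftsE[OF lifts_regular \<pi> \<epsilon>lin] by auto
  let ?P = "direct_sum2 P1 (regular_module R)"
  define t where "t = (\<lambda>z. s (fst z) \<oplus>\<^bsub>P0\<^esub> e (snd z))"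
  have t: "linear_map R ?P P0 t" unfolding t_def by (rule linear_map_copair[OF s(1) e(1)])
  have Pm: "right_module R ?P" by (rule direct_sum2_right_module[OF P1m Rm])
  have "(\<lambda>r. \<pi> (e r)) ` carrier (regular_module R) = ?H" using e(2) by simp
  then have t_image: "t ` carrier ?P = {v \<in> carrier P0. \<pi> v \<in> ?H}"
    using cone_image[OF s(1) \<pi>(1) e(1) s(2)] unfolding t_def by simp
  have env': "factors R (regular_module R) M (\<lambda>r. \<pi> (e r)) X" if "X \<in> \<T>" for X
    using env[OF that] e(2) unfolding factors_def by simp
  have fac2: "factors R ?P P0 t X \<longleftrightarrow> X \<in> \<T>" if X: "X \<in> right_modules R" for X
    unfolding t_def by (rule factors_cone_iff[where s = s and \<pi> = \<pi> and e = e,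
          OF U \<T> MT s(1) \<pi> s(2) e(1) fac1 env' X])

  let ?P' = "direct_sum2 P1 ?P" and ?Q' = "direct_sum2 P0 P0"
  let ?s = "\<lambda>z. (s (fst z), t (snd z))" and ?p = "\<lambda>z. \<theta> (\<pi> (fst z), ?\<kappa> (\<pi> (snd z)))"
  have p: "linear_map R ?Q' N ?p"
    by (rule linear_map_compose[OF linear_map_direct_sum2[OF \<pi>(1) linear_map_compose[OF \<pi>(1) \<kappa>(1)]] \<theta>(1)])
  have psurj: "?p ` carrier ?Q' = carrier N"
  proof (intro equalityI subsetI)
    fix n assume n: "n \<in> carrier N"
    obtain x y where xy: "\<eta> n = (x, y)" by (cases "\<eta> n")
    then have c: "x \<in> carrier M" "y \<in> carrier ?K" using \<eta>.map_closed[OF n] by auto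
    obtain u where u: "u \<in> carrier P0" "x = \<pi> u" using c(1) \<pi>(2) by blast
    obtain m where m: "m \<in> carrier M" "y = ?\<kappa> m" using c(2) unfolding \<kappa>(2)[symmetric] by blast
    obtain v where v: "v \<in> carrier P0" "m = \<pi> v" using m(1) \<pi>(2) by blast
    have "n = ?p (u, v)" using \<eta>(3)[OF n] xy u m v by simp
    then show "n \<in> ?p ` carrier ?Q'" 
      by (rule image_eqI[where x = "(u, v)"]) (use u v in simp)
  qed (use linear_mapD(3)[OF p] in blast)
  have exact: "?s ` carrier ?P' = a_kernel ?Q' N ?p"
  proof -
    have key: "?p (u, v) = \<zero>\<^bsub>N\<^esub> \<longleftrightarrow> u \<in> s ` carrier P1 \<and> v \<in> t ` carrier ?P"
      if uv: "u \<in> carrier P0" "v \<in> carrier P0" for u v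
    proof -
      have "?p (u, v) = \<zero>\<^bsub>N\<^esub> \<longleftrightarrow> \<pi> u = \<zero>\<^bsub>M\<^esub> \<and> ?\<kappa> (\<pi> v) = \<zero>\<^bsub>?K\<^esub>"
      proof -
        have "(\<pi> u, ?\<kappa> (\<pi> v)) \<in> carrier (direct_sum2 M ?K)"
          using uv by (simp del: carrier_regular)
        from \<theta>zero[OF this] show ?thesis by (simp only: zero_direct_sum2 prod.inject fst_conv snd_conv)
      qed
      also have "?\<kappa> (\<pi> v) = \<zero>\<^bsub>?K\<^esub> \<longleftrightarrow> \<pi> v \<in> ?H"
        using \<pi>.map_closed[OF uv(2)] mem_a_kernel[of "\<pi> v" M ?K ?\<kappa>] unfolding \<kappa>(3) by blast
      finally show ?thesis using uv unfolding s(2) t_image by simp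
    qed
    show ?thesis
    proof (intro equalityI subsetI)
      fix z assume "z \<in> ?s ` carrier ?P'"
      then obtain y where y: "y \<in> carrier P1 \<times> carrier ?P" "z = ?s y"
        unfolding carrier_direct_sum2 by (elim imageE)
      obtain x w where "y = (x, w)" by (cases y)
      then have xw: "x \<in> carrier P1" "w \<in> carrier ?P" and z: "z = (s x, t w)"
        using y by (simp_all only: mem_Times_iff fst_conv snd_conv)
      have c: "s x \<in> carrier P0" "t w \<in> carrier P0" using xw linear_mapD(3)[OF t] by auto
      have "?p z = \<zero>\<^bsub>N\<^esub>" unfolding z using key[OF c] xw by blast
      then show "z \<in> a_kernel ?Q' N ?p" using z c by simp
    next
      fix z assume z: "z \<in> a_kernel ?Q' N ?p"
      obtain u v where uv: "z = (u, v)" by (cases z)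
      then have c: "u \<in> carrier P0" "v \<in> carrier P0" and "?p (u, v) = \<zero>\<^bsub>N\<^esub>"
        using z by simp_all
      then obtain x w where xw: "x \<in> carrier P1" "u = s x" "w \<in> carrier ?P" "v = t w"
        using key[OF c] by blast
      have "z = ?s (x, w)" using uv xw by simp
      moreover have "(x, w) \<in> carrier ?P'"
        using xw(1,3) unfolding carrier_direct_sum2[of P1 ?P] by (rule SigmaI)
      ultimately show "z \<in> ?s ` carrier ?P'" by blast
    qed
  qed
  show "silting R N"
  proof (rule siltingI[OF N linear_map_direct_sum2[OF s(1) t] p psurj exact])
    show "small TYPE('u) (carrier ?P')" "small TYPE('u) (carrier ?Q')"
      using projective_def P1 by (auto intro!: small_Times U small P0small simp: projective_def right_modules_def)
    show "lifts R ?P' A B" if "A \<in> right_modules R" "B \<in> right_modules R" for A B :: "('a, 'u) module"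
      by (intro lifts_direct_sum2 liftP1 that lifts_regular P1m Rm Pm)
    show "lifts R ?Q' A B" for A B :: "('a, 'u) module"
      by (intro lifts_direct_sum2 liftP0 P0m)
    show "factors R ?P' ?Q' ?s X \<longleftrightarrow> X \<in> Gen R N" if "X \<in> right_modules R" for X :: "('a, 'u) module"
      unfolding factors_direct_sum2[OF s(1) t] Gen[symmetric] using fac1 fac2[OF that] by blast
    show "torsion_class R (Gen R N)" "N \<in> Gen R N" using \<T> NT unfolding Gen by auto
  qed
qed


section \<open>From a silting module to a preenvelope\<close>

text \<open>The map is the direct sum of the \<open>\<sigma> i\<close>, and factorizations are chosen summand by summand.\<close>

lemma factors_direct_sum:
  assumes R: "ring R" and \<sigma>: "\<And>i. i \<in> I \<Longrightarrow> linear_map R (P i) (Q i) (\<sigma> i)"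
    and fac: "\<And>i. i \<in> I \<Longrightarrow> factors R (P i) (Q i) (\<sigma> i) X"
  shows "factors R (direct_sum I P) (direct_sum I Q)
    (copair I P (direct_sum I Q) (\<lambda>i x. single I Q i (\<sigma> i x))) X"
proof (rule factorsI)
  fix f assume f: "linear_map R (direct_sum I P) X f"
  let ?S = "copair I P (direct_sum I Q) (\<lambda>i x. single I Q i (\<sigma> i x))"
  have Pm: "right_module R (P i)" and Qm: "right_module R (Q i)" if "i \<in> I" for i
    using linear_mapD(1,2)[OF \<sigma>[OF that]] .
  have Xm: "right_module R X" by (rule linear_mapD(2)[OF f])
  have Bm: "right_module R (direct_sum I Q)" by (rule direct_sum_right_module[OF R Qm])
  have b\<sigma>: "linear_map R (P i) (direct_sum I Q) (\<lambda>x. single I Q i (\<sigma> i x))" if "i \<in> I" for i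
    by (rule linear_map_compose[OF \<sigma>[OF that] linear_map_single[where M = Q and I = I, OF R Qm that]])
  have S: "linear_map R (direct_sum I P) (direct_sum I Q) ?S"
    by (rule linear_map_direct_sum[OF R Pm Bm b\<sigma>])
  have "\<exists>g. linear_map R (Q i) X g \<and> (\<forall>x \<in> carrier (P i). g (\<sigma> i x) = f (single I P i x))"
    if "i \<in> I" for i
    using fac[OF that] linear_map_compose[OF linear_map_single[where M = P and I = I, OF R Pm that] f]
    unfolding factors_def by simp
  then obtain g where g: "\<And>i. i \<in> I \<Longrightarrow> linear_map R (Q i) X (g i)"
    "\<And>i x. i \<in> I \<Longrightarrow> x \<in> carrier (P i) \<Longrightarrow> g i (\<sigma> i x) = f (single I P i x)" by metis
  let ?g = "copair I Q X g"
  have lin: "linear_map R (direct_sum I Q) X ?g" by (rule linear_map_direct_sum[OF R Qm Xm g(1)])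
  have "?g (?S c) = f c" if c: "c \<in> carrier (direct_sum I P)" for c
  proof (rule direct_sum_map_eqI[where M = P and I = I and h = "\<lambda>c. ?g (?S c)" and k = f, OF Pm])
    show "?g (?S (single I P i x)) = f (single I P i x)" if i: "i \<in> I" and x: "x \<in> carrier (P i)" for i x
      using copair_single[where M = Q and g = g, OF Xm g(1) i linear_mapD(3)[OF \<sigma>[OF i] x]]
        copair_single[where M = P and g = "\<lambda>i x. single I Q i (\<sigma> i x)", OF Bm b\<sigma> i x] g(2)[OF i x]
      by simp
  qed (use linear_map_compose[OF S lin] f c in auto)
  then show "\<exists>g. linear_map R (direct_sum I Q) X g \<and> (\<forall>c\<in>carrier (direct_sum I P). g (?S c) = f c)"
    using lin by (intro exI[of _ ?g]) blast
qed

text \<open>The pushout is the cokernel of the map \<open>(s, -S)\<close>; this description of its kernel is kept because it is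
  also the presentation from which \<open>Ext\<close> is computed.\<close>

lemma ex_pushout:
  fixes L :: "('a, 'b) module" and B :: "('a, 'c) module"
  assumes U: "module_universe TYPE('u)"
    and small: "small TYPE('u) (carrier L)" "small TYPE('u) (carrier B)"
    and s: "linear_map R A L s" and S: "linear_map R A B S"
  obtains M :: "('a, 'u) module" and \<epsilon> \<beta> where "M \<in> right_modules R"
    "linear_map R L M \<epsilon>" "linear_map R B M \<beta>" "\<And>u. u \<in> carrier A \<Longrightarrow> \<epsilon> (s u) = \<beta> (S u)"
    "(\<lambda>z. \<epsilon> (fst z) \<oplus>\<^bsub>M\<^esub> \<beta> (snd z)) ` carrier (direct_sum2 L B) = carrier M"
    "a_kernel (direct_sum2 L B) M (\<lambda>z. \<epsilon> (fst z) \<oplus>\<^bsub>M\<^esub> \<beta> (snd z)) = (\<lambda>u. (s u, \<ominus>\<^bsub>B\<^esub> S u)) ` carrier A"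
proof -
  interpret s: linear_map R A L s by fact
  interpret S: linear_map R A B S by fact
  have Lm: "right_module R L" and Bm: "right_module R B"
    by (rule s.N.right_module_axioms S.N.right_module_axioms)+
  let ?E = "direct_sum2 L B" and ?t = "\<lambda>u. (s u, \<ominus>\<^bsub>B\<^esub> S u)"
  have t: "linear_map R A ?E ?t" by (rule linear_map_pair[OF s linear_map_uminus[OF S]])
  interpret t: linear_map R A ?E ?t by fact
  have "small TYPE('u) (carrier ?E)" by (simp add: small_Times[OF U small])
  then obtain M :: "('a, 'u) module" and q where M: "M \<in> right_modules R"
    and q: "linear_map R ?E M q" "q ` carrier ?E = carrier M" "a_kernel ?E M q = ?t ` carrier A"
    using ex_quotient[OF t.N.right_module_axioms _ t.submodule_image[OF s.M.submodule_carrier]] by blast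
  interpret q: linear_map R ?E M q by fact
  define \<epsilon> where "\<epsilon> = (\<lambda>r. q (r, \<zero>\<^bsub>B\<^esub>))"
  define \<beta> where "\<beta> = (\<lambda>y. q (\<zero>\<^bsub>L\<^esub>, y))"
  have \<epsilon>: "linear_map R L M \<epsilon>" and \<beta>: "linear_map R B M \<beta>"
    unfolding \<epsilon>_def \<beta>_def
    by (rule linear_map_compose[OF linear_map_inl[OF Lm Bm] q(1)]
        linear_map_compose[OF linear_map_inr[OF Lm Bm] q(1)])+
  interpret \<epsilon>: linear_map R L M \<epsilon> by fact
  interpret \<beta>: linear_map R B M \<beta> by fact
  have split: "\<epsilon> (fst z) \<oplus>\<^bsub>M\<^esub> \<beta> (snd z) = q z" if "z \<in> carrier ?E" for z
    using linear_map_split[OF q(1) Lm Bm, of "fst z" "snd z"] that by (auto simp: \<epsilon>_def \<beta>_def)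
  have "\<epsilon> (s u) = \<beta> (S u)" if u: "u \<in> carrier A" for u
  proof -
    have c: "s u \<in> carrier L" "S u \<in> carrier B" using u by simp_all
    have "?t u \<in> a_kernel ?E M q" unfolding q(3) using u by (rule imageI)
    then have "\<epsilon> (s u) \<ominus>\<^bsub>M\<^esub> \<beta> (S u) = \<zero>\<^bsub>M\<^esub>"
      using split[of "?t u"] c by (simp add: a_minus_def \<beta>.map_uminus)
    then show ?thesis using c by (simp add: q.N.minus_eq_zero_iff)
  qed
  moreover have "(\<lambda>z. \<epsilon> (fst z) \<oplus>\<^bsub>M\<^esub> \<beta> (snd z)) ` carrier ?E = carrier M"
    unfolding q(2)[symmetric] by (rule image_cong[OF refl split])
  moreover have "a_kernel ?E M (\<lambda>z. \<epsilon> (fst z) \<oplus>\<^bsub>M\<^esub> \<beta> (snd z)) = ?t ` carrier A"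
    unfolding q(3)[symmetric] using split by auto
  ultimately show thesis using that[OF M \<epsilon> \<beta>] by blast
qed

text \<open>A factorization of \<open>A \<rightarrow> X\<close> through \<open>S\<close> gives both halves: combined with a map on \<open>L\<close> it kills the
  relations of the pushout, and up to sign and taken on the summand \<open>B\<close> alone it extends a given map on
  the relations.\<close>

lemma factors_pushout:
  assumes S: "linear_map R A B S" and s: "linear_map R A L s"
    and q: "linear_map R (direct_sum2 L B) M q" "q ` carrier (direct_sum2 L B) = carrier M"
      "a_kernel (direct_sum2 L B) M q = (\<lambda>u. (s u, \<ominus>\<^bsub>B\<^esub> S u)) ` carrier A"
    and fac: "factors R A B S X"
  shows "factors R L M (\<lambda>r. q (r, \<zero>\<^bsub>B\<^esub>)) X"
    and "factors R ((direct_sum2 L B)\<lparr>carrier := a_kernel (direct_sum2 L B) M q\<rparr>) (direct_sum2 L B) (\<lambda>z. z) X"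
proof -
  let ?E = "direct_sum2 L B"
  interpret S: linear_map R A B S by fact
  interpret s: linear_map R A L s by fact
  interpret q: linear_map R ?E M q by fact
  have Lm: "right_module R L" and Bm: "right_module R B"
    by (rule s.N.right_module_axioms S.N.right_module_axioms)+
  show "factors R L M (\<lambda>r. q (r, \<zero>\<^bsub>B\<^esub>)) X"
  proof (rule factorsI)
    fix h assume h: "linear_map R L X h"
    interpret h: linear_map R L X h by fact
    obtain g where g: "linear_map R B X g" "\<And>u. u \<in> carrier A \<Longrightarrow> g (S u) = h (s u)"
      using factorsE[OF fac linear_map_compose[OF s h]] by blast
    interpret g: linear_map R B X g by fact
    let ?f = "\<lambda>z. h (fst z) \<oplus>\<^bsub>X\<^esub> g (snd z)"
    have "?f (s u, \<ominus>\<^bsub>B\<^esub> S u) = \<zero>\<^bsub>X\<^esub>" if "u \<in> carrier A" for u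
      using g(2)[OF that] that by (simp add: g.map_uminus h.N.M.r_neg)
    then have "a_kernel ?E M q \<subseteq> a_kernel ?E X ?f" unfolding q(3) by auto
    then obtain k where k: "linear_map R M X k" "\<And>z. z \<in> carrier ?E \<Longrightarrow> k (q z) = ?f z"
      using linear_map_factor[OF q(1,2) linear_map_copair[OF h g(1)]] by blast
    have "k (q (r, \<zero>\<^bsub>B\<^esub>)) = h r" if "r \<in> carrier L" for r
      using k(2)[of "(r, \<zero>\<^bsub>B\<^esub>)"] that by simp
    then show "\<exists>k. linear_map R M X k \<and> (\<forall>r\<in>carrier L. k (q (r, \<zero>\<^bsub>B\<^esub>)) = h r)"
      using k(1) by (intro exI[of _ k]) simp
  qed
  show "factors R (?E\<lparr>carrier := a_kernel ?E M q\<rparr>) ?E (\<lambda>z. z) X"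
  proof (rule factorsI)
    fix f assume f: "linear_map R (?E\<lparr>carrier := a_kernel ?E M q\<rparr>) X f"
    have "linear_map R A (?E\<lparr>carrier := a_kernel ?E M q\<rparr>) (\<lambda>u. (s u, \<ominus>\<^bsub>B\<^esub> S u))"
      by (rule linear_map_corestrict[OF linear_map_pair[OF s linear_map_uminus[OF S]] q.submodule_kernel])
        (use q(3) in blast)
    then obtain g where g: "linear_map R B X g" "\<And>u. u \<in> carrier A \<Longrightarrow> g (S u) = f (s u, \<ominus>\<^bsub>B\<^esub> S u)"
      using factorsE[OF fac linear_map_compose[OF _ f]] by blast
    interpret g: linear_map R B X g by fact
    let ?g = "\<lambda>z. \<ominus>\<^bsub>X\<^esub> g (snd z)"
    have "?g z = f z" if "z \<in> a_kernel ?E M q" for z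
      using that unfolding q(3) by (auto simp: g.map_uminus g(2)[symmetric])
    moreover have "linear_map R ?E X ?g"
      by (rule linear_map_uminus[OF linear_map_compose[OF linear_map_snd[OF Lm Bm] g(1)]])
    ultimately show "\<exists>g. linear_map R ?E X g \<and> (\<forall>z\<in>carrier (?E\<lparr>carrier := a_kernel ?E M q\<rparr>). g z = f z)"
      by (intro exI[of _ ?g]) simp
  qed
qed

lemma silting_preenvelope:
  fixes T :: "('a, 'u) module"
  assumes U: "module_universe TYPE('u)" and small: "small TYPE('u) (carrier R)"
    and R: "ring R" and silting: "silting R T"
  obtains M :: "('a, 'u) module" and \<epsilon> where
    "preenvelope R (Gen R T) (regular_module R) M \<epsilon>" "M \<in> left_Ext_orth R (Gen R T)"
proof -
  define \<T> where "\<T> = Gen R T"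
  have Rm: "right_module R (regular_module R)" by (rule regular_right_module[OF R])
  obtain P \<sigma> Q \<pi> where pres: "projective_presentation R P \<sigma> Q \<pi> T"
    and tors: "torsion_class R (D_class R P Q \<sigma>)" and TD: "T \<in> D_class R P Q \<sigma>"
    and DG: "D_class R P Q \<sigma> = \<T>"
    using silting unfolding silting_def \<T>_def by blast
  have \<T>: "torsion_class R \<T>" and TT: "T \<in> \<T>" using tors TD DG by auto
  have P: "projective R P" "P \<in> right_modules R" and Q: "projective R Q" "Q \<in> right_modules R"
    using pres by (auto simp: projective_presentation_def projective_def)
  have Pm: "right_module R P" and Qm: "right_module R Q" and Tm: "right_module R T"
    using P Q torsion_class_right_modules[OF \<T> TT] by (auto simp: right_modules_def)
  have \<sigma>: "linear_map R P Q \<sigma>" and \<pi>: "linear_map R Q T \<pi>" "\<pi> ` carrier Q = carrier T"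
    and exact: "\<sigma> ` carrier P = a_kernel Q T \<pi>"
    using pres Pm Qm Tm by (auto simp: projective_presentation_def epis_def intro: linear_map_of_rhom)
  interpret \<sigma>: linear_map R P Q \<sigma> by fact
  interpret \<pi>: linear_map R Q T \<pi> by fact
  have D: "X \<in> \<T> \<longleftrightarrow> X \<in> right_modules R \<and> factors R P Q \<sigma> X" for X
    unfolding DG[symmetric] by (rule D_class_iff[OF \<sigma>])
  have Psmall: "small TYPE('u) (carrier P)" and Qsmall: "small TYPE('u) (carrier Q)"
    using P(2) Q(2) by (simp_all add: right_modules_def)

  \<comment> \<open>The index set \<open>Hom(P, R)\<close> is coded by a set \<open>I\<close> of elements of the universe, because a torsion
    class is closed under direct sums with such index sets.\<close>
  have "small TYPE('u) (rhom R P (regular_module R))"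
    by (rule small_subset[OF small_PiE[OF U Psmall small]]) (auto simp: rhom_def)
  then obtain I :: "'u set" where I: "I \<approx> rhom R P (regular_module R)" "small TYPE('u) I"
    using small_code by blast
  obtain \<phi> where \<phi>: "\<phi> ` I = rhom R P (regular_module R)"
    using I(1) unfolding eqpoll_def bij_betw_def by blast
  have \<phi>lin: "linear_map R P (regular_module R) (\<phi> i)" if "i \<in> I" for i
    using \<phi> that by (intro linear_map_of_rhom Pm Rm) auto
  define A where "A = direct_sum I (\<lambda>_. P)"
  define B where "B = direct_sum I (\<lambda>_. Q)"
  have Bm: "right_module R B"
    unfolding B_def by (intro direct_sum_right_module R Qm)
  let ?a = "single I (\<lambda>_. P)" and ?b = "single I (\<lambda>_. Q)"
  have a: "linear_map R P A (?a i)" and b: "linear_map R Q B (?b i)" if "i \<in> I" for i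
    unfolding A_def B_def
    using linear_map_single[where M = "\<lambda>_. P", OF R Pm that]
      linear_map_single[where M = "\<lambda>_. Q", OF R Qm that] by auto
  define s where "s = copair I (\<lambda>_. P) (regular_module R) \<phi>"
  define \<Sigma> where "\<Sigma> = copair I (\<lambda>_. P) B (\<lambda>i x. ?b i (\<sigma> x))"
  have b\<sigma>: "linear_map R P B (\<lambda>x. ?b i (\<sigma> x))" if "i \<in> I" for i
    by (rule linear_map_compose[OF \<sigma> b[OF that]])
  have s: "linear_map R A (regular_module R) s"
    unfolding A_def s_def by (rule linear_map_direct_sum[OF R Pm Rm \<phi>lin])
  have \<Sigma>: "linear_map R A B \<Sigma>"
    unfolding A_def \<Sigma>_def by (rule linear_map_direct_sum[OF R Pm Bm b\<sigma>])
  have s_single: "s (?a i x) = \<phi> i x" if "i \<in> I" "x \<in> carrier P" for i x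
    unfolding s_def using copair_single[where M = "\<lambda>_. P" and g = \<phi>, OF Rm \<phi>lin that] .
  have \<Sigma>_single: "\<Sigma> (?a i x) = ?b i (\<sigma> x)" if "i \<in> I" "x \<in> carrier P" for i x
    unfolding \<Sigma>_def
    using copair_single[where M = "\<lambda>_. P" and g = "\<lambda>i x. ?b i (\<sigma> x)", OF Bm b\<sigma> that] .
  have facA: "factors R A B \<Sigma> X" if "X \<in> \<T>" for X
    unfolding A_def B_def \<Sigma>_def
    by (rule factors_direct_sum[where P = "\<lambda>_. P" and Q = "\<lambda>_. Q" and \<sigma> = "\<lambda>_. \<sigma>", OF R \<sigma>])
      (use that D in blast)

  have Bsmall: "small TYPE('u) (carrier B)"
    unfolding B_def by (rule small_direct_sum[OF U I(2) Qsmall])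
  have smallR': "small TYPE('u) (carrier (regular_module R))" using small by simp
  obtain M :: "('a, 'u) module" and \<epsilon> \<beta> where M: "M \<in> right_modules R"
    and \<epsilon>: "linear_map R (regular_module R) M \<epsilon>" and \<beta>: "linear_map R B M \<beta>"
    and push: "\<And>u. u \<in> carrier A \<Longrightarrow> \<epsilon> (s u) = \<beta> (\<Sigma> u)"
    and q: "(\<lambda>z. \<epsilon> (fst z) \<oplus>\<^bsub>M\<^esub> \<beta> (snd z)) ` carrier (direct_sum2 (regular_module R) B) = carrier M"
      "a_kernel (direct_sum2 (regular_module R) B) M (\<lambda>z. \<epsilon> (fst z) \<oplus>\<^bsub>M\<^esub> \<beta> (snd z))
        = (\<lambda>u. (s u, \<ominus>\<^bsub>B\<^esub> \<Sigma> u)) ` carrier A"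
    by (rule ex_pushout[OF U smallR' Bsmall s \<Sigma>]) blast
  let ?E = "direct_sum2 (regular_module R) B" and ?q = "\<lambda>z. \<epsilon> (fst z) \<oplus>\<^bsub>M\<^esub> \<beta> (snd z)"
  interpret \<epsilon>: linear_map R "regular_module R" M \<epsilon> by fact
  interpret \<beta>: linear_map R B M \<beta> by fact
  have Mm: "right_module R M" and Msmall: "small TYPE('u) (carrier M)"
    using M by (simp_all add: right_modules_def)
  have qlin: "linear_map R ?E M ?q" by (rule linear_map_copair[OF \<epsilon> \<beta>])
  have env: "factors R (regular_module R) M \<epsilon> X" if "X \<in> \<T>" for X
    using factors_pushout(1)[OF \<Sigma> s qlin q facA[OF that]] unfolding factors_def by simp

  have MT: "M \<in> \<T>"
  proof -
    let ?H = "\<epsilon> ` carrier (regular_module R)"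
    have H: "submodule ?H R M" by (rule \<epsilon>.submodule_image[OF \<epsilon>.M.submodule_carrier])
    \<comment> \<open>Modulo \<open>\<epsilon>(R)\<close> the pushout is generated by the images of the copies of \<open>Q\<close>, and on each of these
      the relations make \<open>\<sigma>(P)\<close> vanish, so each of them contributes an image of \<open>T\<close>.\<close>
    obtain F :: "('a, 'u) module" and p where F: "F \<in> right_modules R"
      and p: "linear_map R M F p" "p ` carrier M = carrier F" "a_kernel M F p = ?H"
      using ex_quotient[OF Mm Msmall H] by blast
    interpret p: linear_map R M F p by fact
    have Fm: "right_module R F" by (rule p.N.right_module_axioms)
    have p\<epsilon>: "p (\<epsilon> r) = \<zero>\<^bsub>F\<^esub>" if "r \<in> carrier R" for r using p(3) that by auto
    have p\<beta>: "linear_map R B F (\<lambda>y. p (\<beta> y))" by (rule linear_map_compose[OF \<beta> p(1)])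
    have "\<exists>g. linear_map R T F g \<and> (\<forall>y \<in> carrier Q. g (\<pi> y) = p (\<beta> (?b i y)))" if i: "i \<in> I" for i
    proof -
      have lin: "linear_map R Q F (\<lambda>y. p (\<beta> (?b i y)))" by (rule linear_map_compose[OF b[OF i] p\<beta>])
      have "p (\<beta> (?b i (\<sigma> x))) = \<zero>\<^bsub>F\<^esub>" if x: "x \<in> carrier P" for x
      proof -
        have ax: "?a i x \<in> carrier A" by (rule linear_mapD(3)[OF a[OF i] x])
        have "p (\<beta> (\<Sigma> (?a i x))) = \<zero>\<^bsub>F\<^esub>"
          using p\<epsilon>[of "s (?a i x)"] linear_mapD(3)[OF s ax] push[OF ax] by simp
        then show ?thesis using \<Sigma>_single[OF i x] by simp
      qed
      then have "a_kernel Q T \<pi> \<subseteq> a_kernel Q F (\<lambda>y. p (\<beta> (?b i y)))"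
        unfolding exact[symmetric] by auto
      then obtain g where "linear_map R T F g" "\<And>y. y \<in> carrier Q \<Longrightarrow> g (\<pi> y) = p (\<beta> (?b i y))"
        using linear_map_factor[OF \<pi> lin] by blast
      then show ?thesis by (intro exI[of _ g]) simp
    qed
    then obtain g where g: "\<And>i. i \<in> I \<Longrightarrow> linear_map R T F (g i)"
      "\<And>i y. i \<in> I \<Longrightarrow> y \<in> carrier Q \<Longrightarrow> g i (\<pi> y) = p (\<beta> (?b i y))" by metis
    let ?C = "direct_sum I (\<lambda>_. T)"
    let ?c = "single I (\<lambda>_. T)" and ?G = "copair I (\<lambda>_. T) F g"
    have Cm: "right_module R ?C" by (intro direct_sum_right_module R Tm)
    have c: "linear_map R T ?C (?c i)" if "i \<in> I" for i
      using linear_map_single[where M = "\<lambda>_. T", OF R Tm that] .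
    have G: "linear_map R ?C F ?G" by (rule linear_map_direct_sum[OF R Tm Fm g(1)])
    let ?\<Pi> = "copair I (\<lambda>_. Q) ?C (\<lambda>i y. ?c i (\<pi> y))"
    have c\<pi>: "linear_map R Q ?C (\<lambda>y. ?c i (\<pi> y))" if "i \<in> I" for i
      by (rule linear_map_compose[OF \<pi>(1) c[OF that]])
    have \<Pi>: "linear_map R B ?C ?\<Pi>"
      unfolding B_def by (rule linear_map_direct_sum[OF R Qm Cm c\<pi>])
    have G\<Pi>: "?G (?\<Pi> y) = p (\<beta> y)" if y: "y \<in> carrier B" for y
    proof (rule direct_sum_map_eqI[where M = "\<lambda>_. Q" and I = I and h = "\<lambda>y. ?G (?\<Pi> y)" and k = "\<lambda>y. p (\<beta> y)"])
      show "linear_map R (direct_sum I (\<lambda>_. Q)) F (\<lambda>y. ?G (?\<Pi> y))"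
        using linear_map_compose[OF \<Pi> G] unfolding B_def .
      show "linear_map R (direct_sum I (\<lambda>_. Q)) F (\<lambda>y. p (\<beta> y))" using p\<beta> unfolding B_def .
      show "y \<in> carrier (direct_sum I (\<lambda>_. Q))" using y unfolding B_def .
      show "?G (?\<Pi> (?b i x)) = p (\<beta> (?b i x))" if "i \<in> I" "x \<in> carrier Q" for i x
        using copair_single[where M = "\<lambda>_. Q" and g = "\<lambda>i y. ?c i (\<pi> y)", OF Cm c\<pi> that]
          copair_single[where M = "\<lambda>_. T" and g = g, OF Fm g(1) that(1) \<pi>.map_closed[OF that(2)]]
          g(2)[OF that] by simp
    qed (rule Qm)
    have "?G ` carrier ?C = carrier F"
    proof (intro equalityI subsetI)
      fix x assume "x \<in> carrier F"
      then obtain m where m: "m \<in> carrier M" "x = p m" using p(2) by blast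
      have "m \<in> ?q ` carrier ?E" unfolding q(1) by (rule m(1))
      then obtain r y where ry: "r \<in> carrier R" "y \<in> carrier B" "m = \<epsilon> r \<oplus>\<^bsub>M\<^esub> \<beta> y" by auto
      have "x = p (\<beta> y)" using m ry p\<epsilon> by (simp add: p.map_add)
      then have "x = ?G (?\<Pi> y)" using G\<Pi> ry by simp
      then show "x \<in> ?G ` carrier ?C" using linear_mapD(3)[OF \<Pi> ry(2)] by blast
    qed (use linear_mapD(3)[OF G] in auto)
    then have FT: "F \<in> \<T>" using torsion_class_direct_sum_epi[OF U \<T> TT I(2) F G] by blast

    have "factors R P Q \<sigma> M"
    proof (rule factorsI)
      fix f assume f: "linear_map R P M f"
      interpret f: linear_map R P M f by fact
      have facF: "factors R P Q \<sigma> F" using FT D by blast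
      obtain g where g: "linear_map R Q F g" "\<And>x. x \<in> carrier P \<Longrightarrow> g (\<sigma> x) = p (f x)"
        using factorsE[OF facF linear_map_compose[OF f p(1)]] by blast
      obtain g' where g': "linear_map R Q M g'" "\<And>y. y \<in> carrier Q \<Longrightarrow> p (g' y) = g y"
        using liftsE[OF projective_lifts[OF Q(1) Msmall] p(1,2) g(1)] F by (auto simp: right_modules_def)
      interpret g': linear_map R Q M g' by fact
      have d: "linear_map R P (M\<lparr>carrier := ?H\<rparr>) (\<lambda>x. f x \<ominus>\<^bsub>M\<^esub> g' (\<sigma> x))"
      proof (rule linear_map_corestrict[OF linear_map_minus[OF f linear_map_compose[OF \<sigma> g'(1)]] H])
        fix x assume x: "x \<in> carrier P"
        then have "p (f x \<ominus>\<^bsub>M\<^esub> g' (\<sigma> x)) = \<zero>\<^bsub>F\<^esub>"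
          using g g' by (simp add: p.map_minus p.N.minus_eq_zero_iff)
        then show "f x \<ominus>\<^bsub>M\<^esub> g' (\<sigma> x) \<in> ?H" using x unfolding p(3)[symmetric] by simp
      qed
      have \<epsilon>': "linear_map R (regular_module R) (M\<lparr>carrier := ?H\<rparr>) \<epsilon>"
        by (rule linear_map_corestrict[OF \<epsilon> H]) simp
      have "small TYPE('u) ?H" using small_image[OF small] by simp
      then obtain \<psi> where \<psi>: "linear_map R P (regular_module R) \<psi>"
        "\<And>x. x \<in> carrier P \<Longrightarrow> \<epsilon> (\<psi> x) = f x \<ominus>\<^bsub>M\<^esub> g' (\<sigma> x)"
        using liftsE[OF projective_lifts[OF P(1)] \<epsilon>' _ d] small by auto
      \<comment> \<open>The lifted remainder is itself one of the indices, and the corresponding copy of \<open>\<sigma>\<close> factors it.\<close>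
      obtain i where i: "i \<in> I" "\<phi> i = restrict \<psi> (carrier P)"
        using restrict_rhom[OF \<psi>(1)] unfolding \<phi>[symmetric] by (metis imageE)
      have "g' (\<sigma> x) \<oplus>\<^bsub>M\<^esub> \<beta> (?b i (\<sigma> x)) = f x" if x: "x \<in> carrier P" for x
      proof -
        have ax: "?a i x \<in> carrier A" by (rule linear_mapD(3)[OF a[OF i(1)] x])
        have "f x \<ominus>\<^bsub>M\<^esub> g' (\<sigma> x) = \<epsilon> (s (?a i x))"
          using \<psi>(2)[OF x] s_single[OF i(1) x] i(2) x by simp
        also have "\<dots> = \<beta> (?b i (\<sigma> x))" using push[OF ax] \<Sigma>_single[OF i(1) x] by simp
        finally show ?thesis using x \<epsilon>.N.add_minus_cancel[of "f x" "g' (\<sigma> x)"] by simp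
      qed
      then show "\<exists>g. linear_map R Q M g \<and> (\<forall>x\<in>carrier P. g (\<sigma> x) = f x)"
        by (intro exI[of _ "\<lambda>y. g' y \<oplus>\<^bsub>M\<^esub> \<beta> (?b i y)"] conjI ballI
            linear_map_add[OF g'(1) linear_map_compose[OF b[OF i(1)] \<beta>]])
    qed
    then show ?thesis using D M by blast
  qed

  have "trivial_group (Ext1 R M X)" if X: "X \<in> \<T>" for X
  proof -
    have Xm: "right_module R X"
      using torsion_class_right_modules[OF \<T> X] by (simp add: right_modules_def)
    have Fsmall: "small TYPE('u) (carrier (free_module R (carrier M)))"
      unfolding free_module_def by (rule small_direct_sum[OF U Msmall]) (simp add: small)
    have lift: "lifts R ?E (free_module R (carrier M)) M"
      unfolding B_def
      by (intro lifts_direct_sum2 lifts_direct_sum lifts_regular R Qm Rm direct_sum_right_module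
          projective_lifts[OF Q(1) Fsmall Msmall])
    have "factors R (?E\<lparr>carrier := a_kernel ?E M ?q\<rparr>) ?E (\<lambda>z. z) X"
      by (rule factors_pushout(2)[OF \<Sigma> s qlin q facA[OF X]])
    then show ?thesis using Ext1_trivial_iff[OF Mm Xm qlin q(1) lift] by simp
  qed
  then have orth: "M \<in> left_Ext_orth R \<T>" using M by (simp add: left_Ext_orth_def)
  have "restrict \<epsilon> (carrier R) \<in> rhom R (regular_module R) M" using restrict_rhom[OF \<epsilon>] by simp
  moreover have "factors R (regular_module R) M (restrict \<epsilon> (carrier R)) X" if "X \<in> \<T>" for X
    using env[OF that] unfolding factors_def by simp
  ultimately have "preenvelope R \<T> (regular_module R) M (restrict \<epsilon> (carrier R))"
    using MT unfolding preenvelope_iff[OF \<T> R] by blast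
  then show thesis using that orth unfolding \<T>_def by blast
qed

theorem theorem2p4:
  fixes R :: "('a, 'r) ring_scheme" and \<T> :: "('a, 'u) module set"
  assumes "ring R"
    and "module_universe TYPE('u)"
    and "small TYPE('u) (carrier R)"
    and "right_perfect TYPE('u) R"
    and "torsion_class R \<T>"
  shows "((\<exists>T. silting R T \<and> \<T> = Gen R T) \<longleftrightarrow>
          (\<exists>M \<epsilon>. preenvelope R \<T> (regular_module R) M \<epsilon> \<and> M \<in> \<T> \<inter> left_Ext_orth R \<T>)) \<and>
         (\<forall>M \<epsilon>. preenvelope R \<T> (regular_module R) M \<epsilon> \<and> M \<in> \<T> \<inter> left_Ext_orth R \<T> \<longrightarrow>
            (\<exists>N \<in> right_modules R :: ('a, 'u) module set.
               isomorphic R (direct_sum2 M (cokernel (regular_module R) M \<epsilon>)) N) \<and>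
            (\<forall>N \<in> right_modules R :: ('a, 'u) module set.
               isomorphic R (direct_sum2 M (cokernel (regular_module R) M \<epsilon>)) N \<longrightarrow>
                 silting R N \<and> \<T> = Gen R N))"
proof -
  note R = assms(1) and U = assms(2) and small = assms(3) and perfect = assms(4) and \<T> = assms(5)
  have ex: "\<exists>N \<in> right_modules R :: ('a, 'u) module set.
      isomorphic R (direct_sum2 M (cokernel (regular_module R) M \<epsilon>)) N"
    if pre: "preenvelope R \<T> (regular_module R) M \<epsilon>" for M \<epsilon>
  proof -
    have Rm: "right_module R (regular_module R)" by (rule regular_right_module[OF R])
    have MT: "M \<in> \<T>" and \<epsilon>: "\<epsilon> \<in> rhom R (regular_module R) M"
      using pre unfolding preenvelope_def by auto
    have Mm: "right_module R M" and Msmall: "small TYPE('u) (carrier M)"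
      using torsion_class_right_modules[OF \<T> MT] by (simp_all add: right_modules_def)
    interpret \<epsilon>: linear_map R "regular_module R" M \<epsilon> by (rule linear_map_of_rhom[OF \<epsilon> Rm Mm])
    let ?H = "\<epsilon> ` carrier (regular_module R)" and ?K = "cokernel (regular_module R) M \<epsilon>"
    have H: "submodule ?H R M" by (rule \<epsilon>.submodule_image[OF \<epsilon>.M.submodule_carrier])
    have Km: "right_module R ?K" and Ksmall: "small TYPE('u) (carrier ?K)"
      unfolding cokernel_def quotient_module_map(2)[OF Mm H, symmetric]
      by (rule linear_mapD(2)[OF quotient_module_map(1)[OF Mm H]] small_image[OF Msmall])+
    have "small TYPE('u) (carrier (direct_sum2 M ?K))" by (simp add: small_Times[OF U Msmall Ksmall])
    then obtain N :: "('a, 'u) module" and b where N: "N \<in> right_modules R"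
      "linear_map R (direct_sum2 M ?K) N b" "bij_betw b (carrier (direct_sum2 M ?K)) (carrier N)"
      using ex_copy[OF direct_sum2_right_module[OF Mm Km]] by blast
    have "bij_betw (restrict b (carrier (direct_sum2 M ?K))) (carrier (direct_sum2 M ?K)) (carrier N)"
      using N(3) by (subst bij_betw_restrict_eq)
    then have "isomorphic R (direct_sum2 M ?K) N"
      unfolding isomorphic_def using restrict_rhom[OF N(2)] by blast
    then show ?thesis using N(1) by blast
  qed
  have main: "silting R N \<and> \<T> = Gen R N"
    if "preenvelope R \<T> (regular_module R) M \<epsilon>" "M \<in> \<T> \<inter> left_Ext_orth R \<T>" "N \<in> right_modules R"
      "isomorphic R (direct_sum2 M (cokernel (regular_module R) M \<epsilon>)) N"
    for M N :: "('a, 'u) module" and \<epsilon>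
    using preenvelope_silting[OF U small perfect \<T> that(1) _ that(3,4)] that(2) by blast
  have "\<exists>M \<epsilon>. preenvelope R \<T> (regular_module R) M \<epsilon> \<and> M \<in> \<T> \<inter> left_Ext_orth R \<T>"
    if T: "silting R T" "\<T> = Gen R T" for T
  proof (rule silting_preenvelope[OF U small R T(1)])
    fix M :: "('a, 'u) module" and \<epsilon>
    assume "preenvelope R (Gen R T) (regular_module R) M \<epsilon>" "M \<in> left_Ext_orth R (Gen R T)"
    then show ?thesis unfolding T(2) preenvelope_def by blast
  qed
  moreover have "\<exists>T. silting R T \<and> \<T> = Gen R T"
    if "preenvelope R \<T> (regular_module R) M \<epsilon>" "M \<in> \<T> \<inter> left_Ext_orth R \<T>" for M \<epsilon>
    using ex[OF that(1)] main[OF that] by blast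
  ultimately show ?thesis using ex main by blast
qed

end
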